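(* Let $p$ be a complex polynomial of degree $d\ge 2$ with $d$ distinct roots, and let $\mathbf{B}_p$ be its branched annulus with its metric rectangular cell structure. Each vertex of $\mathbf{B}_p$ lying on the boundary has valence $3$. Every other vertex is labeled by a point of $\mathbb{C}$ (that is, it equals $i_B(z)$ for some $z\in\mathbb{C}\setminus\mathbf{rts}$); those labeled by a critical point of $p$ of multiplicity $k$ have valence $4(k+1)$, while the rest have valence $4$.
   Context: Branched annulus. Let $\mathbb{S}=\{u\in\mathbb{C}:|u|=1\}$, $\mathbb{I}=[-1,1]$, and let $\mathbb{A}=\mathbb{S}\times\mathbb{I}$ carry the flat product Riemannian metric (so $\mathbb{S}$ has length $2\pi$). Let $i_A\colon\mathbb{C}\setminus\{0\}\to\mathbb{A}$ be $i_A(ru)=\left(u,\frac{r^2-1}{r^2+1}\right)$ for $r>0$, $u\in\mathbb{S}$; it is a homeomorphism onto the interior $\mathbb{S}\times(-1,1)$. For a complex polynomial $p$ of degree $d$ with $d$ distinct roots, let $\mathbf{rts}$ be its set of roots, $\mathbf{cpt}$ its set of critical points (zeros of $p'$) and $\mathbf{cvl}=p(\mathbf{cpt})\subset\mathbb{C}\setminus\{0\}$ its set of critical values. The open branched annulus is $\mathbb{C}\setminus\mathbf{rts}$ with the pullback metric along $i_A\circ p$: the length of a curve is the length of its image under $i_A\circ p$, and distance is the infimum of lengths of rectifiable connecting curves. The branched annulus $\mathbb{B}_p$ is its metric completion (a compact surface with boundary whose interior is the open branched annulus), $i_B\colon\mathbb{C}\setminus\mathbf{rts}\to\mathbb{B}_p$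 is the inclusion, and $p_A\colon\mathbb{B}_p\to\mathbb{A}$ is the continuous extension of $i_A\circ p$. Cell structure (for $d\ge2$). Let $\mathbf{S}_p$ be $\mathbb{S}$ with vertex set $\{c/|c| : c\in\mathbf{cvl}\}$ and edges the arcs between them, let $\mathbf{I}_p$ be $\mathbb{I}$ with vertex set $\{-1,1\}\cup\left\{\frac{|c|^2-1}{|c|^2+1}: c\in\mathbf{cvl}\right\}$ and edges the intervals between them, and let $\mathbf{A}_p=\mathbf{S}_p\times\mathbf{I}_p$ be the product cell structure on $\mathbb{A}$. The cell complex $\mathbf{B}_p$ is $\mathbb{B}_p$ with the cell structure whose open cells are the connected components of the preimages under $p_A$ of the open cells of $\mathbf{A}_p$. The multiplicity of a critical point $b$ is its multiplicity as a root of $p'$. The valence of a vertex is the number of ends of $1$-cells at it (a loop counts twice). *)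

theory Defs
  imports "HOL-Analysis.Analysis" "HOL-Computational_Algebra.Polynomial"
begin

text \<open>
  The flat product metric on \<open>\<S> \<times> \<I>\<close>: for unit complex numbers, \<open>\<bar>Arg (u / v)\<bar>\<close> is the length of
  the shorter of the two arcs from \<open>u\<close> to \<open>v\<close>.
\<close>

definition circle_dist :: "complex \<Rightarrow> complex \<Rightarrow> real" where
  "circle_dist u v = \<bar>Arg (u / v)\<bar>"

definition annulus :: "(complex \<times> real) metric" where
  "annulus = metric (sphere 0 1 \<times> {-1..1},
     \<lambda>x y. sqrt ((circle_dist (fst x) (fst y))\<^sup>2 + (snd x - snd y)\<^sup>2))"

definition iA :: "complex \<Rightarrow> complex \<times> real" where
  "iA z = (z / of_real (cmod z), ((cmod z)\<^sup>2 - 1) / ((cmod z)\<^sup>2 + 1))"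

definition curve_length :: "'a metric \<Rightarrow> (real \<Rightarrow> 'a) \<Rightarrow> ennreal" where
  "curve_length X \<gamma> = (SUP ts\<in>{ts. sorted ts \<and> set ts \<subseteq> {0..1}}.
     ennreal (\<Sum>i<length ts - 1. mdist X (\<gamma> (ts ! i)) (\<gamma> (ts ! Suc i))))"

definition rts :: "complex poly \<Rightarrow> complex set" where
  "rts p = {z. poly p z = 0}"

definition cpt :: "complex poly \<Rightarrow> complex set" where
  "cpt p = {z. poly (pderiv p) z = 0}"

definition cvl :: "complex poly \<Rightarrow> complex set" where
  "cvl p = poly p ` cpt p"

definition pullback_length :: "complex poly \<Rightarrow> (real \<Rightarrow> complex) \<Rightarrow> ennreal" where
  "pullback_length p \<gamma> = curve_length annulus (iA \<circ> poly p \<circ> \<gamma>)"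

definition rectifiable_curves :: "complex poly \<Rightarrow> complex \<Rightarrow> complex \<Rightarrow> (real \<Rightarrow> complex) set" where
  "rectifiable_curves p z w =
     {\<gamma>. path \<gamma> \<and> path_image \<gamma> \<subseteq> - rts p \<and> pathstart \<gamma> = z \<and> pathfinish \<gamma> = w \<and>
         pullback_length p \<gamma> < \<infinity>}"

text \<open>
  \<^const>\<open>Metric_space\<close> requires the distance to be symmetric and nonnegative also off the carrier,
  hence the conventional value \<open>0\<close> there.
\<close>

definition open_branched_annulus :: "complex poly \<Rightarrow> complex metric" where
  "open_branched_annulus p = metric (- rts p,
     \<lambda>z w. if z \<in> - rts p \<and> w \<in> - rts p
           then (INF \<gamma>\<in>rectifiable_curves p z w. enn2real (pullback_length p \<gamma>)) else 0)"

definition is_metric_completion :: "'a metric \<Rightarrow> 'b metric \<Rightarrow> ('a \<Rightarrow> 'b) \<Rightarrow> bool" where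
  "is_metric_completion X Y i \<longleftrightarrow>
     mcomplete_of Y \<and> i \<in> mspace X \<rightarrow> mspace Y \<and>
     (\<forall>x\<in>mspace X. \<forall>y\<in>mspace X. mdist Y (i x) (i y) = mdist X x y) \<and>
     mtopology_of Y closure_of (i ` mspace X) = mspace Y"

lemma (in Metric_space) is_metric_completion_exists:
  "\<exists>(Y :: ('a \<Rightarrow> real) metric) i. is_metric_completion (metric (M, d)) Y i"
proof -
  obtain i :: "'a \<Rightarrow> 'a \<Rightarrow> real" and Y where
    "mcomplete_of Y" "i \<in> M \<rightarrow> mspace Y" "mtopology_of Y closure_of i ` M = mspace Y"
    "\<And>x y. \<lbrakk>x \<in> M; y \<in> M\<rbrakk> \<Longrightarrow> mdist Y (i x) (i y) = d x y"
    by (rule metric_completion) blast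
  then have "is_metric_completion (metric (M, d)) Y i"
    by (simp add: is_metric_completion_def)
  then show ?thesis
    by blast
qed

text \<open>
  A branched annulus is given as a pair \<open>B\<close>, \<open>i\<close> with
  \<open>is_metric_completion (open_branched_annulus p) B i\<close>; the map \<open>pA\<close> below is the continuous extension
  of \<open>i\<^sub>A \<circ> p\<close>, which is unique on \<open>mspace B\<close> because \<open>i\<close> has dense image.
\<close>

definition pA :: "complex poly \<Rightarrow> 'b metric \<Rightarrow> (complex \<Rightarrow> 'b) \<Rightarrow> 'b \<Rightarrow> complex \<times> real" where
  "pA p B i = (SOME f. continuous_map (mtopology_of B) (mtopology_of annulus) f \<and>
                       (\<forall>z\<in>- rts p. f (i z) = iA (poly p z)))"

text \<open>The open \<open>k\<close>-cells of a 1-dimensional complex with underlying space \<open>X\<close> and vertex set \<open>V\<close>.\<close>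

definition graph_cells :: "'a::topological_space set \<Rightarrow> 'a set \<Rightarrow> nat \<Rightarrow> 'a set set" where
  "graph_cells X V k =
     (if k = 0 then {{v} |v. v \<in> V} else if k = 1 then components (X - V) else {})"

definition circle_cells :: "complex poly \<Rightarrow> nat \<Rightarrow> complex set set" where
  "circle_cells p = graph_cells (sphere 0 1) {c / of_real (cmod c) |c. c \<in> cvl p}"

definition interval_cells :: "complex poly \<Rightarrow> nat \<Rightarrow> real set set" where
  "interval_cells p =
     graph_cells {-1..1} ({-1, 1} \<union> {((cmod c)\<^sup>2 - 1) / ((cmod c)\<^sup>2 + 1) |c. c \<in> cvl p})"

definition annulus_cells :: "complex poly \<Rightarrow> nat \<Rightarrow> (complex \<times> real) set set" where
  "annulus_cells p k = {e \<times> f |e f i j. e \<in> circle_cells p i \<and> f \<in> interval_cells p j \<and> i + j = k}"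

definition branched_cells ::
    "complex poly \<Rightarrow> 'b metric \<Rightarrow> (complex \<Rightarrow> 'b) \<Rightarrow> nat \<Rightarrow> 'b set set" where
  "branched_cells p B i k =
     (\<Union>e\<in>annulus_cells p k.
        connected_components_of (subtopology (mtopology_of B) {x \<in> mspace B. pA p B i x \<in> e}))"

definition branched_vertices :: "complex poly \<Rightarrow> 'b metric \<Rightarrow> (complex \<Rightarrow> 'b) \<Rightarrow> 'b set" where
  "branched_vertices p B i = \<Union> (branched_cells p B i 0)"

text \<open>
  A characteristic map of the open 1-cell \<open>e\<close>. Any two of them differ by a homeomorphism of
  \<open>[0,1]\<close>, so the choice made in \<open>valence\<close> is immaterial.
\<close>

definition is_edge_map :: "'b topology \<Rightarrow> 'b set \<Rightarrow> (real \<Rightarrow> 'b) \<Rightarrow> bool" where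
  "is_edge_map X e \<phi> \<longleftrightarrow>
     continuous_map (top_of_set {0..1}) X \<phi> \<and>
     homeomorphic_map (top_of_set {0<..<1}) (subtopology X e) \<phi>"

definition edge_map :: "'b topology \<Rightarrow> 'b set \<Rightarrow> real \<Rightarrow> 'b" where
  "edge_map X e = (SOME \<phi>. is_edge_map X e \<phi>)"

text \<open>An end of the 1-cell \<open>e\<close> is a pair \<open>(e, t)\<close> with \<open>t \<in> {0, 1}\<close>, so that a loop has two ends at its vertex.\<close>

definition valence :: "complex poly \<Rightarrow> 'b metric \<Rightarrow> (complex \<Rightarrow> 'b) \<Rightarrow> 'b \<Rightarrow> nat" where
  "valence p B i v =
     card {(e, t). e \<in> branched_cells p B i 1 \<and> t \<in> {0, 1} \<and> edge_map (mtopology_of B) e t = v}"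

text \<open>
  The boundary of a topological surface: the points without an open neighbourhood homeomorphic
  to the plane.
\<close>

definition surface_boundary :: "'b topology \<Rightarrow> 'b set" where
  "surface_boundary X = {x \<in> topspace X.
     \<not> (\<exists>U. openin X U \<and> x \<in> U \<and> subtopology X U homeomorphic_space (euclidean :: complex topology))}"

end

theory Submission
  imports Defs "HOL-Complex_Analysis.Complex_Analysis"
    "HOL-Computational_Algebra.Fundamental_Theorem_Algebra"
begin

text \<open>
  The branched annulus is replaced by a concrete compact model \<open>K\<close>: the closure of the graph-like set of
  points \<open>J z = (z / (1 + \<bar>z\<bar>), i\<^sub>A (p z))\<close>. Besides these points it contains one circle for each root and
  one circle at infinity, the latter covering the top circle of the annulus \<open>d\<close> times. Each fibre of the
  projection \<open>K \<rightarrow> \<A>\<close> has \<open>d\<close> points counted with multiplicity, and each point \<open>x\<close> of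
  multiplicity \<open>m\<close> has a neighbourhood meeting every fibre in at most \<open>m\<close> points. By compactness and
  counting these bounds are attained, so the projection is a covering away from the critical values:
  every edge of the annulus lifts to edges of the model, and exactly \<open>m\<close> lifts of an edge end at
  \<open>x\<close>. Vertices of the annulus have valence \<open>4\<close> in the interior and \<open>3\<close> on the boundary.

  The model is homeomorphic to the completion because \<open>J\<close> and its inverse are uniformly continuous for
  the path metric: a short curve cannot leave a small ball around a point of \<open>K\<close> since fibres
  are finite, and conversely nearby points of the model are joined by short curves, namely straight
  segments of the plane, or lifts of straight segments of the annulus near the boundary.
\<close>

subsection \<open>Branched covers of compact sets\<close>

text \<open>Valence and boundary are topological notions, so they may be computed in any
  homeomorphic copy of the completion. The coordinate \<open>squash z\<close> separates the
  \<open>d\<close> sheets that \<open>iA\<close> after \<open>p\<close> identifies, and it adds a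
  circle of directions at infinity instead of a single point. This is what the top boundary needs:
  near infinity \<open>p\<close> behaves like its leading term, so a direction \<open>e\<close> is
  sent to a unit multiple of \<open>e ^ d\<close>. At a root the closure adds one full circle,
  covered once, because the \<open>d\<close> roots are distinct and hence simple. The obstacle is
  the boundary of \<open>K\<close>, which is given only as a set of limit points and comes without
  an analytic chart. Upper bounds for the number of nearby points are within reach there, while
  surjectivity and path lifting up to the boundary are not visible directly. They are obtained
  globally: the bounds over one fibre add up to \<open>d\<close>, and a nearby unbranched fibre has
  exactly \<open>d\<close> points, so no bound can be strict.\<close>

locale branched_cover =
  fixes K :: "'a::real_normed_vector set" and P :: "'a \<Rightarrow> 'b::real_normed_vector"
    and A :: "'b set" and m :: "'a \<Rightarrow> nat" and d :: nat
  assumes compact_K: "compact K"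
    and continuous_P: "continuous_on K P"
    and P_in_A: "P ` K \<subseteq> A"
    and finite_preimage: "a \<in> A \<Longrightarrow> finite {x \<in> K. P x = a}"
    and degree_preimage: "a \<in> A \<Longrightarrow> (\<Sum>x | x \<in> K \<and> P x = a. m x) = d"
    and local_mult: "x \<in> K \<Longrightarrow> \<exists>N. open N \<and> x \<in> N \<and> (\<forall>a. card {y \<in> K \<inter> N. P y = a} \<le> m x)"
begin

definition fibre :: "'b \<Rightarrow> 'a set" where
  "fibre a = {x \<in> K. P x = a}"

lemma in_fibre: "x \<in> fibre a \<longleftrightarrow> x \<in> K \<and> P x = a"
  by (simp add: fibre_def)

lemma finite_fibre: "a \<in> A \<Longrightarrow> finite (fibre a)"
  by (simp add: fibre_def finite_preimage)

lemma degree_fibre: "a \<in> A \<Longrightarrow> sum m (fibre a) = d"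
  by (simp add: fibre_def degree_preimage)

text \<open>Upper semicontinuity of fibres: the part of \<open>K\<close> outside the given
  neighbourhoods is compact, so its image is closed, and it misses \<open>a\<close>.\<close>

lemma fibre_near:
  assumes "\<And>x. x \<in> fibre a \<Longrightarrow> open (N x) \<and> x \<in> N x"
  shows "\<exists>\<delta>>0. \<forall>b. dist b a < \<delta> \<longrightarrow> fibre b \<subseteq> (\<Union>x\<in>fibre a. N x)"
proof -
  define C where "C = K - (\<Union>x\<in>fibre a. N x)"
  have "compact C"
    unfolding C_def using assms compact_K by (intro compact_diff open_UN) auto
  then have "closed (P ` C)"
    using continuous_P by (intro compact_imp_closed compact_continuous_image)
      (auto simp: C_def intro: continuous_on_subset)
  moreover have "a \<notin> P ` C"
    using assms by (auto simp: C_def in_fibre)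
  ultimately obtain \<delta> where "\<delta> > 0" "ball a \<delta> \<subseteq> - P ` C"
    by (metis ComplI open_Compl open_contains_ball)
  then show ?thesis
    by (intro exI[of _ \<delta>]) (auto simp: C_def dist_commute subset_iff in_fibre)
qed

text \<open>A finite fibre has a positive least distance \<eta>, so the neighbourhoods from
  \<open>local_mult\<close> can be cut down to small disjoint ones.\<close>

lemma fibre_separated:
  assumes "a \<in> A" "\<epsilon> > 0"
  shows "\<exists>N. (\<forall>x\<in>fibre a. open (N x) \<and> x \<in> N x \<and> N x \<subseteq> ball x \<epsilon> \<and> (\<forall>b. card (fibre b \<inter> N x) \<le> m x)) \<and>
    (\<forall>x\<in>fibre a. \<forall>y\<in>fibre a. x \<noteq> y \<longrightarrow> N x \<inter> N y = {})"
proof -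
  have fin: "finite (fibre a)"
    using assms finite_fibre by blast
  have "\<exists>\<eta>>0. \<forall>x\<in>fibre a. \<forall>y\<in>fibre a. x \<noteq> y \<longrightarrow> \<eta> \<le> dist x y"
  proof -
    \<comment> \<open>The extra element keeps \<open>Min D\<close> meaningful when the fibre has
      fewer than two points.\<close>
    define D where "D = insert 1 ((\<lambda>(x, y). dist x y) ` (fibre a \<times> fibre a - Id))"
    have "finite D"
      unfolding D_def using fin by simp
    moreover have "D \<noteq> {}" "\<forall>t\<in>D. t > 0"
      by (auto simp: D_def)
    ultimately have "Min D > 0" "\<forall>t\<in>D. Min D \<le> t"
      by simp_all
    moreover have "dist x y \<in> D" if "x \<in> fibre a" "y \<in> fibre a" "x \<noteq> y" for x y
      unfolding D_def using that by force
    ultimately show ?thesis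
      by blast
  qed
  then obtain \<eta> where "\<eta> > 0" and sep: "\<forall>x\<in>fibre a. \<forall>y\<in>fibre a. x \<noteq> y \<longrightarrow> \<eta> \<le> dist x y"
    by (elim exE conjE)
  have "\<forall>x\<in>fibre a. \<exists>N. open N \<and> x \<in> N \<and> (\<forall>a. card {y \<in> K \<inter> N. P y = a} \<le> m x)"
    by (intro ballI local_mult) (simp add: in_fibre)
  from bchoice[OF this] obtain N0 where
    N0: "\<forall>x\<in>fibre a. open (N0 x) \<and> x \<in> N0 x \<and> (\<forall>b. card {y \<in> K \<inter> N0 x. P y = b} \<le> m x)"
    by (elim exE)
  \<comment> \<open>Balls of radius \<eta> / 2 around points at distance at least \<eta> are
    disjoint.\<close>
  define N where "N x = N0 x \<inter> ball x (min \<epsilon> (\<eta> / 2))" for x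
  show ?thesis
  proof (intro exI[of _ N] conjI ballI impI allI)
    show "open (N x)" "x \<in> N x" "N x \<subseteq> ball x \<epsilon>" if "x \<in> fibre a" for x
      using bspec[OF N0 that] \<open>\<eta> > 0\<close> assms(2) by (auto simp: N_def)
    show "card (fibre b \<inter> N x) \<le> m x" if "x \<in> fibre a" for x b
    \<comment> \<open>Monotonicity of \<open>card\<close> needs a finite larger set, which is known
      over \<open>A\<close>; elsewhere the fibre is empty.\<close>
    proof (cases "b \<in> A")
      case True
      have "card (fibre b \<inter> N x) \<le> card {y \<in> K \<inter> N0 x. P y = b}"
      proof (rule card_mono)
        show "finite {y \<in> K \<inter> N0 x. P y = b}"
          using finite_fibre[OF True] by (rule rev_finite_subset) (auto simp: in_fibre)
      qed (auto simp: N_def in_fibre)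
      also have "\<dots> \<le> m x"
        using bspec[OF N0 that] by simp
      finally show ?thesis .
    next
      case False
      then have "fibre b = {}"
        using P_in_A by (force simp: in_fibre)
      then show ?thesis
        by simp
    qed
    show "N x \<inter> N y = {}" if "x \<in> fibre a" "y \<in> fibre a" "x \<noteq> y" for x y
    proof (rule ccontr)
      assume "N x \<inter> N y \<noteq> {}"
      then obtain z where "dist x z < \<eta> / 2" "dist y z < \<eta> / 2"
        by (auto simp: N_def)
      then have "dist x y < \<eta>"
        by (metis dist_commute dist_triangle_half_l)
      then show False
        using sep that by fastforce
    qed
  qed
qed

text \<open>Pigeonhole: the fibre over \<open>b\<close> has \<open>d\<close> points, distributed
  over neighbourhoods whose capacities \<open>m x\<close> add up to \<open>d\<close>, so every
  capacity is exhausted.\<close>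

lemma card_fibre_near:
  assumes "a \<in> A" "b \<in> A" and all: "fibre b \<subseteq> (\<Union>x\<in>fibre a. N x)"
    and N: "\<And>x. x \<in> fibre a \<Longrightarrow> card (fibre b \<inter> N x) \<le> m x"
    and disj: "\<And>x y. x \<in> fibre a \<Longrightarrow> y \<in> fibre a \<Longrightarrow> x \<noteq> y \<Longrightarrow> N x \<inter> N y = {}"
    and one: "\<And>y. y \<in> fibre b \<Longrightarrow> m y = 1"
    and x: "x \<in> fibre a"
  shows "card (fibre b \<inter> N x) = m x"
proof (rule ccontr)
  assume "card (fibre b \<inter> N x) \<noteq> m x"
  then have less: "card (fibre b \<inter> N x) < m x"
    using N[OF x] by simp
  have "d = (\<Sum>y\<in>fibre b. m y)"
    using degree_fibre[OF \<open>b \<in> A\<close>] by simp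
  also have "\<dots> = card (fibre b)"
    using one by simp
  also have "fibre b = (\<Union>x\<in>fibre a. fibre b \<inter> N x)"
    using all by blast
  also have "card \<dots> \<le> (\<Sum>x\<in>fibre a. card (fibre b \<inter> N x))"
    using finite_fibre[OF \<open>a \<in> A\<close>] by (rule card_UN_le)
  also have "\<dots> < (\<Sum>x\<in>fibre a. m x)"
    using finite_fibre[OF \<open>a \<in> A\<close>] N x less by (intro sum_strict_mono_ex1) auto
  also have "\<dots> = d"
    using degree_fibre[OF \<open>a \<in> A\<close>] by simp
  finally show False
    by simp
qed

text \<open>With all multiplicities equal to 1, \<open>card_fibre_near\<close> puts exactly one
  point of each nearby fibre into each neighbourhood. This gives bijective sheets, and compactness
  of \<open>K\<close> makes the projection closed on them.\<close>

lemma covering_unbranched: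
  assumes "S \<subseteq> A" and one: "\<And>x. x \<in> K \<Longrightarrow> P x \<in> S \<Longrightarrow> m x = 1" and "d > 0"
  shows "covering_space (K \<inter> P -` S) P S"
  unfolding covering_space_def
proof (intro conjI ballI)
  show "continuous_on (K \<inter> P -` S) P"
    by (rule continuous_on_subset[OF continuous_P]) auto
  have "fibre a \<noteq> {}" if "a \<in> A" for a
    using degree_fibre[OF that] \<open>d > 0\<close> by auto
  then show "P ` (K \<inter> P -` S) = S"
    using \<open>S \<subseteq> A\<close> by (force simp: in_fibre)
  fix a assume "a \<in> S"
  then have "a \<in> A"
    using \<open>S \<subseteq> A\<close> by blast
  obtain N where N0: "(\<forall>x\<in>fibre a. open (N x) \<and> x \<in> N x \<and> N x \<subseteq> ball x 1 \<and> (\<forall>b. card (fibre b \<inter> N x) \<le> m x)) \<and>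
    (\<forall>x\<in>fibre a. \<forall>y\<in>fibre a. x \<noteq> y \<longrightarrow> N x \<inter> N y = {})"
    using fibre_separated[OF \<open>a \<in> A\<close> zero_less_one] by (elim exE)
  have N: "\<And>x. x \<in> fibre a \<Longrightarrow> open (N x) \<and> x \<in> N x"
    "\<And>x b. x \<in> fibre a \<Longrightarrow> card (fibre b \<inter> N x) \<le> m x"
    "\<And>x y. x \<in> fibre a \<Longrightarrow> y \<in> fibre a \<Longrightarrow> x \<noteq> y \<Longrightarrow> N x \<inter> N y = {}"
    using conjunct1[OF N0] conjunct2[OF N0] by blast+
  obtain \<delta> where \<delta>: "\<delta> > 0" "\<And>b. dist b a < \<delta> \<Longrightarrow> fibre b \<subseteq> (\<Union>x\<in>fibre a. N x)"
    using fibre_near[of a N] N(1) by blast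
  define T where "T = S \<inter> ball a \<delta>"
  define u where "u x = K \<inter> P -` T \<inter> N x" for x
  have card1: "card (fibre b \<inter> N x) = 1" if "b \<in> T" "x \<in> fibre a" for b x
  proof -
    have "card (fibre b \<inter> N x) = m x"
    proof (rule card_fibre_near[OF \<open>a \<in> A\<close> _ _ N(2) N(3) _ that(2)])
      show "fibre b \<subseteq> (\<Union>x\<in>fibre a. N x)"
        using that \<delta>(2) by (simp add: T_def dist_commute)
    qed (use that assms in \<open>auto simp: T_def in_fibre\<close>)
    then show ?thesis
      using one that \<open>a \<in> S\<close> by (auto simp: in_fibre)
  qed
  have hom: "\<exists>q. homeomorphism (u x) T P q" if x: "x \<in> fibre a" for x
  proof (rule homeomorphism_injective_closed_map)
    show "continuous_on (u x) P"
      unfolding u_def by (rule continuous_on_subset[OF continuous_P]) auto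
    show "P ` u x = T"
    proof
      show "T \<subseteq> P ` u x"
      proof
        fix b assume "b \<in> T"
        then have "fibre b \<inter> N x \<noteq> {}"
          using card1[OF _ x] by (metis card.empty zero_neq_one)
        then show "b \<in> P ` u x"
          using \<open>b \<in> T\<close> by (auto simp: u_def in_fibre)
      qed
    qed (auto simp: u_def)
    show "inj_on P (u x)"
    proof (rule inj_onI)
      fix y z assume *: "y \<in> u x" "z \<in> u x" "P y = P z"
      then have "y \<in> fibre (P y) \<inter> N x" "z \<in> fibre (P y) \<inter> N x" "P y \<in> T"
        by (auto simp: u_def in_fibre)
      then show "y = z"
        using card1[OF _ x] by (metis card_1_singletonE singletonD)
    qed
    fix U assume "closedin (top_of_set (u x)) U"
    then obtain C where C: "closed C" "U = u x \<inter> C"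
      by (auto simp: closedin_closed)
    \<comment> \<open>Removing the other sheets leaves a compact set that has the same image over
      \<open>T\<close> as the relatively closed set \<open>U\<close>.\<close>
    define E where "E = (K \<inter> C) - (\<Union>y\<in>fibre a - {x}. N y)"
    have "compact E"
      unfolding E_def using compact_K C N(1) by (intro compact_diff compact_Int_closed open_UN) auto
    then have "closed (P ` E)"
      using continuous_P by (intro compact_imp_closed compact_continuous_image)
        (auto simp: E_def intro: continuous_on_subset)
    moreover have "P ` U = T \<inter> P ` E"
    proof
      show "P ` U \<subseteq> T \<inter> P ` E"
      proof
        fix b assume "b \<in> P ` U"
        then obtain y where y: "y \<in> u x" "y \<in> C" "b = P y"
          using C(2) by blast
        then have "y \<notin> N z" if "z \<in> fibre a - {x}" for z
          using N(3)[OF x, of z] that by (auto simp: u_def)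
        then show "b \<in> T \<inter> P ` E"
          using y by (auto simp: E_def u_def)
      qed
      show "T \<inter> P ` E \<subseteq> P ` U"
      proof
        fix b assume "b \<in> T \<inter> P ` E"
        then obtain y where y: "y \<in> E" "b = P y" "b \<in> T" by blast
        then have "y \<in> fibre b" "dist b a < \<delta>"
          by (auto simp: T_def E_def dist_commute in_fibre)
        then have "y \<in> (\<Union>x\<in>fibre a. N x)"
          using \<delta>(2) by blast
        then have "y \<in> U"
          using y C(2) by (auto simp: E_def u_def)
        then show "b \<in> P ` U"
          using y by blast
      qed
    qed
    ultimately show "closedin (top_of_set T) (P ` U)"
      by (metis closedin_closed_Int)
  qed blast
  show "\<exists>T. a \<in> T \<and> openin (top_of_set S) T \<and>
          (\<exists>v. \<Union> v = K \<inter> P -` S \<inter> P -` T \<and> (\<forall>u\<in>v. openin (top_of_set (K \<inter> P -` S)) u) \<and>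
             pairwise disjnt v \<and> (\<forall>u\<in>v. \<exists>q. homeomorphism u T P q))"
  proof (intro exI[of _ T] conjI exI[of _ "u ` fibre a"] ballI)
    show "a \<in> T" "openin (top_of_set S) T"
      using \<open>a \<in> S\<close> \<delta>(1) by (auto simp: T_def openin_open)
    show "\<Union> (u ` fibre a) = K \<inter> P -` S \<inter> P -` T"
    proof
      show "K \<inter> P -` S \<inter> P -` T \<subseteq> \<Union> (u ` fibre a)"
      proof
        fix y assume y: "y \<in> K \<inter> P -` S \<inter> P -` T"
        then have "y \<in> fibre (P y)" "dist (P y) a < \<delta>"
          by (auto simp: T_def dist_commute in_fibre)
        then have "y \<in> (\<Union>x\<in>fibre a. N x)"
          using \<delta>(2) by blast
        then show "y \<in> \<Union> (u ` fibre a)"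
          using y by (auto simp: u_def)
      qed
    qed (auto simp: u_def T_def)
    have contS: "continuous_on (K \<inter> P -` S) P"
      by (rule continuous_on_subset[OF continuous_P]) auto
    fix v assume "v \<in> u ` fibre a"
    then obtain x where x: "x \<in> fibre a" "v = u x" by blast
    have "openin (top_of_set (K \<inter> P -` S)) ((K \<inter> P -` S) \<inter> P -` ball a \<delta>)"
      using contS by (simp add: continuous_openin_preimage_gen)
    moreover have "openin (top_of_set (K \<inter> P -` S)) ((K \<inter> P -` S) \<inter> N x)"
      using N(1)[OF x(1)] by (simp add: openin_open_Int)
    moreover have "v = ((K \<inter> P -` S) \<inter> P -` ball a \<delta>) \<inter> ((K \<inter> P -` S) \<inter> N x)"
      by (auto simp: x u_def T_def)
    ultimately show "openin (top_of_set (K \<inter> P -` S)) v"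
      by (simp only:) (rule openin_Int)
    show "\<exists>q. homeomorphism v T P q"
      using hom x by blast
  next
    show "pairwise disjnt (u ` fibre a)"
      unfolding pairwise_def disjnt_def u_def
      using N(3) by (smt (verit, best) disjoint_iff IntD2 imageE)
  qed
qed

end

subsection \<open>Ends of edges\<close>

text \<open>The contribution of a single 1-cell to \<open>valence\<close>; it is 2 for a loop at
  \<open>v\<close>.\<close>

definition ends :: "'b topology \<Rightarrow> 'b set \<Rightarrow> 'b \<Rightarrow> nat" where
  "ends X e v = card {t \<in> {0, 1}. edge_map X e t = v}"

text \<open>An increasing surjection comes below every small value, and by monotonicity it stays
  below that value from there towards 0; likewise at 1.\<close>

lemma strict_mono_onto_unit_interval_limits:
  fixes h :: "real \<Rightarrow> real"
  assumes "strict_mono_on {0<..<1} h" "h ` {0<..<1} = {0<..<1}"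
  shows "filterlim h (at 0 within {0<..<1}) (at 0 within {0<..<1})"
    and "filterlim h (at 1 within {0<..<1}) (at 1 within {0<..<1})"
proof -
  have h: "h s \<in> {0<..<1}" if "s \<in> {0<..<1}" for s
    using assms that by blast
  then have h01: "0 < h s" "h s < 1" "h s \<noteq> 0" "h s \<noteq> 1" if "0 < s" "s < 1" for s
    using that by fastforce+
  have ev: "eventually (\<lambda>s. s \<in> {0<..<1}) (at t within {0<..<1})" for t :: real
    by (simp add: eventually_at_filter)
  have "(h \<longlongrightarrow> 0) (at 0 within {0<..<1})"
  proof (rule tendstoI)
    fix \<epsilon> :: real assume "\<epsilon> > 0"
    \<comment> \<open>The cap 1/2 makes the value lie in the open interval, where \<open>h\<close>
      attains it.\<close>
    then have "min \<epsilon> (1/2) \<in> h ` {0<..<1}"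
      using assms(2) by simp
    then obtain r where r: "h r = min \<epsilon> (1/2)" "r \<in> {0<..<1}"
      by (metis imageE)
    have "eventually (\<lambda>s. s < r) (at 0 within {0<..<1})"
      using r by (intro order_tendstoD[OF tendsto_ident_at]) simp
    then show "eventually (\<lambda>s. dist (h s) 0 < \<epsilon>) (at 0 within {0<..<1})"
      using ev
    proof eventually_elim
      case (elim s)
      then have "h s < h r" "h s > 0"
        using strict_mono_onD[OF assms(1), of s r] r h[of s] by auto
      then show ?case
        using r by simp
    qed
  qed
  then show "filterlim h (at 0 within {0<..<1}) (at 0 within {0<..<1})"
    unfolding filterlim_at using ev[of 0] by (auto elim!: eventually_mono simp: h01)
  have "(h \<longlongrightarrow> 1) (at 1 within {0<..<1})"
  proof (rule tendstoI)
    fix \<epsilon> :: real assume "\<epsilon> > 0"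
    then have "max (1 - \<epsilon>) (1/2) \<in> h ` {0<..<1}"
      using assms(2) by simp
    then obtain r where r: "h r = max (1 - \<epsilon>) (1/2)" "r \<in> {0<..<1}"
      by (metis imageE)
    have "eventually (\<lambda>s. s > r) (at 1 within {0<..<1})"
      using r by (intro order_tendstoD[OF tendsto_ident_at]) simp
    then show "eventually (\<lambda>s. dist (h s) 1 < \<epsilon>) (at 1 within {0<..<1})"
      using ev
    proof eventually_elim
      case (elim s)
      then have "h s > h r" "h s < 1"
        using strict_mono_onD[OF assms(1), of r s] r h[of s] by auto
      then show ?case
        using r by (simp add: dist_real_def)
    qed
  qed
  then show "filterlim h (at 1 within {0<..<1}) (at 1 within {0<..<1})"
    unfolding filterlim_at using ev[of 1] by (auto elim!: eventually_mono simp: h01)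
qed

text \<open>The limit runs within the open interval, since that is where two edge maps of one cell
  are related by a homeomorphism.\<close>

lemma edge_map_limit:
  assumes "is_edge_map X e \<phi>" "t \<in> {0..1}"
  shows "limitin X \<phi> (\<phi> t) (at t within {0<..<1})"
  unfolding limitin_def
proof (intro conjI allI impI)
  have cont: "continuous_map (top_of_set {0..1}) X \<phi>"
    using assms by (simp add: is_edge_map_def)
  then show "\<phi> t \<in> topspace X"
    using assms by (auto simp: continuous_map_def)
  fix U assume U: "openin X U \<and> \<phi> t \<in> U"
  then have "openin (top_of_set {0..1}) {s \<in> {0..1}. \<phi> s \<in> U}"
    using cont by (simp add: continuous_map_def)
  then obtain T where "open T" "{s \<in> {0..1}. \<phi> s \<in> U} = {0..1} \<inter> T"
    by (auto simp: openin_open)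
  then show "eventually (\<lambda>s. \<phi> s \<in> U) (at t within {0<..<1})"
    unfolding eventually_at_topological using U assms(2)
    by (intro exI[of _ T]) force
qed

text \<open>The transition map \<open>h\<close> between two edge maps is an injective continuous map
  of an interval, hence monotone. End points are limits, which are unique in a Hausdorff space, so
  an increasing \<open>h\<close> preserves them and a decreasing one swaps them.\<close>

lemma edge_maps_agree:
  assumes "Hausdorff_space X" "is_edge_map X e \<phi>" "is_edge_map X e \<psi>"
  shows "(\<phi> 0 = \<psi> 0 \<and> \<phi> 1 = \<psi> 1) \<or> (\<phi> 0 = \<psi> 1 \<and> \<phi> 1 = \<psi> 0)"
proof -
  let ?I = "{0<..<1::real}"
  obtain g where g: "homeomorphic_maps (top_of_set ?I) (subtopology X e) \<psi> g"
    using assms(3) unfolding is_edge_map_def homeomorphic_map_maps by blast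
  have \<phi>: "homeomorphic_map (top_of_set ?I) (subtopology X e) \<phi>"
    using assms(2) unfolding is_edge_map_def by blast
  define h where "h = g \<circ> \<phi>"
  have "homeomorphic_map (top_of_set ?I) (top_of_set ?I) h"
    unfolding h_def using \<phi> g by (meson homeomorphic_map_compose homeomorphic_map_maps homeomorphic_maps_sym)
  then have cont: "continuous_on ?I h" and inj: "inj_on h ?I" and onto: "h ` ?I = ?I"
    using homeomorphic_imp_continuous_map homeomorphic_imp_injective_map homeomorphic_imp_surjective_map
    by (fastforce simp: continuous_map_in_subtopology)+
  have eq: "\<phi> s = \<psi> (h s)" if "s \<in> ?I" for s
  proof -
    have "\<phi> s \<in> topspace (subtopology X e)"
      using homeomorphic_imp_surjective_map[OF \<phi>] that by auto
    then show ?thesis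
      using g by (simp add: h_def homeomorphic_maps_def)
  qed
  have ends: "\<phi> t = \<psi> t'" if "filterlim h (at t' within ?I) (at t within ?I)" "t \<in> {0,1}" "t' \<in> {0,1}" for t t'
  proof (rule limitin_Hausdorff_unique[OF _ _ _ assms(1)])
    show "limitin X \<phi> (\<phi> t) (at t within ?I)"
      using edge_map_limit[OF assms(2)] that by auto
    have "limitin X \<psi> (\<psi> t') (at t' within ?I)"
      using edge_map_limit[OF assms(3)] that by auto
    then have "limitin X (\<lambda>s. \<psi> (h s)) (\<psi> t') (at t within ?I)"
      unfolding limitin_def using that(1) by (auto simp: filterlim_iff)
    then show "limitin X \<phi> (\<psi> t') (at t within ?I)"
    proof (rule limitin_transform_eventually[rotated])
      show "eventually (\<lambda>s. \<psi> (h s) = \<phi> s) (at t within ?I)"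
        by (simp add: eventually_at_filter eq)
    qed
    have "t islimpt ?I"
      using that(2) by (auto simp: islimpt_greaterThanLessThan1 islimpt_greaterThanLessThan2)
    then show "at t within ?I \<noteq> bot"
      by (simp add: trivial_limit_within)
  qed
  have "strict_mono_on ?I h \<or> strict_antimono_on ?I h"
    using injective_eq_monotone_map[OF _ cont] inj by (simp add: is_interval_oo)
  then show ?thesis
  proof
    assume "strict_mono_on ?I h"
    then show ?thesis
      using strict_mono_onto_unit_interval_limits[OF _ onto] ends by blast
  next
    assume anti: "strict_antimono_on ?I h"
    \<comment> \<open>Reflection turns the decreasing case into the increasing one.\<close>
    let ?k = "\<lambda>s. 1 - h s"
    have "strict_mono_on ?I ?k"
      using anti by (auto simp: monotone_on_def)
    moreover have flip: "(\<lambda>s. 1 - s) ` ?I = ?I"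
    proof
      show "?I \<subseteq> (\<lambda>s. 1 - s) ` ?I"
        by (intro subsetI image_eqI[of _ _ "1 - s" for s]) auto
    qed auto
    then have "?k ` ?I = ?I"
      using onto by (metis image_image)
    ultimately have k: "filterlim ?k (at t within ?I) (at t within ?I)" if "t \<in> {0,1}" for t
      using strict_mono_onto_unit_interval_limits[of ?k] that by blast
    have "filterlim (\<lambda>s. 1 - s) (at (1 - t) within ?I) (at t within ?I)" if "t \<in> {0,1}" for t :: real
      unfolding filterlim_at using that
      by (auto simp: eventually_at_filter intro!: tendsto_intros)
    from filterlim_compose[OF this k]
    have "filterlim h (at (1 - t) within ?I) (at t within ?I)" if "t \<in> {0,1}" for t
      using that by simp
    from ends[OF this] show ?thesis
      by auto
  qed
qed

lemma card_end_parameters: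
  "card {t \<in> {0, 1::real}. f t = v} = (if f 0 = v then 1 else 0) + (if f 1 = v then 1 else 0)"
proof -
  have "{t \<in> {0, 1}. f t = v} = (if f 0 = v then {0} else {}) \<union> (if f 1 = v then {1} else {})"
    by auto
  then show ?thesis
    by simp
qed

text \<open>Makes the choice in \<open>edge_map\<close> harmless: swapping the two ends does not
  change how many of them are at \<open>v\<close>.\<close>

lemma ends_eq:
  assumes "Hausdorff_space X" "is_edge_map X e \<phi>"
  shows "ends X e v = card {t \<in> {0, 1}. \<phi> t = v}"
proof -
  define \<psi> where "\<psi> = edge_map X e"
  have "is_edge_map X e \<psi>"
    unfolding \<psi>_def edge_map_def by (rule someI[of _ \<phi>]) (rule assms(2))
  note ag = edge_maps_agree[OF assms(1) this assms(2)]
  show ?thesis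
    unfolding ends_def \<psi>_def[symmetric] card_end_parameters using ag by (elim disjE conjE) simp_all
qed

lemma homeomorphic_maps_top_of_set:
  "homeomorphic_maps (top_of_set S) (top_of_set T) f g \<longleftrightarrow> homeomorphism S T f g"
  by (force simp: Pi_iff homeomorphic_maps_def homeomorphism_def)

lemma is_edge_map_euclidean:
  fixes \<phi> :: "real \<Rightarrow> 'a::topological_space"
  shows "is_edge_map (top_of_set K) e \<phi> \<longleftrightarrow>
    continuous_on {0..1} \<phi> \<and> \<phi> ` {0..1} \<subseteq> K \<and> (\<exists>q. homeomorphism {0<..<1} (K \<inter> e) \<phi> q)"
proof -
  have "homeomorphic_map (top_of_set {0<..<1}) (top_of_set (K \<inter> e)) \<phi> \<longleftrightarrow>
      (\<exists>q. homeomorphism {0<..<1} (K \<inter> e) \<phi> q)"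
    unfolding homeomorphic_map_maps by (metis homeomorphic_maps_top_of_set)
  then show ?thesis
    unfolding is_edge_map_def subtopology_subtopology
    by (simp add: continuous_map_in_subtopology image_subset_iff_funcset)
qed

subsection \<open>Lifting edges\<close>

lemma connected_in_one_of_disjoint_open:
  assumes "connected S" "S \<noteq> {}" "S \<subseteq> (\<Union>x\<in>I. N x)" "\<And>x. x \<in> I \<Longrightarrow> open (N x)"
    and disj: "\<And>x y. x \<in> I \<Longrightarrow> y \<in> I \<Longrightarrow> x \<noteq> y \<Longrightarrow> N x \<inter> N y = {}"
  obtains x where "x \<in> I" "S \<subseteq> N x"
proof -
  obtain s x where s: "s \<in> S" "x \<in> I" "s \<in> N x"
    using assms(2,3) by blast
  let ?R = "\<Union>y\<in>I - {x}. N y"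
  have "open (N x)" "open ?R"
    using assms(4) s(2) by auto
  moreover have "N x \<inter> ?R \<inter> S = {}"
    using disj[OF s(2)] by blast
  moreover have "S \<subseteq> N x \<union> ?R"
    using assms(3) by blast
  moreover have "N x \<inter> S \<noteq> {}"
    using s by blast
  ultimately have "?R \<inter> S = {}"
    using connectedD[OF assms(1), of "N x" ?R] by blast
  then have "S \<subseteq> N x"
    using assms(3) by blast
  with s(2) show thesis
    by (rule that)
qed

context branched_cover
begin

text \<open>The tail of \<open>g\<close> near \<open>t\<close> is connected and is covered by small
  disjoint neighbourhoods of the fibre points, so it stays in one of them. As the fibre is finite,
  one and the same point serves for all radii.\<close>

lemma lift_limit:
  assumes cont: "continuous_on {0..1} \<phi>" and g: "continuous_on {0<..<1} g"
    and gK: "\<And>s. s \<in> {0<..<1} \<Longrightarrow> g s \<in> K \<and> P (g s) = \<phi> s"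
    and t: "t \<in> {0, 1::real}" and "\<phi> t \<in> A"
  obtains v where "v \<in> fibre (\<phi> t)" "(g \<longlongrightarrow> v) (at t within {0<..<1})"
proof -
  let ?F = "at t within {0<..<1}"
  have "t \<in> {0..1}"
    using t by auto
  have near: "\<exists>v\<in>fibre (\<phi> t). eventually (\<lambda>s. dist (g s) v < \<epsilon>) ?F" if "\<epsilon> > 0" for \<epsilon>
  proof -
    obtain N where N: "(\<forall>x\<in>fibre (\<phi> t). open (N x) \<and> x \<in> N x \<and> N x \<subseteq> ball x \<epsilon> \<and> (\<forall>b. card (fibre b \<inter> N x) \<le> m x)) \<and>
        (\<forall>x\<in>fibre (\<phi> t). \<forall>y\<in>fibre (\<phi> t). x \<noteq> y \<longrightarrow> N x \<inter> N y = {})"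
      using fibre_separated[OF \<open>\<phi> t \<in> A\<close> \<open>\<epsilon> > 0\<close>] by (elim exE)
    note N1 = bspec[OF conjunct1[OF N]]
    obtain \<delta> where \<delta>: "\<delta> > 0" "\<And>b. dist b (\<phi> t) < \<delta> \<Longrightarrow> fibre b \<subseteq> (\<Union>x\<in>fibre (\<phi> t). N x)"
      using fibre_near[of "\<phi> t" N] N1 by blast
    obtain \<eta> where \<eta>: "\<eta> > 0" "\<And>s. s \<in> {0..1} \<Longrightarrow> dist s t < \<eta> \<Longrightarrow> dist (\<phi> s) (\<phi> t) < \<delta>"
      using cont \<open>t \<in> {0..1}\<close> \<delta>(1) unfolding continuous_on_iff by metis
    define S where "S = {0<..<1} \<inter> ball t \<eta>"
    have "convex S"
      unfolding S_def by (intro convex_Int convex_ball convex_real_interval)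
    then have "connected (g ` S)"
      by (intro connected_continuous_image convex_connected continuous_on_subset[OF g]) (auto simp: S_def)
    \<comment> \<open>A parameter inside the open interval at distance less than \<eta> from
      \<open>t\<close> shows that the tail is not empty.\<close>
    moreover have "(if t = 0 then min (\<eta> / 2) (1 / 2) else max (1 - \<eta> / 2) (1 / 2)) \<in> S"
      using t \<eta>(1) by (auto simp: S_def dist_real_def min_def max_def)
    then have "g ` S \<noteq> {}"
      by blast
    moreover have "g ` S \<subseteq> (\<Union>x\<in>fibre (\<phi> t). N x)"
    proof
      fix y assume "y \<in> g ` S"
      then obtain s where s: "s \<in> S" "y = g s"
        by blast
      then have "dist (\<phi> s) (\<phi> t) < \<delta>" "y \<in> fibre (\<phi> s)"
        using \<eta>(2)[of s] gK[of s] by (auto simp: S_def dist_commute in_fibre)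
      then show "y \<in> (\<Union>x\<in>fibre (\<phi> t). N x)"
        using \<delta>(2) by blast
    qed
    ultimately obtain v where v: "v \<in> fibre (\<phi> t)" "g ` S \<subseteq> N v"
      by (rule connected_in_one_of_disjoint_open) (use N in auto)
    have "eventually (\<lambda>s. s \<in> S) ?F"
      unfolding eventually_at using \<eta>(1)
      by (intro exI[of _ \<eta>]) (auto simp: S_def dist_commute)
    then have "eventually (\<lambda>s. dist (g s) v < \<epsilon>) ?F"
    proof eventually_elim
      case (elim s)
      then have "g s \<in> ball v \<epsilon>"
        using v N1 by blast
      then show ?case
        by (simp add: dist_commute)
    qed
    with v show ?thesis by blast
  qed
  have "\<exists>v\<in>fibre (\<phi> t). \<forall>\<epsilon>>0. eventually (\<lambda>s. dist (g s) v < \<epsilon>) ?F"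
  proof (rule ccontr)
    assume "\<not> ?thesis"
    then have "\<forall>v\<in>fibre (\<phi> t). \<exists>\<epsilon>>0. \<not> eventually (\<lambda>s. dist (g s) v < \<epsilon>) ?F"
      by blast
    then obtain E where E: "\<forall>v\<in>fibre (\<phi> t). E v > 0 \<and> \<not> eventually (\<lambda>s. dist (g s) v < E v) ?F"
      by metis
    \<comment> \<open>If each point of the finite fibre fails at some radius, all of them fail at
      the least one.\<close>
    define \<epsilon> where "\<epsilon> = Min (insert 1 (E ` fibre (\<phi> t)))"
    have fin: "finite (insert 1 (E ` fibre (\<phi> t)))"
      using finite_fibre[OF \<open>\<phi> t \<in> A\<close>] by simp
    have "\<epsilon> > 0"
      unfolding \<epsilon>_def using fin E by simp
    then obtain v where v: "v \<in> fibre (\<phi> t)" "eventually (\<lambda>s. dist (g s) v < \<epsilon>) ?F"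
      using near by blast
    have "\<epsilon> \<le> E v"
      unfolding \<epsilon>_def using fin v(1) by (intro Min_le) auto
    then have "eventually (\<lambda>s. dist (g s) v < E v) ?F"
      using v(2) by (auto elim: eventually_mono)
    then show False
      using E v(1) by blast
  qed
  then show thesis
    using that by (auto simp: tendsto_iff)
qed

text \<open>The open edge is simply connected and therefore lifts through the covering over
  \<open>c\<close>. Unique lifting identifies the image with the whole component \<open>e\<close>,
  and \<open>lift_limit\<close> supplies the two end points.\<close>

lemma edge_lift:
  assumes cont: "continuous_on {0..1} \<phi>" and hom: "homeomorphism {0<..<1} c \<phi> q"
    and sub: "\<phi> ` {0..1} \<subseteq> A" and one: "\<And>x. x \<in> K \<Longrightarrow> P x \<in> c \<Longrightarrow> m x = 1" and "d > 0"
    and e: "e \<in> components (K \<inter> P -` c)"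
  obtains \<gamma> where "continuous_on {0..1::real} \<gamma>" "\<gamma> ` {0..1} \<subseteq> K"
    "\<And>s. s \<in> {0..1} \<Longrightarrow> P (\<gamma> s) = \<phi> s" "homeomorphism {0<..<1} e \<gamma> (q \<circ> P)"
proof -
  let ?I = "{0<..<1::real}"
  have c: "c = \<phi> ` ?I"
    using hom by (simp add: homeomorphism_def)
  have "c \<subseteq> A"
    unfolding c using sub by force
  then have cov: "covering_space (K \<inter> P -` c) P c"
    using covering_unbranched one \<open>d > 0\<close> by blast
  obtain x where x: "x \<in> e"
    using in_components_nonempty[OF e] by blast
  have eK: "e \<subseteq> K \<inter> P -` c"
    using in_components_subset[OF e] .
  define s0 where "s0 = q (P x)"
  have q: "q a \<in> ?I" "\<phi> (q a) = a" if "a \<in> c" for a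
    using hom that by (auto simp: homeomorphism_def)
  have q\<phi>: "q (\<phi> s) = s" if "s \<in> ?I" for s
    using hom that by (simp add: homeomorphism_def)
  have s0: "s0 \<in> ?I" "\<phi> s0 = P x"
    unfolding s0_def using q x eK by auto
  have contI: "continuous_on ?I \<phi>"
    using hom by (simp add: homeomorphism_def)
  have "x \<in> K \<inter> P -` c"
    using x eK by blast
  obtain g where g: "continuous_on ?I g" "g \<in> ?I \<rightarrow> K \<inter> P -` c" "g s0 = x" "\<And>y. y \<in> ?I \<Longrightarrow> P (g y) = \<phi> y"
  proof (rule covering_space_lift_strong[OF cov \<open>x \<in> K \<inter> P -` c\<close> s0(1) _ _ contI _ s0(2)])
    show "simply_connected ?I"
      by (simp add: convex_imp_simply_connected)
    show "locally path_connected ?I"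
      by (simp add: convex_imp_locally_path_connected)
    show "\<phi> \<in> ?I \<rightarrow> c"
      using c by blast
  qed blast
  have Pe: "continuous_on e P"
    using continuous_P eK by (meson continuous_on_subset le_inf_iff)
  have qP: "continuous_on e (q \<circ> P)"
    using Pe hom eK by (intro continuous_on_compose) (auto simp: homeomorphism_def intro: continuous_on_subset)
  have lift: "g (q (P y)) = y" if "y \<in> e" for y
  proof -
    \<comment> \<open>The identity and this composite are both lifts of \<open>P\<close> on the
      connected set \<open>e\<close>, and they agree at \<open>x\<close>.\<close>
    have "y = (g \<circ> (q \<circ> P)) y"
    proof (rule covering_space_lift_unique_gen[OF cov, where a = x and T = e and f = P and U = e and ?g1.0 = "\<lambda>y. y" and ?g2.0 = "g \<circ> (q \<circ> P)"])
      show "x = (g \<circ> (q \<circ> P)) x"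
        using g(3) by (simp add: s0_def)
      show "P \<in> e \<rightarrow> c" "(\<lambda>y. y) \<in> e \<rightarrow> K \<inter> P -` c"
        using eK by auto
      show "continuous_on e (g \<circ> (q \<circ> P))"
        by (rule continuous_on_compose[OF qP continuous_on_subset[OF g(1)]]) (use q eK in auto)
      show "g \<circ> (q \<circ> P) \<in> e \<rightarrow> K \<inter> P -` c"
      proof
        fix z assume "z \<in> e"
        then have "q (P z) \<in> ?I"
          using q eK by auto
        then show "(g \<circ> (q \<circ> P)) z \<in> K \<inter> P -` c"
          using g(2) by (auto simp: Pi_iff)
      qed
      show "P y = P ((g \<circ> (q \<circ> P)) y)" if "y \<in> e" for y
      proof -
        have "P y \<in> c" using that eK by auto
        then show ?thesis using q g(4) by simp
      qed
      show "e \<in> components e"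
        using in_components_connected[OF e] x unfolding in_components_maximal by blast
    qed (use Pe that x in auto)
    then show ?thesis by simp
  qed
  have "g ` ?I \<subseteq> e"
  proof (rule components_maximal[OF e])
    show "connected (g ` ?I)"
      by (intro connected_continuous_image g) simp
    show "e \<inter> g ` ?I \<noteq> {}"
      using x g(3) s0(1) by blast
  qed (use g(2) in blast)
  moreover have "e \<subseteq> g ` ?I"
  proof
    fix y assume "y \<in> e"
    then have "q (P y) \<in> ?I" "y = g (q (P y))"
      using lift q eK by auto
    then show "y \<in> g ` ?I"
      by (rule image_eqI[rotated])
  qed
  ultimately have e_eq: "g ` ?I = e" ..
  have limit: "\<exists>v\<in>fibre (\<phi> t). (g \<longlongrightarrow> v) (at t within ?I)" if "t \<in> {0, 1}" for t
  proof -
    have "\<phi> t \<in> A"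
      using sub that by auto
    moreover have "g s \<in> K \<and> P (g s) = \<phi> s" if "s \<in> ?I" for s
      using g(2,4) that by (auto simp: Pi_iff)
    ultimately show ?thesis
      using lift_limit[OF cont g(1) _ that] by blast
  qed
  obtain v0 v1 where v0: "v0 \<in> fibre (\<phi> 0)" "(g \<longlongrightarrow> v0) (at 0 within ?I)"
    and v1: "v1 \<in> fibre (\<phi> 1)" "(g \<longlongrightarrow> v1) (at 1 within ?I)"
    using limit[of 0] limit[of 1] by blast
  define \<gamma> where "\<gamma> s = (if s = 0 then v0 else if s = 1 then v1 else g s)" for s
  have \<gamma>g: "\<gamma> s = g s" if "s \<in> ?I" for s
    using that by (auto simp: \<gamma>_def)
  show thesis
  proof
    show "continuous_on {0..1} \<gamma>"
      unfolding continuous_on_def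
    proof
      fix s :: real assume s: "s \<in> {0..1}"
      have "(g \<longlongrightarrow> \<gamma> s) (at s within ?I)"
        using s v0(2) v1(2) g(1) by (auto simp: \<gamma>_def continuous_on_def)
      then have lim: "(\<gamma> \<longlongrightarrow> \<gamma> s) (at s within ?I)"
        by (rule Lim_transform_eventually) (auto simp: eventually_at_filter \<gamma>g)
      \<comment> \<open>The finite set of end points contributes a trivial filter, so limits within
        the open interval are enough.\<close>
      have "at s within {0..1} \<le> sup (at s within ?I) (at s within {0, 1})"
        unfolding at_within_union[symmetric] by (rule at_le) auto
      moreover have "at s within {0, 1} = bot"
        unfolding trivial_limit_within by (intro islimpt_finite) simp
      ultimately show "(\<gamma> \<longlongrightarrow> \<gamma> s) (at s within {0..1})"
        using lim by (metis sup_bot.right_neutral tendsto_mono)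
    qed
    show P\<gamma>: "P (\<gamma> s) = \<phi> s" if "s \<in> {0..1}" for s
      using v0(1) v1(1) g(4) that by (auto simp: \<gamma>_def in_fibre)
    show "\<gamma> ` {0..1} \<subseteq> K"
      using v0(1) v1(1) g(2) by (fastforce simp: \<gamma>_def in_fibre Pi_iff)
    show "homeomorphism {0<..<1} e \<gamma> (q \<circ> P)"
    proof (rule homeomorphismI)
      show "continuous_on {0<..<1} \<gamma>"
        using g(1) by (rule continuous_on_eq) (simp add: \<gamma>g)
      show "\<gamma> ` {0<..<1} \<subseteq> e"
        using e_eq \<gamma>g by auto
      show "(q \<circ> P) ` e \<subseteq> ?I"
        using q eK by auto
      show "(q \<circ> P) (\<gamma> s) = s" if "s \<in> ?I" for s
        using that by (simp add: \<gamma>g g(4) q\<phi>)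
      show "\<gamma> ((q \<circ> P) y) = y" if "y \<in> e" for y
        using that lift q eK by (subst \<gamma>g) auto
    qed (rule qP)
  qed
qed

end

lemma is_edge_map_image:
  assumes G: "homeomorphic_map Y X G" and e: "e \<subseteq> topspace Y" and \<phi>: "is_edge_map Y e \<phi>"
  shows "is_edge_map X (G ` e) (G \<circ> \<phi>)"
  unfolding is_edge_map_def
proof
  show "continuous_map (top_of_set {0..1}) X (G \<circ> \<phi>)"
    using \<phi> homeomorphic_imp_continuous_map[OF G] continuous_map_compose unfolding is_edge_map_def by blast
  have "G ` (topspace Y \<inter> e) = topspace X \<inter> G ` e"
    using homeomorphic_imp_surjective_map[OF G] e by blast
  then have "homeomorphic_map (subtopology Y e) (subtopology X (G ` e)) G"
    by (rule homeomorphic_map_subtopologies[OF G])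
  then show "homeomorphic_map (top_of_set {0<..<1}) (subtopology X (G ` e)) (G \<circ> \<phi>)"
    using \<phi> homeomorphic_map_compose unfolding is_edge_map_def by blast
qed

section \<open>Counting the lifts of an edge that end at a given point\<close>

context branched_cover
begin

text \<open>At a parameter \<open>s\<close> close to \<open>t\<close>, evaluation is a bijection
  from the lifts to the fibre over \<open>\<phi> s\<close>. The lifts ending at \<open>v\<close> are
  those passing through the neighbourhood \<open>N v\<close> at \<open>s\<close>, and
  \<open>card_fibre_near\<close> counts these.\<close>

lemma count_lifts:
  assumes cont: "continuous_on {0..1} \<phi>" and hom: "homeomorphism {0<..<1} c \<phi> q"
    and sub: "\<phi> ` {0..1} \<subseteq> A" and one: "\<And>x. x \<in> K \<Longrightarrow> P x \<in> c \<Longrightarrow> m x = 1" and "d > 0"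
    and L: "\<forall>e\<in>components (K \<inter> P -` c). continuous_on {0..1::real} (L e) \<and> L e ` {0..1} \<subseteq> K \<and>
      (\<forall>s\<in>{0..1}. P (L e s) = \<phi> s) \<and> homeomorphism {0<..<1} e (L e) (q \<circ> P)"
  shows "finite (components (K \<inter> P -` c))"
    and "t \<in> {0, 1} \<Longrightarrow> v \<in> fibre (\<phi> t) \<Longrightarrow> card {e \<in> components (K \<inter> P -` c). L e t = v} = m v"
proof -
  let ?I = "{0<..<1::real}"
  let ?C = "components (K \<inter> P -` c)"
  have c: "c = \<phi> ` ?I" and inj: "inj_on \<phi> ?I"
    using hom by (auto simp: homeomorphism_def intro: inj_on_inverseI)
  have I01: "s \<in> {0..1}" if "s \<in> ?I" for s :: real
    using that by simp
  have LP: "L e s \<in> fibre (\<phi> s)" if "e \<in> ?C" "s \<in> {0..1}" for e s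
    using bspec[OF L that(1)] that(2) unfolding in_fibre by blast
  have Le: "L e ` ?I = e" if "e \<in> ?C" for e
    using bspec[OF L that] unfolding homeomorphism_def by blast
  have injL: "inj_on (\<lambda>e. L e s) ?C" if "s \<in> ?I" for s
  proof (rule inj_onI)
    fix e e' assume *: "e \<in> ?C" "e' \<in> ?C" "L e s = L e' s"
    then have "L e s \<in> e" "L e s \<in> e'"
      using imageI[OF that, of "L e"] imageI[OF that, of "L e'"] Le by auto
    then show "e = e'"
      using *(1,2) components_nonoverlap by blast
  qed
  have surj: "\<exists>e\<in>?C. L e s = y" if s: "s \<in> ?I" and y: "y \<in> fibre (\<phi> s)" for s y
  proof -
    have "y \<in> K \<inter> P -` c"
      using y s by (auto simp: c in_fibre)
    then obtain e where e: "e \<in> ?C" "y \<in> e"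
      using Union_components by blast
    then obtain s' where s': "s' \<in> ?I" "y = L e s'"
      using Le by blast
    have "\<phi> s' = \<phi> s"
      using LP[OF e(1) I01[OF s'(1)]] y s' by (simp add: in_fibre)
    then have "s' = s"
      using inj s s' by (auto dest: inj_onD)
    with e s' show ?thesis by blast
  qed
  have A: "\<phi> s \<in> A" if "s \<in> {0..1}" for s
    using sub that by blast
  show fin: "finite ?C"
  proof (rule inj_on_finite[OF injL])
    show "(1/2::real) \<in> ?I" by simp
    show "(\<lambda>e. L e (1/2)) ` ?C \<subseteq> fibre (\<phi> (1/2))"
      using LP by auto
    show "finite (fibre (\<phi> (1/2)))"
      using A by (intro finite_fibre) simp
  qed
  show "card {e \<in> ?C. L e t = v} = m v" if t: "t \<in> {0, 1}" and v: "v \<in> fibre (\<phi> t)"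
  proof -
    have t01: "t \<in> {0..1}"
      using t by auto
    obtain N where N: "(\<forall>x\<in>fibre (\<phi> t). open (N x) \<and> x \<in> N x \<and> N x \<subseteq> ball x 1 \<and> (\<forall>b. card (fibre b \<inter> N x) \<le> m x)) \<and>
        (\<forall>x\<in>fibre (\<phi> t). \<forall>y\<in>fibre (\<phi> t). x \<noteq> y \<longrightarrow> N x \<inter> N y = {})"
      using fibre_separated[OF A[OF t01] zero_less_one] by (elim exE)
    note N1 = bspec[OF conjunct1[OF N]]
    have disj: "\<And>x y. x \<in> fibre (\<phi> t) \<Longrightarrow> y \<in> fibre (\<phi> t) \<Longrightarrow> x \<noteq> y \<Longrightarrow> N x \<inter> N y = {}"
      using conjunct2[OF N] by blast
    obtain \<delta> where \<delta>: "\<delta> > 0" "\<And>b. dist b (\<phi> t) < \<delta> \<Longrightarrow> fibre b \<subseteq> (\<Union>x\<in>fibre (\<phi> t). N x)"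
      using fibre_near[of "\<phi> t" N] N1 by blast
    obtain \<eta> where \<eta>: "\<eta> > 0" "\<And>s. s \<in> {0..1} \<Longrightarrow> dist s t < \<eta> \<Longrightarrow> dist (\<phi> s) (\<phi> t) < \<delta>"
      using cont t01 \<delta>(1) unfolding continuous_on_iff by metis
    \<comment> \<open>Half of \<eta> keeps \<open>s\<close> within distance \<eta> of
      \<open>t\<close>, and the bound 1/2 keeps it inside the open interval.\<close>
    define s where "s = (if t = 0 then min (\<eta> / 2) (1 / 2) else max (1 - \<eta> / 2) (1 / 2))"
    have s: "s \<in> ?I" "dist s t < \<eta>"
      using t \<eta>(1) by (auto simp: s_def dist_real_def min_def max_def)
    let ?S = "closed_segment s t"
    have S01: "?S \<subseteq> {0..1}"
      using s(1) t01 by (simp add: closed_segment_subset)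
    have near: "\<exists>w\<in>fibre (\<phi> t). L e ` ?S \<subseteq> N w" if e: "e \<in> ?C" for e
    proof -
      have "continuous_on ?S (L e)"
        using bspec[OF L e] S01 by (blast intro: continuous_on_subset)
      then have "connected (L e ` ?S)"
        by (intro connected_continuous_image) auto
      moreover have "L e ` ?S \<noteq> {}"
        by simp
      moreover have "L e ` ?S \<subseteq> (\<Union>x\<in>fibre (\<phi> t). N x)"
      proof
        fix y assume "y \<in> L e ` ?S"
        then obtain r where r: "r \<in> ?S" "y = L e r"
          by blast
        have "dist r t < \<eta>"
          using segment_bound[OF r(1)] s(2) by (simp add: dist_norm norm_minus_commute)
        then have "dist (\<phi> r) (\<phi> t) < \<delta>" "y \<in> fibre (\<phi> r)"
          using r S01 \<eta>(2) LP[OF e] by blast+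
        then show "y \<in> (\<Union>x\<in>fibre (\<phi> t). N x)"
          using \<delta>(2) by blast
      qed
      ultimately obtain w where "w \<in> fibre (\<phi> t)" "L e ` ?S \<subseteq> N w"
        by (rule connected_in_one_of_disjoint_open) (use N1 disj in auto)
      then show ?thesis by blast
    qed
    \<comment> \<open>The image of the segment from \<open>s\<close> to \<open>t\<close> is
      connected, so both of its ends lie in the same one of the disjoint neighbourhoods.\<close>
    have near_iff: "L e t = v \<longleftrightarrow> L e s \<in> N v" if e: "e \<in> ?C" for e
    proof -
      obtain w where w: "w \<in> fibre (\<phi> t)" "L e ` ?S \<subseteq> N w"
        using near[OF e] by blast
      have ws: "L e s \<in> N w" "L e t \<in> N w"
        using w(2) by auto
      have "L e t \<in> fibre (\<phi> t)" 
        using LP[OF e t01] .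
      then have "L e t = w"
        using ws(2) disj[OF w(1)] N1 by blast
      then show ?thesis
        using ws(1) disj[OF w(1) v] N1[OF w(1)] by blast
    qed
    have "bij_betw (\<lambda>e. L e s) {e \<in> ?C. L e t = v} (fibre (\<phi> s) \<inter> N v)"
      unfolding bij_betw_def
    proof
      show "inj_on (\<lambda>e. L e s) {e \<in> ?C. L e t = v}"
        using injL[OF s(1)] by (rule inj_on_subset) auto
      show "(\<lambda>e. L e s) ` {e \<in> ?C. L e t = v} = fibre (\<phi> s) \<inter> N v"
      proof
        show "(\<lambda>e. L e s) ` {e \<in> ?C. L e t = v} \<subseteq> fibre (\<phi> s) \<inter> N v"
          using LP[OF _ I01[OF s(1)]] near_iff by auto
        show "fibre (\<phi> s) \<inter> N v \<subseteq> (\<lambda>e. L e s) ` {e \<in> ?C. L e t = v}"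
        proof
          fix y assume y: "y \<in> fibre (\<phi> s) \<inter> N v"
          then obtain e where "e \<in> ?C" "L e s = y"
            using surj[OF s(1)] by blast
          then show "y \<in> (\<lambda>e. L e s) ` {e \<in> ?C. L e t = v}"
            using near_iff y by blast
        qed
      qed
    qed
    then have "card {e \<in> ?C. L e t = v} = card (fibre (\<phi> s) \<inter> N v)"
      by (rule bij_betw_same_card)
    also have "\<dots> = m v"
    proof (rule card_fibre_near[OF A[OF t01] A[OF I01[OF s(1)]] _ _ disj _ v])
      show "fibre (\<phi> s) \<subseteq> (\<Union>x\<in>fibre (\<phi> t). N x)"
        using \<delta>(2) \<eta>(2)[OF I01[OF s(1)] s(2)] .
      show "m y = 1" if "y \<in> fibre (\<phi> s)" for y
        using that one s(1) by (auto simp: c in_fibre)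
    qed (use N1 in auto)
    finally show ?thesis .
  qed
qed

text \<open>Double counting of pairs consisting of a lift and an end parameter: each end of
  \<open>c\<close> at \<open>P v\<close> is the projection of \<open>m v\<close> ends of lifts at
  \<open>v\<close>. Loops in the base are covered, since both parameters may contribute.\<close>

lemma ends_over_edge:
  assumes \<phi>: "is_edge_map (top_of_set A) c \<phi>" and "c \<subseteq> A"
    and one: "\<And>x. x \<in> K \<Longrightarrow> P x \<in> c \<Longrightarrow> m x = 1" and "d > 0"
    and X: "Hausdorff_space X" and G: "homeomorphic_map (top_of_set K) X G" and "v \<in> K"
  shows "finite (components (K \<inter> P -` c))"
    and "(\<Sum>e\<in>components (K \<inter> P -` c). ends X (G ` e) (G v)) = m v * ends (top_of_set A) c (P v)"
    and "e \<in> components (K \<inter> P -` c) \<Longrightarrow> \<exists>\<psi>. is_edge_map X (G ` e) \<psi>"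
proof -
  let ?C = "components (K \<inter> P -` c)"
  have "A \<inter> c = c"
    using \<open>c \<subseteq> A\<close> by blast
  then obtain q where cont: "continuous_on {0..1} \<phi>" and sub: "\<phi> ` {0..1} \<subseteq> A"
    and hom: "homeomorphism {0<..<1} c \<phi> q"
    using \<phi> unfolding is_edge_map_euclidean by auto
  have "\<forall>e\<in>?C. \<exists>\<gamma>. continuous_on {0..1::real} \<gamma> \<and> \<gamma> ` {0..1} \<subseteq> K \<and>
      (\<forall>s\<in>{0..1}. P (\<gamma> s) = \<phi> s) \<and> homeomorphism {0<..<1} e \<gamma> (q \<circ> P)"
  proof
    fix e assume "e \<in> ?C"
    from edge_lift[OF cont hom sub one \<open>d > 0\<close> this]
    show "\<exists>\<gamma>. continuous_on {0..1::real} \<gamma> \<and> \<gamma> ` {0..1} \<subseteq> K \<and>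
      (\<forall>s\<in>{0..1}. P (\<gamma> s) = \<phi> s) \<and> homeomorphism {0<..<1} e \<gamma> (q \<circ> P)"
      by metis
  qed
  from bchoice[OF this] obtain L where L: "\<forall>e\<in>?C. continuous_on {0..1::real} (L e) \<and> L e ` {0..1} \<subseteq> K \<and>
      (\<forall>s\<in>{0..1}. P (L e s) = \<phi> s) \<and> homeomorphism {0<..<1} e (L e) (q \<circ> P)"
    by (elim exE)
  have count: "finite ?C" "\<And>t v. t \<in> {0, 1} \<Longrightarrow> v \<in> fibre (\<phi> t) \<Longrightarrow> card {e \<in> ?C. L e t = v} = m v"
    using count_lifts[OF cont hom sub _ \<open>d > 0\<close> L] one by blast+
  show fin: "finite ?C"
    by (rule count(1))
  have edge: "is_edge_map X (G ` e) (G \<circ> L e)" if e: "e \<in> ?C" for e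
  proof (rule is_edge_map_image[OF G])
    show eK: "e \<subseteq> topspace (top_of_set K)"
      using in_components_subset[OF e] by auto
    then have "K \<inter> e = e"
      by auto
    then show "is_edge_map (top_of_set K) e (L e)"
      unfolding is_edge_map_euclidean using bspec[OF L e] by auto
  qed
  then show "\<exists>\<psi>. is_edge_map X (G ` e) \<psi>" if "e \<in> ?C"
    using that by blast
  have injG: "inj_on G K"
    using homeomorphic_imp_injective_map[OF G] by simp
  have "ends X (G ` e) (G v) = (\<Sum>t\<in>{0, 1}. if L e t = v then 1 else 0)" if e: "e \<in> ?C" for e
  proof -
    have "L e t \<in> K" if "t \<in> {0, 1}" for t
      using bspec[OF L e] that by auto
    then have "{t \<in> {0, 1}. (G \<circ> L e) t = G v} = {t \<in> {0, 1}. L e t = v}"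
      using inj_onD[OF injG] \<open>v \<in> K\<close> by auto
    then have "ends X (G ` e) (G v) = card {t \<in> {0, 1}. L e t = v}"
      using ends_eq[OF X edge[OF e]] by simp
    also have "\<dots> = (\<Sum>t\<in>{0, 1}. if L e t = v then 1 else 0)"
      by (simp add: sum.If_cases Int_def)
    finally show ?thesis .
  qed
  then have "(\<Sum>e\<in>?C. ends X (G ` e) (G v)) = (\<Sum>e\<in>?C. \<Sum>t\<in>{0, 1}. if L e t = v then 1 else 0)"
    by simp
  \<comment> \<open>After exchanging the sums, each inner sum has a fixed end parameter and is the
    number computed by \<open>count_lifts\<close>.\<close>
  also have "\<dots> = (\<Sum>t\<in>{0, 1}. \<Sum>e\<in>?C. if L e t = v then 1 else 0)"
    by (rule sum.swap)
  also have "\<dots> = (\<Sum>t\<in>{0, 1}. card {e \<in> ?C. L e t = v})"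
    using fin by (simp add: sum.If_cases Int_def)
  also have "\<dots> = (\<Sum>t\<in>{0, 1}. if \<phi> t = P v then m v else 0)"
  proof (rule sum.cong)
    fix t :: real assume t: "t \<in> {0, 1}"
    show "card {e \<in> ?C. L e t = v} = (if \<phi> t = P v then m v else 0)"
    proof (cases "\<phi> t = P v")
      case True
      then show ?thesis
        using count(2)[OF t, of v] \<open>v \<in> K\<close> by (simp add: in_fibre)
    next
      case False
      then have "{e \<in> ?C. L e t = v} = {}"
        using L t by fastforce
      then show ?thesis
        using False by (simp only: card.empty if_False)
    qed
  qed simp
  also have "\<dots> = m v * card {t \<in> {0, 1}. \<phi> t = P v}"
    by (simp add: sum.If_cases Int_def)
  also have "card {t \<in> {0, 1}. \<phi> t = P v} = ends (top_of_set A) c (P v)"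
    using \<phi> by (intro ends_eq[symmetric] Hausdorff_space_subtopology) auto
  finally show "(\<Sum>e\<in>?C. ends X (G ` e) (G v)) = m v * ends (top_of_set A) c (P v)" .
qed

end

subsection \<open>Gaps of finite subsets of the line and the circle\<close>

text \<open>Pairs of neighbouring elements; keeping the pair rather than the interval leaves both
  end points available for counting.\<close>

definition gaps :: "real set \<Rightarrow> (real \<times> real) set" where
  "gaps W = {(x, y). x \<in> W \<and> y \<in> W \<and> x < y \<and> W \<inter> {x<..<y} = {}}"

lemma finite_gaps:
  assumes "finite W"
  shows "finite (gaps W)"
proof (rule finite_subset)
  show "gaps W \<subseteq> W \<times> W"
    unfolding gaps_def by blast
  show "finite (W \<times> W)"
    using assms by simp
qed

lemma gap_right:
  fixes W :: "real set"
  assumes "finite W" "s < b" "b \<in> W"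
  obtains y where "y \<in> W" "s < y" "W \<inter> {s<..<y} = {}"
proof
  let ?R = "{w \<in> W. s < w}"
  have R: "finite ?R" "?R \<noteq> {}"
    using assms by auto
  show "Min ?R \<in> W" "s < Min ?R"
    using Min_in[OF R] by auto
  show "W \<inter> {s<..<Min ?R} = {}"
  proof (rule ccontr)
    assume "W \<inter> {s<..<Min ?R} \<noteq> {}"
    then obtain w where "w \<in> W \<inter> {s<..<Min ?R}"
      by blast
    then have "w \<in> ?R" "w < Min ?R"
      by simp_all
    then show False
      using Min_le[OF R(1)] by (metis not_le)
  qed
qed

lemma gap_left:
  fixes W :: "real set"
  assumes "finite W" "a < s" "a \<in> W"
  obtains x where "x \<in> W" "x < s" "W \<inter> {x<..<s} = {}"
proof
  let ?R = "{w \<in> W. w < s}"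
  have R: "finite ?R" "?R \<noteq> {}"
    using assms by auto
  show "Max ?R \<in> W" "Max ?R < s"
    using Max_in[OF R] by auto
  show "W \<inter> {Max ?R<..<s} = {}"
  proof (rule ccontr)
    assume "W \<inter> {Max ?R<..<s} \<noteq> {}"
    then obtain w where "w \<in> W \<inter> {Max ?R<..<s}"
      by blast
    then have "w \<in> ?R" "Max ?R < w"
      by simp_all
    then show False
      using Max_ge[OF R(1)] by (metis not_le)
  qed
qed

text \<open>Every element except the greatest begins exactly one gap, and every element except the
  least ends exactly one.\<close>

lemma gaps_ends:
  assumes W: "finite W" "a \<in> W" "b \<in> W" "W \<subseteq> {a..b}" and h: "h \<in> W"
  shows "(\<Sum>(x, y)\<in>gaps W. (if x = h then 1 else 0) + (if y = h then 1 else 0)) =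
    (if h < b then 1 else 0) + (if a < h then 1 else (0::nat))"
proof -
  have "card {g \<in> gaps W. fst g = h} = (if h < b then 1 else 0)"
  proof (cases "h < b")
    case True
    then obtain y where y: "y \<in> W" "h < y" "W \<inter> {h<..<y} = {}"
      using gap_right[OF W(1) True W(3)] by metis
    then have "{g \<in> gaps W. fst g = h} = {(h, y)}"
      using h by (fastforce simp: gaps_def)
    then show ?thesis
      using True by simp
  next
    case False
    then have "{g \<in> gaps W. fst g = h} = {}"
      using W(4) by (fastforce simp: gaps_def)
    then show ?thesis
      using False by (simp only: card.empty if_False)
  qed
  moreover have "card {g \<in> gaps W. snd g = h} = (if a < h then 1 else 0)"
  proof (cases "a < h")
    case True
    then obtain x where x: "x \<in> W" "x < h" "W \<inter> {x<..<h} = {}"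
      using gap_left[OF W(1) True W(2)] by metis
    then have "{g \<in> gaps W. snd g = h} = {(x, h)}"
      using h by (fastforce simp: gaps_def)
    then show ?thesis
      using True by simp
  next
    case False
    then have "{g \<in> gaps W. snd g = h} = {}"
      using W(4) by (fastforce simp: gaps_def)
    then show ?thesis
      using False by (simp only: card.empty if_False)
  qed
  ultimately show ?thesis
    using finite_gaps[OF W(1)]
    by (simp add: case_prod_unfold sum.distrib sum.If_cases Int_def)
qed

lemma gaps_cover:
  assumes W: "finite W" "a \<in> W" "b \<in> W" "W \<subseteq> {a..b}"
  shows "(\<Union>(x, y)\<in>gaps W. {x<..<y}) = {a..b} - W"
proof
  show "(\<Union>(x, y)\<in>gaps W. {x<..<y}) \<subseteq> {a..b} - W"
    using W(4) by (fastforce simp: gaps_def)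
  show "{a..b} - W \<subseteq> (\<Union>(x, y)\<in>gaps W. {x<..<y})"
  proof
    fix s assume s: "s \<in> {a..b} - W"
    then have "a < s" "s < b"
      using W(2,3) by (metis DiffE atLeastAtMost_iff order_less_le)+
    obtain x where x: "x \<in> W" "x < s" "W \<inter> {x<..<s} = {}"
      using gap_left[OF W(1) \<open>a < s\<close> W(2)] by metis
    obtain y where y: "y \<in> W" "s < y" "W \<inter> {s<..<y} = {}"
      using gap_right[OF W(1) \<open>s < b\<close> W(3)] by metis
    have "W \<inter> {x<..<y} = {}"
    proof (rule ccontr)
      assume "W \<inter> {x<..<y} \<noteq> {}"
      then obtain w where "w \<in> W" "x < w" "w < y"
        by auto
      then show False
        using x(3) y(3) s by (cases w s rule: linorder_cases) auto
    qed
    then have "(x, y) \<in> gaps W"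
      using x y by (auto simp: gaps_def)
    then show "s \<in> (\<Union>(x, y)\<in>gaps W. {x<..<y})"
      using x(2) y(2) by fastforce
  qed
qed

lemma gaps_disjoint:
  assumes "(x, y) \<in> gaps W" "(x', y') \<in> gaps W" "{x<..<y} \<inter> {x'<..<y'} \<noteq> {}"
  shows "x = x' \<and> y = y'"
proof -
  obtain s where "s \<in> {x<..<y} \<inter> {x'<..<y'}"
    using assms(3) by blast
  then have s: "x < s" "s < y" "x' < s" "s < y'"
    by simp_all
  have "\<not> x < x'" "\<not> x' < x" "\<not> y < y'" "\<not> y' < y"
    using assms(1,2) s by (force simp: gaps_def)+
  then show ?thesis by auto
qed

text \<open>A connected set larger than one of the disjoint relatively open pieces would be
  separated by that piece and the union of the others, so each piece is maximal.\<close>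

lemma components_openin_unique:
  assumes un: "\<Union>\<C> = S" and op: "\<And>X. X \<in> \<C> \<Longrightarrow> openin (top_of_set S) X \<and> connected X \<and> X \<noteq> {}"
    and disj: "\<And>X Y. X \<in> \<C> \<Longrightarrow> Y \<in> \<C> \<Longrightarrow> X \<inter> Y \<noteq> {} \<Longrightarrow> X = Y"
  shows "components S = \<C>"
proof -
  have comp: "X \<in> components S" if X: "X \<in> \<C>" for X
    unfolding in_components_maximal
  proof (intro conjI allI impI)
    show "X \<noteq> {}" "X \<subseteq> S" "connected X"
      using op[OF X] openin_imp_subset by blast+
    fix D assume D: "D \<noteq> {} \<and> X \<subseteq> D \<and> D \<subseteq> S \<and> connected D"
    let ?R = "\<Union>(\<C> - {X})"
    have "openin (top_of_set S) ?R"
      using op by (intro openin_Union) simp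
    then obtain T where "open T" "?R = S \<inter> T"
      unfolding openin_open by (elim exE conjE)
    then have "D \<inter> ?R = D \<inter> T"
      using D by blast
    then have oR: "openin (top_of_set D) (D \<inter> ?R)"
      using \<open>open T\<close> by (simp add: openin_open_Int)
    have oX: "openin (top_of_set D) X"
      using D op[OF X] by (intro openin_subset_trans[of S X D]) simp_all
    have "D \<inter> ?R = {}"
    proof (rule ccontr)
      assume ne: "D \<inter> ?R \<noteq> {}"
      have cover: "D \<subseteq> X \<union> (D \<inter> ?R)"
        using D un by blast
      have sep: "X \<inter> (D \<inter> ?R) = {}"
        using disj[OF X] by blast
      have "X \<noteq> {}"
        using op[OF X] by simp
      have "\<not> connected D"
        unfolding connected_openin not_not
        by (intro exI[of _ X] exI[of _ "D \<inter> ?R"] conjI oX oR cover sep ne \<open>X \<noteq> {}\<close>)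
      then show False
        using D by simp
    qed
    then show "D = X"
      using D un by blast
  qed
  show ?thesis
  proof
    show "\<C> \<subseteq> components S"
      using comp by blast
    show "components S \<subseteq> \<C>"
    proof
      fix c assume c: "c \<in> components S"
      then obtain s where "s \<in> c" "s \<in> S"
        using in_components_nonempty[OF c] in_components_subset[OF c] by blast
      then obtain X where "X \<in> \<C>" "s \<in> X"
        using un by blast
      then have "c = X"
        using components_nonoverlap[OF c comp[OF \<open>X \<in> \<C>\<close>]] \<open>s \<in> c\<close> by blast
      then show "c \<in> \<C>"
        using \<open>X \<in> \<C>\<close> by blast
    qed
  qed
qed

lemma components_interval_minus:
  assumes W: "finite W" "a \<in> W" "b \<in> W" "W \<subseteq> {a..b}"
  shows "components ({a..b} - W) = (\<lambda>(x, y). {x<..<y}) ` gaps W"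
proof (rule components_openin_unique)
  show "\<Union>((\<lambda>(x, y). {x<..<y}) ` gaps W) = {a..b} - W"
    by (rule gaps_cover[OF assms])
  show "openin (top_of_set ({a..b} - W)) X \<and> connected X \<and> X \<noteq> {}" if X: "X \<in> (\<lambda>(x, y). {x<..<y}) ` gaps W" for X
  proof (intro conjI)
    obtain x y where "X = {x<..<y}" "(x, y) \<in> gaps W"
      using X by auto
    then show "connected X" "X \<noteq> {}"
      by (auto simp: gaps_def)
    have "X \<subseteq> (\<Union>(x, y)\<in>gaps W. {x<..<y})"
      using X by blast
    then have "X \<subseteq> {a..b} - W"
      unfolding gaps_cover[OF assms] .
    then show "openin (top_of_set ({a..b} - W)) X"
      using \<open>X = {x<..<y}\<close> by (metis open_greaterThanLessThan open_subset)
  qed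
  show "X = Y" if "X \<in> (\<lambda>(x, y). {x<..<y}) ` gaps W" "Y \<in> (\<lambda>(x, y). {x<..<y}) ` gaps W" "X \<inter> Y \<noteq> {}" for X Y
    using that gaps_disjoint by fast
qed

text \<open>The factor \<open>- 1 / cis \<theta>\<close> rotates the removed point onto the branch
  cut of \<open>Arg\<close>, which is why the inverse is continuous on the rest of the
  circle.\<close>

lemma homeomorphism_cis:
  "homeomorphism {\<theta><..<\<theta> + 2 * pi} (sphere 0 1 - {cis \<theta>}) cis (\<lambda>u. \<theta> + pi + Arg (- u / cis \<theta>))"
proof (rule homeomorphismI)
  let ?I = "{\<theta><..<\<theta> + 2 * pi}" and ?g = "\<lambda>u. \<theta> + pi + Arg (- u / cis \<theta>)"
  have eq: "?g (cis t) = t" if t: "t \<in> ?I" for t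
  proof -
    have "- cis t / cis \<theta> = cis (t - \<theta> - pi)"
      by (simp add: cis_divide[symmetric])
    moreover have "Arg (cis (t - \<theta> - pi)) = t - \<theta> - pi"
      using t by (intro Arg_unique[where r = 1]) (auto simp: cis_conv_exp)
    ultimately show ?thesis by simp
  qed
  then show "?g (cis t) = t" if "t \<in> ?I" for t
    using that by blast
  have ne: "- u / cis \<theta> \<notin> \<real>\<^sub>\<le>\<^sub>0" if "u \<in> sphere 0 1 - {cis \<theta>}" for u
  proof
    assume "- u / cis \<theta> \<in> \<real>\<^sub>\<le>\<^sub>0"
    then obtain r where r: "- u / cis \<theta> = of_real r" "r \<le> 0"
      by (rule nonpos_Reals_cases)
    have "cmod (- u / cis \<theta>) = 1"
      using that by (simp add: norm_divide)
    then have "\<bar>r\<bar> = 1"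
      unfolding r(1) by simp
    then have "r = -1"
      using r(2) by simp
    then show False
      using r that by (simp add: field_simps)
  qed
  show "continuous_on ?I cis"
    by (intro continuous_intros)
  show "continuous_on (sphere 0 1 - {cis \<theta>}) ?g"
    using ne by (intro continuous_intros continuous_on_compose2[OF continuous_on_Arg]) auto
  have cis_g: "cis (?g u) = u" if "u \<in> sphere 0 1 - {cis \<theta>}" for u
  proof -
    have "u \<noteq> 0"
      using that by auto
    have n1: "cmod (- u / cis \<theta>) = 1"
      using that by (simp add: norm_divide)
    have "cis (Arg (- u / cis \<theta>)) = - u / cis \<theta>"
      using cis_Arg[of "- u / cis \<theta>"] n1 \<open>u \<noteq> 0\<close> by (auto simp: sgn_div_norm)
    then show ?thesis
      by (simp add: cis_mult[symmetric] field_simps)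
  qed
  then show "cis (?g u) = u" if "u \<in> sphere 0 1 - {cis \<theta>}" for u
    using that by blast
  show g: "?g ` (sphere 0 1 - {cis \<theta>}) \<subseteq> ?I"
  proof (rule image_subsetI)
    fix u assume u: "u \<in> sphere 0 1 - {cis \<theta>}"
    then have "Arg (- u / cis \<theta>) \<noteq> pi"
      using ne[of u] by (metis Arg_eq_pi complex_nonpos_Reals_iff order_less_le)
    moreover have "- pi < Arg (- u / cis \<theta>)" "Arg (- u / cis \<theta>) \<le> pi"
      using Arg_bounded by auto
    ultimately show "?g u \<in> ?I"
      by auto
  qed
  show "cis ` ?I \<subseteq> sphere 0 1 - {cis \<theta>}"
  proof (rule image_subsetI)
    fix t assume t: "t \<in> ?I"
    have "cis t \<noteq> cis \<theta>"
    proof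
      assume "cis t = cis \<theta>"
      then have "t = \<theta> + pi + Arg (- 1)"
        using eq[OF t] by simp
      moreover have "Arg (- 1) = pi"
        by (simp add: Arg_eq_pi)
      ultimately show False
        using t by simp
    qed
    then show "cis t \<in> sphere 0 1 - {cis \<theta>}"
      by simp
  qed
qed

text \<open>Affine reparametrisation: \<open>is_edge_map\<close> demands the unit interval, while
  the gaps have arbitrary end points.\<close>

lemma is_edge_map_interval:
  fixes f :: "real \<Rightarrow> 'a::topological_space"
  assumes "x < y" "homeomorphism {x<..<y} e f g" "continuous_on {x..y} f" "f ` {x..y} \<subseteq> A" "e \<subseteq> A"
  shows "is_edge_map (top_of_set A) e (\<lambda>s. f (x + s * (y - x)))"
  unfolding is_edge_map_euclidean
proof (intro conjI exI)
  let ?l = "\<lambda>s. x + s * (y - x)"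
  have l: "?l ` {0..1} \<subseteq> {x..y}"
  proof (rule image_subsetI)
    fix s :: real assume "s \<in> {0..1}"
    then have "0 \<le> s * (y - x)" "s * (y - x) \<le> 1 * (y - x)"
      using \<open>x < y\<close> by (auto intro!: mult_right_mono)
    then show "?l s \<in> {x..y}" by auto
  qed
  then show "continuous_on {0..1} (\<lambda>s. f (?l s))"
    by (intro continuous_on_compose2[OF assms(3)] continuous_intros)
  show "(\<lambda>s. f (?l s)) ` {0..1} \<subseteq> A"
    using l assms(4) by blast
  have "homeomorphism {0<..<1} {x<..<y} ?l (\<lambda>r. (r - x) / (y - x))"
  proof (rule homeomorphismI)
    show "?l ` {0<..<1} \<subseteq> {x<..<y}"
    proof (rule image_subsetI)
      fix s :: real assume "s \<in> {0<..<1}"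
      then have "0 < s * (y - x)" "s * (y - x) < 1 * (y - x)"
        using \<open>x < y\<close> by (auto intro!: mult_strict_right_mono)
      then show "?l s \<in> {x<..<y}" by auto
    qed
  qed (use \<open>x < y\<close> in \<open>auto intro!: continuous_intros\<close>)
  then have "homeomorphism {0<..<1} e (f \<circ> ?l) ((\<lambda>r. (r - x) / (y - x)) \<circ> g)"
    using assms(2) by (rule homeomorphism_compose)
  moreover have "A \<inter> e = e"
    using assms(5) by blast
  ultimately show "homeomorphism {0<..<1} (A \<inter> e) (\<lambda>s. f (?l s)) ((\<lambda>r. (r - x) / (y - x)) \<circ> g)"
    by (simp add: o_def)
qed

subsection \<open>The cell structure of the annulus\<close>

lemma ends_eq_sum:
  assumes "Hausdorff_space X" "is_edge_map X e \<phi>"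
  shows "ends X e v = (if \<phi> 0 = v then 1 else 0) + (if \<phi> 1 = v then 1 else 0)"
  unfolding ends_eq[OF assms] card_end_parameters ..

locale annulus_grid =
  fixes U :: "complex set" and H :: "real set"
  assumes finite_U: "finite U" and U_subset: "U \<subseteq> sphere 0 1"
    and finite_H: "finite H" and H_subset: "H \<subseteq> {-1..1}" and H_ends: "-1 \<in> H" "1 \<in> H"
begin

abbreviation "cylinder \<equiv> sphere (0::complex) 1 \<times> {-1..1::real}"

definition vertical :: "(complex \<times> real) set set" where
  "vertical = {{u} \<times> f |u f. u \<in> U \<and> f \<in> components ({-1..1} - H)}"

definition horizontal :: "(complex \<times> real) set set" where
  "horizontal = {e \<times> {h} |e h. e \<in> components (sphere 0 1 - U) \<and> h \<in> H}"

text \<open>The vertices of the circle unrolled from \<theta>. If \<open>cis \<theta>\<close> is a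
  vertex it appears at both ends of the interval, so a circle with a single vertex correctly gives
  one gap, a loop.\<close>

definition angles :: "real \<Rightarrow> real set" where
  "angles \<theta> = {t \<in> {\<theta>..\<theta> + 2 * pi}. cis t \<in> U}"

lemma cis_2pi: "cis (\<theta> + 2 * pi) = cis \<theta>"
  by (rule complex_eqI) simp_all

lemma angles:
  assumes "cis \<theta> \<in> U"
  shows "finite (angles \<theta>)" "\<theta> \<in> angles \<theta>" "\<theta> + 2 * pi \<in> angles \<theta>" "angles \<theta> \<subseteq> {\<theta>..\<theta> + 2 * pi}"
proof -
  let ?g = "\<lambda>u. \<theta> + pi + Arg (- u / cis \<theta>)"
  have "angles \<theta> \<subseteq> {\<theta>, \<theta> + 2 * pi} \<union> ?g ` U"
  proof
    fix t assume t: "t \<in> angles \<theta>"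
    show "t \<in> {\<theta>, \<theta> + 2 * pi} \<union> ?g ` U"
    proof (cases "t \<in> {\<theta><..<\<theta> + 2 * pi}")
      case True
      then have "t = ?g (cis t)"
        using homeomorphism_cis by (metis homeomorphism_apply1)
      then show ?thesis
        using t unfolding angles_def by blast
    qed (use t in \<open>auto simp: angles_def\<close>)
  qed
  then show "finite (angles \<theta>)"
    by (rule finite_subset) (simp add: finite_U)
  show "\<theta> \<in> angles \<theta>" "\<theta> + 2 * pi \<in> angles \<theta>" "angles \<theta> \<subseteq> {\<theta>..\<theta> + 2 * pi}"
    using assms by (auto simp: angles_def cis_2pi)
qed

lemma gap_angles_subset:
  assumes "cis \<theta> \<in> U" "(x, y) \<in> gaps (angles \<theta>)"
  shows "{x<..<y} \<subseteq> {\<theta><..<\<theta> + 2 * pi}" "{x..y} \<subseteq> {\<theta>..\<theta> + 2 * pi}" "x < y"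
proof -
  have "x \<in> {\<theta>..\<theta> + 2 * pi}" "y \<in> {\<theta>..\<theta> + 2 * pi}" "x < y"
    using assms(2) angles(4)[OF assms(1)] by (auto simp: gaps_def)
  then show "{x<..<y} \<subseteq> {\<theta><..<\<theta> + 2 * pi}" "{x..y} \<subseteq> {\<theta>..\<theta> + 2 * pi}" "x < y"
    by auto
qed

lemma inj_cis: "inj_on cis {\<theta><..<\<theta> + 2 * pi}"
  by (rule inj_on_inverseI) (rule homeomorphism_apply1[OF homeomorphism_cis])

text \<open>Cutting the circle open at the vertex \<open>cis \<theta>\<close> turns the arcs into
  gaps on a line, and \<open>cis\<close> is injective on the open interval of length
  \<open>2 * pi\<close>.\<close>

lemma components_circle_minus:
  assumes u: "cis \<theta> \<in> U"
  shows "components (sphere 0 1 - U) = (\<lambda>(x, y). cis ` {x<..<y}) ` gaps (angles \<theta>)"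
proof -
  let ?I = "{\<theta><..<\<theta> + 2 * pi}"
  define \<C> where "\<C> = (\<lambda>(x, y). cis ` {x<..<y}) ` gaps (angles \<theta>)"
  have surj: "cis ` ?I = sphere 0 1 - {cis \<theta>}"
    by (rule homeomorphism_image1[OF homeomorphism_cis])
  have "\<Union>\<C> = cis ` (\<Union>(x, y)\<in>gaps (angles \<theta>). {x<..<y})"
    by (simp add: \<C>_def image_UN case_prod_unfold)
  also have "\<dots> = cis ` ({\<theta>..\<theta> + 2 * pi} - angles \<theta>)"
    unfolding gaps_cover[OF angles[OF u]] ..
  also have "\<dots> = sphere 0 1 - U"
  proof
    show "cis ` ({\<theta>..\<theta> + 2 * pi} - angles \<theta>) \<subseteq> sphere 0 1 - U"
    proof (rule image_subsetI)
      fix t assume "t \<in> {\<theta>..\<theta> + 2 * pi} - angles \<theta>"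
      then show "cis t \<in> sphere 0 1 - U"
        by (simp add: angles_def)
    qed
    show "sphere 0 1 - U \<subseteq> cis ` ({\<theta>..\<theta> + 2 * pi} - angles \<theta>)"
    proof
      fix z assume z: "z \<in> sphere 0 1 - U"
      then have "z \<in> sphere 0 1 - {cis \<theta>}"
        using u by auto
      then have "z \<in> cis ` ?I"
        unfolding surj .
      then obtain t where t: "z = cis t" "t \<in> ?I"
        by (rule imageE)
      then have "t \<in> {\<theta>..\<theta> + 2 * pi} - angles \<theta>"
        using z by (simp add: angles_def)
      then show "z \<in> cis ` ({\<theta>..\<theta> + 2 * pi} - angles \<theta>)"
        unfolding t(1) by (rule imageI)
    qed
  qed
  finally have un: "\<Union>\<C> = sphere 0 1 - U" .
  have op: "openin (top_of_set (sphere 0 1 - U)) X \<and> connected X \<and> X \<noteq> {}"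
    if X: "X \<in> \<C>" for X
  proof (intro conjI)
    obtain x y where xy: "X = cis ` {x<..<y}" "(x, y) \<in> gaps (angles \<theta>)"
      using X by (auto simp: \<C>_def)
    then show "X \<noteq> {}"
      by (auto simp: gaps_def)
    show "connected X"
      unfolding xy by (intro connected_continuous_image continuous_intros) auto
    have "openin (top_of_set ?I) {x<..<y}"
      using gap_angles_subset(1)[OF u xy(2)] by (simp add: open_subset)
    then have "openin (top_of_set (sphere 0 1 - {cis \<theta>})) X"
      unfolding xy(1) by (rule homeomorphism_imp_open_map[OF homeomorphism_cis[of \<theta>]])
    moreover have "X \<subseteq> sphere 0 1 - U"
      using X un by blast
    ultimately show "openin (top_of_set (sphere 0 1 - U)) X"
      by (rule openin_subset_trans) (use u in auto)
  qed
  have disj: "X = Y" if XY: "X \<in> \<C>"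
    "Y \<in> \<C>" "X \<inter> Y \<noteq> {}" for X Y
  proof -
    obtain x y x' y' where xy: "X = cis ` {x<..<y}" "(x, y) \<in> gaps (angles \<theta>)"
      "Y = cis ` {x'<..<y'}" "(x', y') \<in> gaps (angles \<theta>)"
      using XY(1,2) by (auto simp: \<C>_def)
    have "cis ` ({x<..<y} \<inter> {x'<..<y'}) = X \<inter> Y"
      unfolding xy(1,3)
      by (rule inj_on_image_Int[OF inj_cis gap_angles_subset(1)[OF u xy(2)] gap_angles_subset(1)[OF u xy(4)]])
    then have "{x<..<y} \<inter> {x'<..<y'} \<noteq> {}"
      using XY(3) by blast
    then show ?thesis
      using gaps_disjoint[OF xy(2,4)] xy by simp
  qed
  have "components (sphere 0 1 - U) = \<C>"
    using un op disj by (intro components_openin_unique) blast+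
  then show ?thesis
    unfolding \<C>_def .
qed

lemma components_interval:
  "components ({-1..1} - H) = (\<lambda>(x, y). {x<..<y}) ` gaps H"
  by (rule components_interval_minus[OF finite_H H_ends H_subset])

lemma vertical_eq: "vertical = (\<lambda>(u, x, y). {u} \<times> {x<..<y}) ` (U \<times> gaps H)"
proof
  show "vertical \<subseteq> (\<lambda>(u, x, y). {u} \<times> {x<..<y}) ` (U \<times> gaps H)"
  proof
    fix c assume "c \<in> vertical"
    then obtain u f where c: "c = {u} \<times> f" "u \<in> U" "f \<in> components ({-1..1} - H)"
      unfolding vertical_def by blast
    then obtain x y where "f = {x<..<y}" "(x, y) \<in> gaps H"
      unfolding components_interval by auto
    with c show "c \<in> (\<lambda>(u, x, y). {u} \<times> {x<..<y}) ` (U \<times> gaps H)"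
      by (intro image_eqI[of _ _ "(u, x, y)"]) simp_all
  qed
  show "(\<lambda>(u, x, y). {u} \<times> {x<..<y}) ` (U \<times> gaps H) \<subseteq> vertical"
    unfolding vertical_def components_interval by auto
qed

lemma horizontal_eq:
  assumes "cis \<theta> \<in> U"
  shows "horizontal = (\<lambda>((x, y), h). (cis ` {x<..<y}) \<times> {h}) ` (gaps (angles \<theta>) \<times> H)"
proof
  show "horizontal \<subseteq> (\<lambda>((x, y), h). (cis ` {x<..<y}) \<times> {h}) ` (gaps (angles \<theta>) \<times> H)"
  proof
    fix c assume "c \<in> horizontal"
    then obtain e h where c: "c = e \<times> {h}" "h \<in> H" "e \<in> components (sphere 0 1 - U)"
      unfolding horizontal_def by blast
    then obtain x y where "e = cis ` {x<..<y}" "(x, y) \<in> gaps (angles \<theta>)"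
      unfolding components_circle_minus[OF assms] by auto
    with c show "c \<in> (\<lambda>((x, y), h). (cis ` {x<..<y}) \<times> {h}) ` (gaps (angles \<theta>) \<times> H)"
      by (intro image_eqI[of _ _ "((x, y), h)"]) simp_all
  qed
  show "(\<lambda>((x, y), h). (cis ` {x<..<y}) \<times> {h}) ` (gaps (angles \<theta>) \<times> H) \<subseteq> horizontal"
    unfolding horizontal_def components_circle_minus[OF assms] by auto
qed

lemma vertical_edge_map:
  assumes "u \<in> U" "(x, y) \<in> gaps H"
  shows "is_edge_map (top_of_set cylinder) ({u} \<times> {x<..<y}) (\<lambda>s. (u, x + s * (y - x)))"
proof (rule is_edge_map_interval)
  show "x < y"
    using assms(2) by (auto simp: gaps_def)
  show "homeomorphism {x<..<y} ({u} \<times> {x<..<y}) (\<lambda>t. (u, t)) snd"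
    by (rule homeomorphismI) (auto intro!: continuous_intros)
  show "continuous_on {x..y} (\<lambda>t. (u, t))"
    by (intro continuous_intros)
  have *: "{x..y} \<subseteq> {-1..1}"
    using assms(2) H_subset by (auto simp: gaps_def)
  show "(\<lambda>t. (u, t)) ` {x..y} \<subseteq> cylinder"
    using * assms(1) U_subset by blast
  have "{x<..<y} \<subseteq> {x..y}"
    by auto
  then show "{u} \<times> {x<..<y} \<subseteq> cylinder"
    using * assms(1) U_subset by blast
qed

lemma horizontal_edge_map:
  assumes "cis \<theta> \<in> U" "(x, y) \<in> gaps (angles \<theta>)" "h \<in> H"
  shows "is_edge_map (top_of_set cylinder) (cis ` {x<..<y} \<times> {h}) (\<lambda>s. (cis (x + s * (y - x)), h))"
proof (rule is_edge_map_interval)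
  show "x < y"
    using gap_angles_subset assms by blast
  have "homeomorphism {x<..<y} (cis ` {x<..<y}) cis (\<lambda>u. \<theta> + pi + Arg (- u / cis \<theta>))"
    by (rule homeomorphism_of_subsets[OF homeomorphism_cis gap_angles_subset(1)[OF assms(1,2)] subset_refl refl])
  then have "homeomorphism {x<..<y} (cis ` {x<..<y} \<times> {h}) ((\<lambda>u. (u, h)) \<circ> cis)
      ((\<lambda>u. \<theta> + pi + Arg (- u / cis \<theta>)) \<circ> fst)"
    by (rule homeomorphism_compose) (rule homeomorphismI, auto intro!: continuous_intros)
  then show "homeomorphism {x<..<y} (cis ` {x<..<y} \<times> {h}) (\<lambda>t. (cis t, h)) ((\<lambda>u. \<theta> + pi + Arg (- u / cis \<theta>)) \<circ> fst)"
    by (simp add: o_def)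
  show "continuous_on {x..y} (\<lambda>t. (cis t, h))"
    by (intro continuous_intros)
  show "(\<lambda>t. (cis t, h)) ` {x..y} \<subseteq> cylinder" "cis ` {x<..<y} \<times> {h} \<subseteq> cylinder"
    using assms(3) H_subset by auto
qed

lemma Hausdorff_cylinder: "Hausdorff_space (top_of_set cylinder)"
  by (intro Hausdorff_space_subtopology) simp

lemma cis_Arg_unit: "u \<in> U \<Longrightarrow> cis (Arg u) = u"
proof -
  assume "u \<in> U"
  then have "cmod u = 1"
    using U_subset by auto
  moreover from this have "u \<noteq> 0"
    by auto
  ultimately show ?thesis
    using cis_Arg[of u] by (simp add: sgn_div_norm)
qed

lemma ex_cis:
  assumes "U \<noteq> {}"
  shows "\<exists>\<theta>. cis \<theta> \<in> U"
proof -
  obtain u where "u \<in> U"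
    using assms by blast
  then have "cis (Arg u) \<in> U"
    by (simp add: cis_Arg_unit)
  then show ?thesis
    by blast
qed

lemma edge_forms:
  assumes "c \<in> vertical \<union> horizontal"
  shows "(\<exists>u f. c = {u} \<times> f \<and> u \<in> U \<and> f \<in> components ({-1..1} - H) \<and> f \<noteq> {} \<and> f \<subseteq> {-1..1} - H) \<or>
    (\<exists>e h. c = e \<times> {h} \<and> h \<in> H \<and> e \<in> components (sphere 0 1 - U) \<and> e \<noteq> {} \<and> e \<subseteq> sphere 0 1 - U)"
  using assms
proof
  assume "c \<in> vertical"
  then obtain u f where "c = {u} \<times> f" "u \<in> U" "f \<in> components ({-1..1} - H)"
    unfolding vertical_def by blast
  then show ?thesis
    using in_components_subset[of f] in_components_nonempty[of f] by blast
next
  assume "c \<in> horizontal"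
  then obtain e h where "c = e \<times> {h}" "h \<in> H" "e \<in> components (sphere 0 1 - U)"
    unfolding horizontal_def by blast
  then show ?thesis
    using in_components_subset[of e] in_components_nonempty[of e] by blast
qed

lemma finite_edges:
  assumes "U \<noteq> {}"
  shows "finite vertical" "finite horizontal"
proof -
  obtain \<theta> where "cis \<theta> \<in> U"
    using ex_cis[OF assms] by (elim exE)
  then show "finite vertical" "finite horizontal"
    unfolding vertical_eq horizontal_eq[OF \<open>cis \<theta> \<in> U\<close>]
    using finite_U finite_H finite_gaps angles(1) by blast+
qed

lemma edge_map_exists:
  assumes "U \<noteq> {}" "c \<in> vertical \<union> horizontal"
  shows "c \<subseteq> cylinder" "\<exists>\<phi>. is_edge_map (top_of_set cylinder) c \<phi>"
proof -
  obtain \<theta> where \<theta>: "cis \<theta> \<in> U"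
    using ex_cis[OF assms(1)] by (elim exE)
  show "\<exists>\<phi>. is_edge_map (top_of_set cylinder) c \<phi>"
    using assms(2)
  proof
    assume "c \<in> vertical"
    then show ?thesis
      unfolding vertical_eq using vertical_edge_map by auto
  next
    assume "c \<in> horizontal"
    then show ?thesis
      unfolding horizontal_eq[OF \<theta>] using horizontal_edge_map[OF \<theta>] by auto
  qed
  show "c \<subseteq> cylinder"
    using edge_forms[OF assms(2)] U_subset H_subset by blast
qed

text \<open>Ensures later that a lifted edge determines the edge below it.\<close>

lemma edges_disjoint:
  assumes "c \<in> vertical \<union> horizontal" "c' \<in> vertical \<union> horizontal" "c \<inter> c' \<noteq> {}"
  shows "c = c'"
proof -
  have eq: "X = Y" if "X \<in> components S" "Y \<in> components S" "s \<in> X" "s \<in> Y"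
    for X Y :: "'x::topological_space set" and s S
    using that components_nonoverlap by blast
  obtain z where "z \<in> c" "z \<in> c'"
    using assms(3) by blast
  then obtain u h where z: "(u, h) \<in> c" "(u, h) \<in> c'"
    by (cases z) auto
  from edge_forms[OF assms(1)] edge_forms[OF assms(2)] show ?thesis
    by (elim disjE exE conjE) (use z in \<open>auto dest: eq\<close>)
qed

lemma edge_avoids_vertices:
  assumes "c \<in> vertical \<union> horizontal"
  shows "c \<inter> U \<times> H = {}" "c \<noteq> {}"
  using edge_forms[OF assms] by auto

text \<open>The circle through the vertex always contributes two ends; the vertical line contributes
  one upwards unless \<open>h\<close> is the top, and one downwards unless \<open>h\<close> is the
  bottom.\<close>

lemma valence_in_cylinder:
  assumes u: "u \<in> U" and h: "h \<in> H"
  shows "(\<Sum>c\<in>vertical \<union> horizontal. ends (top_of_set cylinder) c (u, h)) =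
    2 + (if h < 1 then 1 else 0) + (if -1 < h then 1 else 0)"
proof -
  let ?e = "\<lambda>c. ends (top_of_set cylinder) c (u, h)"
  \<comment> \<open>With the cut placed at \<open>u\<close> itself, an angle in the closed interval
    represents \<open>u\<close> exactly when it is one of the two ends of that interval.\<close>
  define \<theta> where "\<theta> = Arg u"
  have cis_\<theta>: "cis \<theta> = u"
    unfolding \<theta>_def using u by (rule cis_Arg_unit)
  then have \<theta>: "cis \<theta> \<in> U"
    using u by simp
  let ?v = "\<lambda>(u, x, y). {u} \<times> {x<..<y::real}" and ?h = "\<lambda>((x, y), h). (cis ` {x<..<y}) \<times> {h::real}"
  have "inj_on ?v (U \<times> gaps H)"
    by (rule inj_onI) (auto simp: gaps_def times_eq_iff greaterThanLessThan_eq_iff)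
  then have "sum ?e vertical = (\<Sum>(v, x, y)\<in>U \<times> gaps H. ?e ({v} \<times> {x<..<y}))"
    unfolding vertical_eq by (simp add: sum.reindex case_prod_unfold)
  also have "\<dots> = (\<Sum>(v, x, y)\<in>U \<times> gaps H. if v = u then (if x = h then 1 else 0) + (if y = h then 1 else 0) else 0)"
    by (rule sum.cong) (auto simp: ends_eq_sum[OF Hausdorff_cylinder vertical_edge_map])
  also have "\<dots> = (\<Sum>v\<in>U. \<Sum>(x, y)\<in>gaps H. if v = u then (if x = h then 1 else 0) + (if y = h then 1 else 0) else 0)"
    by (simp add: sum.cartesian_product)
  also have "\<dots> = (\<Sum>v\<in>U. if v = u then (\<Sum>(x, y)\<in>gaps H. (if x = h then 1 else 0) + (if y = h then 1 else 0)) else 0)"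
    by (rule sum.cong) auto
  also have "\<dots> = (if h < 1 then 1 else 0) + (if -1 < h then 1 else 0)"
    using finite_U u gaps_ends[OF finite_H H_ends H_subset h] by simp
  finally have V: "sum ?e vertical = (if h < 1 then 1 else 0) + (if -1 < h then 1 else 0)" .
  have "inj_on ?h (gaps (angles \<theta>) \<times> H)"
  proof (rule inj_onI)
    fix q q' assume q: "q \<in> gaps (angles \<theta>) \<times> H" "q' \<in> gaps (angles \<theta>) \<times> H" "?h q = ?h q'"
    obtain x y g x' y' g' where qq: "q = ((x, y), g)" "q' = ((x', y'), g')"
      by (metis surj_pair)
    have *: "(x, y) \<in> gaps (angles \<theta>)" "(x', y') \<in> gaps (angles \<theta>)"
      "cis ` {x<..<y} \<times> {g} = cis ` {x'<..<y'} \<times> {g'}"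
      using q by (simp_all add: qq)
    have ne: "{x<..<y} \<noteq> {}"
      using * by (auto simp: gaps_def)
    then have "cis ` {x<..<y} = cis ` {x'<..<y'}" "g = g'"
      using *(3) by (auto simp: times_eq_iff)
    then have "{x<..<y} = {x'<..<y'}"
      using inj_on_image_eq_iff[OF inj_cis] gap_angles_subset(1)[OF \<theta>] * by metis
    then show "q = q'"
      using gaps_disjoint[OF *(1,2)] ne \<open>g = g'\<close> by (simp add: qq)
  qed
  then have "sum ?e horizontal = (\<Sum>((x, y), g)\<in>gaps (angles \<theta>) \<times> H. ?e (cis ` {x<..<y} \<times> {g}))"
    unfolding horizontal_eq[OF \<theta>] by (simp add: sum.reindex case_prod_unfold)
  also have "\<dots> = (\<Sum>((x, y), g)\<in>gaps (angles \<theta>) \<times> H. if g = h then (if x = \<theta> then 1 else 0) + (if y = \<theta> + 2 * pi then 1 else 0) else 0)"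
  proof -
    have key: "?e (cis ` {x<..<y} \<times> {g}) = (if g = h then (if x = \<theta> then 1 else 0) + (if y = \<theta> + 2 * pi then 1 else 0) else 0)"
      if *: "(x, y) \<in> gaps (angles \<theta>)" "g \<in> H" for x y g
    proof -
    have I: "\<theta> \<le> x" "x < y" "y \<le> \<theta> + 2 * pi"
      using gap_angles_subset(2,3)[OF \<theta> *(1)] by auto
    have i: "cis t = u \<longleftrightarrow> t = \<theta> \<or> t = \<theta> + 2 * pi" if "t \<in> {\<theta>..\<theta> + 2 * pi}" for t
    proof
      assume "cis t = u"
      then have "cis t \<notin> cis ` {\<theta><..<\<theta> + 2 * pi}"
        using homeomorphism_cis[of \<theta>] cis_\<theta> by (auto simp: homeomorphism_def)
      then show "t = \<theta> \<or> t = \<theta> + 2 * pi"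
        using that by force
    qed (auto simp: cis_\<theta> cis_2pi)
    have "cis x = u \<longleftrightarrow> x = \<theta>" "cis y = u \<longleftrightarrow> y = \<theta> + 2 * pi"
      using i[of x] i[of y] I by auto
    then show ?thesis
      using ends_eq_sum[OF Hausdorff_cylinder horizontal_edge_map[OF \<theta> *]] by auto
  qed
    show ?thesis
      by (rule sum.cong) (use key in \<open>simp_all add: case_prod_unfold mem_Times_iff\<close>)
  qed
  also have "\<dots> = (\<Sum>(x, y)\<in>gaps (angles \<theta>). \<Sum>g\<in>H. if g = h then (if x = \<theta> then 1 else 0) + (if y = \<theta> + 2 * pi then 1 else 0) else 0)"
    by (simp add: sum.cartesian_product case_prod_unfold)
  also have "\<dots> = (\<Sum>(x, y)\<in>gaps (angles \<theta>). (if x = \<theta> then 1 else 0) + (if y = \<theta> + 2 * pi then 1 else 0))"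
    using finite_H h by (intro sum.cong) auto
  also have "\<dots> = 2"
  proof -
    have x: "y \<noteq> \<theta>" "x \<noteq> \<theta> + 2 * pi" if "(x, y) \<in> gaps (angles \<theta>)" for x y
      using gap_angles_subset(2,3)[OF \<theta> that] by auto
    \<comment> \<open>The added terms vanish, because no gap ends at the least angle or begins at
      the greatest. Each sum is then an instance of \<open>gaps_ends\<close>.\<close>
    have "(\<Sum>(x, y)\<in>gaps (angles \<theta>). (if x = \<theta> then 1 else 0) + (if y = \<theta> + 2 * pi then 1 else (0::nat))) =
      (\<Sum>(x, y)\<in>gaps (angles \<theta>). (if x = \<theta> then 1 else 0) + (if y = \<theta> then 1 else 0)) +
      (\<Sum>(x, y)\<in>gaps (angles \<theta>). (if x = \<theta> + 2 * pi then 1 else 0) + (if y = \<theta> + 2 * pi then 1 else 0))"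
      unfolding sum.distrib[symmetric] by (rule sum.cong) (use x in auto)
    then show ?thesis
      using gaps_ends[OF angles[OF \<theta>] angles(2)[OF \<theta>]] gaps_ends[OF angles[OF \<theta>] angles(3)[OF \<theta>]] by simp
  qed
  finally have Hz: "sum ?e horizontal = 2" .
  have "vertical \<inter> horizontal = {}"
  proof (rule ccontr)
    assume "vertical \<inter> horizontal \<noteq> {}"
    then obtain c where "c \<in> vertical" "c \<in> horizontal"
      by blast
    then obtain q e g where q: "c = (\<lambda>(u, x, y). {u} \<times> {x<..<y}) q" "q \<in> U \<times> gaps H" and e: "c = e \<times> {g}"
      unfolding vertical_eq horizontal_def by blast
    obtain v x y where "q = (v, x, y)"
      by (metis surj_pair)
    with q e have *: "c = {v} \<times> {x<..<y}" "(x, y) \<in> gaps H" "c = e \<times> {g}"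
      by simp_all
    then have "x < y"
      by (auto simp: gaps_def)
    \<comment> \<open>Two points of different height, which no horizontal edge can contain.\<close>
    then have "(v, (x + y) / 2) \<in> c" "(v, (x + (x + y) / 2) / 2) \<in> c"
      using *(1) by (auto simp: field_simps)
    then show False
      using *(3) \<open>x < y\<close> by auto
  qed
  moreover have "finite vertical" "finite horizontal"
    using finite_edges u by blast+
  ultimately show ?thesis
    using V Hz by (simp add: sum.union_disjoint)
qed

end

subsection \<open>The metric of the annulus and lengths of curves\<close>

text \<open>Reducing an angle to the principal range does not increase its absolute value: outside
  this range it is already at least \<open>pi\<close>.\<close>

lemma abs_Arg_cis_le: "r > 0 \<Longrightarrow> \<bar>Arg (of_real r * cis t)\<bar> \<le> \<bar>t\<bar>"
proof (cases "t \<in> {-pi<..pi}")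
  case True
  assume "r > 0"
  with True have "Arg (of_real r * cis t) = t"
    by (intro Arg_unique[where r = r]) (auto simp: cis_conv_exp)
  then show ?thesis by simp
next
  case False
  then have "pi \<le> \<bar>t\<bar>"
    by auto
  moreover have "\<bar>Arg (of_real r * cis t)\<bar> \<le> pi"
    using Arg_bounded[of "of_real r * cis t"] by linarith
  ultimately show ?thesis by simp
qed

lemma cis_Arg_cmod: "z = of_real (cmod z) * cis (Arg z)"
  by (metis rcis_cmod_Arg rcis_def)

text \<open>Angles add under multiplication, and \<open>abs_Arg_cis_le\<close> absorbs the reduction
  by full turns. This is the triangle inequality for arc length.\<close>

lemma abs_Arg_mult_le: "x \<noteq> 0 \<Longrightarrow> y \<noteq> 0 \<Longrightarrow> \<bar>Arg (x * y)\<bar> \<le> \<bar>Arg x\<bar> + \<bar>Arg y\<bar>"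
proof -
  assume "x \<noteq> 0" "y \<noteq> 0"
  have "x * y = (of_real (cmod x) * cis (Arg x)) * (of_real (cmod y) * cis (Arg y))"
    using cis_Arg_cmod by metis
  also have "\<dots> = of_real (cmod x * cmod y) * cis (Arg x + Arg y)"
    by (simp add: cis_mult[symmetric])
  finally have "\<bar>Arg (x * y)\<bar> \<le> \<bar>Arg x + Arg y\<bar>"
    using abs_Arg_cis_le[of "cmod x * cmod y"] \<open>x \<noteq> 0\<close> \<open>y \<noteq> 0\<close> by (metis mult_pos_pos zero_less_norm_iff)
  then show ?thesis by linarith
qed

lemma circle_dist_commute: "circle_dist u v = circle_dist v u"
proof -
  have "v / u = inverse (u / v)"
    by simp
  then show ?thesis
    unfolding circle_dist_def by (metis Arg_inverse abs_minus_cancel)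
qed

lemma circle_dist_triangle:
  assumes "u \<noteq> 0" "v \<noteq> 0" "w \<noteq> 0"
  shows "circle_dist u w \<le> circle_dist u v + circle_dist v w"
proof -
  have "u / w = (u / v) * (v / w)"
    using assms by simp
  then show ?thesis
    unfolding circle_dist_def using abs_Arg_mult_le[of "u / v" "v / w"] assms by simp
qed

lemma norm_cis_minus_1: "cmod (cis t - 1) = 2 * \<bar>sin (t / 2)\<bar>"
  using dist_exp_i_1[of t] by (simp add: cis_conv_exp)

lemma cis_circle_dist:
  assumes "cmod u = 1" "cmod v = 1"
  obtains t where "u = v * cis t" "\<bar>t\<bar> = circle_dist u v" "\<bar>t\<bar> \<le> pi"
proof
  show "u = v * cis (Arg (u / v))"
    using cis_Arg_cmod[of "u / v"] assms by (auto simp: norm_divide field_simps)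
  show "\<bar>Arg (u / v)\<bar> = circle_dist u v"
    by (simp add: circle_dist_def)
  show "\<bar>Arg (u / v)\<bar> \<le> pi"
    using Arg_bounded[of "u / v"] by linarith
qed

lemma norm_le_circle_dist:
  assumes "cmod u = 1" "cmod v = 1"
  shows "cmod (u - v) \<le> circle_dist u v"
proof -
  obtain t where t: "u = v * cis t" "\<bar>t\<bar> = circle_dist u v"
    using cis_circle_dist[OF assms] by metis
  have "cmod (u - v) = cmod (v * (cis t - 1))"
    by (simp add: t algebra_simps)
  also have "\<dots> = 2 * \<bar>sin (t / 2)\<bar>"
    using assms by (simp add: norm_mult norm_cis_minus_1)
  also have "\<dots> \<le> \<bar>t\<bar>"
    using abs_sin_x_le_abs_x[of "t / 2"] by simp
  finally show ?thesis
    using t by simp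
qed

text \<open>With \<open>x = 2 * y\<close>, the bounds \<open>y * cos y \<le> sin y\<close> and
  \<open>1 \<le> 2 * (cos y)\<^sup>2\<close> combine through the double angle formula.\<close>

lemma half_le_sin:
  fixes x :: real
  assumes "0 \<le> x" "x \<le> pi / 2"
  shows "x / 2 \<le> sin x"
proof -
  define y where "y = x / 2"
  have y: "0 \<le> y" "y \<le> pi / 4" "x = 2 * y"
    using assms by (auto simp: y_def)
  \<comment> \<open>The function \<open>sin t - t * cos t\<close> has derivative
    \<open>t * sin t\<close>, which is nonnegative on this range.\<close>
  have "sin 0 - 0 * cos 0 \<le> sin y - y * cos y"
  proof (rule DERIV_nonneg_imp_nondecreasing[OF y(1)])
    fix t assume t: "0 \<le> t" "t \<le> y"
    have "((\<lambda>t. sin t - t * cos t) has_real_derivative t * sin t) (at t)"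
      by (auto intro!: derivative_eq_intros)
    moreover have "0 \<le> t * sin t"
      using t y pi_gt_zero by (intro mult_nonneg_nonneg sin_ge_zero) auto
    ultimately show "\<exists>l. ((\<lambda>t. sin t - t * cos t) has_real_derivative l) (at t) \<and> 0 \<le> l"
      by blast
  qed
  then have le: "y * cos y \<le> sin y"
    by simp
  have c: "0 \<le> cos y" "0 \<le> cos (2 * y)"
    using y pi_gt_zero by (auto intro!: cos_ge_zero)
  then have "1 \<le> 2 * (cos y)\<^sup>2"
    by (simp add: cos_double_cos)
  then have "y * 1 \<le> y * (2 * (cos y)\<^sup>2)"
    using y by (intro mult_left_mono) auto
  also have "\<dots> = 2 * (y * cos y) * cos y"
    by (simp add: power2_eq_square)
  also have "\<dots> \<le> 2 * sin y * cos y"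
    using le c by (intro mult_right_mono) auto
  finally show ?thesis
    by (simp add: y(3) sin_double)
qed

text \<open>An arc of length \<open>t\<close> has chord \<open>2 * sin (t / 2)\<close>, and
  \<open>half_le_sin\<close> bounds the chord below by \<open>t / 2\<close>. The factor 2 is not
  sharp.\<close>

lemma circle_dist_le_norm:
  assumes "cmod u = 1" "cmod v = 1"
  shows "circle_dist u v \<le> 2 * cmod (u - v)"
proof -
  obtain t where t: "u = v * cis t" "\<bar>t\<bar> = circle_dist u v" "\<bar>t\<bar> \<le> pi"
    using cis_circle_dist[OF assms] by metis
  define x where "x = \<bar>t\<bar> / 2"
  have x: "0 \<le> x" "x \<le> pi / 2"
    using t by (auto simp: x_def)
  have "x / 2 \<le> sin x"
    using x by (rule half_le_sin)
  moreover have "cmod (u - v) = 2 * sin x"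
  proof -
    have "cmod (u - v) = cmod (v * (cis t - 1))"
      by (simp add: t algebra_simps)
    also have "\<dots> = 2 * \<bar>sin (t / 2)\<bar>"
      using assms by (simp add: norm_mult norm_cis_minus_1)
    also have "\<bar>sin (t / 2)\<bar> = sin x"
    proof -
      have "0 \<le> sin x"
        using x pi_gt_zero by (intro sin_ge_zero) auto
      then show ?thesis
        by (cases "0 \<le> t") (auto simp: x_def)
    qed
    finally show ?thesis .
  qed
  ultimately show ?thesis
    using t(2) by (simp add: x_def)
qed

lemma circle_dist_cis: "circle_dist (u * cis s) (u * cis t) \<le> \<bar>s - t\<bar>"
proof (cases "u = 0")
  case False
  then have "u * cis s / (u * cis t) = of_real 1 * cis (s - t)"
    by (simp add: cis_divide[symmetric])
  then show ?thesis
    unfolding circle_dist_def using abs_Arg_cis_le[of 1] by simp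
qed (simp add: circle_dist_def Arg_zero)

section \<open>The flat metric compared with the Euclidean metric\<close>

definition annulus_set :: "(complex \<times> real) set" where
  "annulus_set = sphere 0 1 \<times> {-1..1}"

definition annulus_dist :: "complex \<times> real \<Rightarrow> complex \<times> real \<Rightarrow> real" where
  "annulus_dist x y = sqrt ((circle_dist (fst x) (fst y))\<^sup>2 + (snd x - snd y)\<^sup>2)"

lemma dist_le_annulus_dist:
  assumes "x \<in> annulus_set" "y \<in> annulus_set"
  shows "dist x y \<le> annulus_dist x y"
  using assms norm_le_circle_dist[of "fst x" "fst y"]
  unfolding dist_prod_def annulus_dist_def
  by (intro real_sqrt_le_mono add_mono) (auto simp: annulus_set_def dist_norm power_mono)

lemma annulus_dist_le_dist:
  assumes "x \<in> annulus_set" "y \<in> annulus_set"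
  shows "annulus_dist x y \<le> 2 * dist x y"
proof -
  have "(circle_dist (fst x) (fst y))\<^sup>2 \<le> (2 * dist (fst x) (fst y))\<^sup>2"
    using assms circle_dist_le_norm[of "fst x" "fst y"]
    by (intro power_mono) (auto simp: annulus_set_def dist_norm circle_dist_def)
  moreover have "(snd x - snd y)\<^sup>2 \<le> (2 * dist (snd x) (snd y))\<^sup>2"
    by (simp add: dist_real_def power_mult_distrib)
  ultimately have "annulus_dist x y \<le> sqrt ((2 * dist (fst x) (fst y))\<^sup>2 + (2 * dist (snd x) (snd y))\<^sup>2)"
    unfolding annulus_dist_def by (intro real_sqrt_le_mono add_mono)
  also have "\<dots> = sqrt (2\<^sup>2 * ((dist (fst x) (fst y))\<^sup>2 + (dist (snd x) (snd y))\<^sup>2))"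
    by (simp only: power_mult_distrib distrib_left)
  also have "\<dots> = 2 * dist x y"
    unfolding real_sqrt_mult dist_prod_def by simp
  finally show ?thesis .
qed

interpretation annulus: Metric_space annulus_set annulus_dist
proof
  show "0 \<le> annulus_dist x y" for x y
    by (simp add: annulus_dist_def)
  show "annulus_dist x y = annulus_dist y x" for x y
    unfolding annulus_dist_def by (metis circle_dist_commute power2_commute)
  show "annulus_dist x y = 0 \<longleftrightarrow> x = y" if "x \<in> annulus_set" "y \<in> annulus_set" for x y
  proof
    assume "annulus_dist x y = 0"
    then show "x = y"
      using dist_le_annulus_dist[OF that] by simp
  next
    assume "x = y"
    then show "annulus_dist x y = 0"
      using annulus_dist_le_dist[OF that] dist_le_annulus_dist[OF that] by simp
  qed
  show "annulus_dist x z \<le> annulus_dist x y + annulus_dist y z"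
    if "x \<in> annulus_set" "y \<in> annulus_set" "z \<in> annulus_set" for x y z
  proof -
    have "circle_dist (fst x) (fst z) \<le> circle_dist (fst x) (fst y) + circle_dist (fst y) (fst z)"
      using that by (intro circle_dist_triangle) (auto simp: annulus_set_def)
    then have "(circle_dist (fst x) (fst z))\<^sup>2 \<le> (circle_dist (fst x) (fst y) + circle_dist (fst y) (fst z))\<^sup>2"
      by (intro power_mono) (auto simp: circle_dist_def)
    then have "annulus_dist x z \<le> sqrt ((circle_dist (fst x) (fst y) + circle_dist (fst y) (fst z))\<^sup>2 +
        ((snd x - snd y) + (snd y - snd z))\<^sup>2)"
      by (simp add: annulus_dist_def)
    also have "\<dots> \<le> annulus_dist x y + annulus_dist y z"
      unfolding annulus_dist_def by (rule real_sqrt_sum_squares_triangle_ineq)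
    finally show ?thesis .
  qed
qed

lemma annulus_eq: "annulus = metric (annulus_set, annulus_dist)"
  unfolding annulus_def annulus_set_def annulus_dist_def ..

lemma mspace_annulus [simp]: "mspace annulus = annulus_set"
  and mdist_annulus [simp]: "mdist annulus = annulus_dist"
  by (simp_all add: annulus_eq annulus.mspace_metric annulus.mdist_metric)

text \<open>The two metrics are bi-Lipschitz equivalent, with constants 1 and 2, so they have the
  same open sets.\<close>

lemma mtopology_annulus: "mtopology_of annulus = top_of_set annulus_set"
proof -
  have iff: "(\<exists>r>0. annulus.mball x r \<subseteq> U) \<longleftrightarrow> (\<exists>e>0. \<forall>x'\<in>annulus_set. dist x' x < e \<longrightarrow> x' \<in> U)"
    (is "?l \<longleftrightarrow> ?r") if sub: "U \<subseteq> annulus_set" and x: "x \<in> U" for U x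
  proof
      assume ?l
      then obtain r where r: "r > 0" "annulus.mball x r \<subseteq> U" by blast
      have "y \<in> U" if "y \<in> annulus_set" "dist y x < r / 2" for y
      proof -
        have "annulus_dist x y < r"
          using annulus_dist_le_dist[of x y] that x sub by (auto simp: dist_commute)
        then have "y \<in> annulus.mball x r"
          using x sub that by (auto simp: annulus.in_mball)
        then show ?thesis
          using r(2) by blast
      qed
      then show ?r
        using r(1) by (meson half_gt_zero)
    next
      assume ?r
      then obtain e where e: "e > 0" "\<forall>x'\<in>annulus_set. dist x' x < e \<longrightarrow> x' \<in> U" by blast
      have "annulus.mball x e \<subseteq> U"
      proof
        fix y assume y: "y \<in> annulus.mball x e"
        then have "dist y x < e"
          using dist_le_annulus_dist[of x y] by (auto simp: dist_commute)
        then show "y \<in> U"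
          using e y by auto
      qed
      then show ?l
        using e(1) by blast
  qed
  then have "openin annulus.mtopology U \<longleftrightarrow> openin (top_of_set annulus_set) U" for U
    unfolding annulus.openin_mtopology openin_euclidean_subtopology_iff by blast
  then have "annulus.mtopology = top_of_set annulus_set"
    by (simp add: topology_eq)
  then show ?thesis
    by (simp add: annulus_eq annulus.mtopology_of)
qed

text \<open>A recursive form of the sum over a partition, so that refining, reversing and splitting
  become list inductions.\<close>

fun path_sum :: "('a \<Rightarrow> 'a \<Rightarrow> real) \<Rightarrow> 'a list \<Rightarrow> real" where
  "path_sum \<rho> (x # y # xs) = \<rho> x y + path_sum \<rho> (y # xs)"
| "path_sum \<rho> xs = 0"

lemma path_sum_eq: "path_sum \<rho> xs = (\<Sum>i<length xs - 1. \<rho> (xs ! i) (xs ! Suc i))"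
proof (induction \<rho> xs rule: path_sum.induct)
  case (1 \<rho> x y xs)
  have "(\<Sum>i<length (x # y # xs) - 1. \<rho> ((x # y # xs) ! i) ((x # y # xs) ! Suc i)) =
      (\<Sum>i<Suc (length (y # xs) - 1). \<rho> ((x # y # xs) ! i) ((x # y # xs) ! Suc i))"
    by simp
  also have "\<dots> = \<rho> x y + (\<Sum>i<length (y # xs) - 1. \<rho> ((y # xs) ! i) ((y # xs) ! Suc i))"
    by (subst sum.lessThan_Suc_shift) simp
  finally show ?case
    using 1 by simp
qed auto

lemma curve_length_alt:
  "curve_length X \<gamma> = (SUP ts\<in>{ts. sorted ts \<and> set ts \<subseteq> {0..1}}. ennreal (path_sum (mdist X) (map \<gamma> ts)))"
proof -
  have "(\<Sum>i<length ts - 1. mdist X (\<gamma> (ts ! i)) (\<gamma> (ts ! Suc i))) = path_sum (mdist X) (map \<gamma> ts)" for ts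
    unfolding path_sum_eq by (intro sum.cong) auto
  then show ?thesis
    unfolding curve_length_def by simp
qed

lemma path_sum_le_curve_length:
  "sorted ts \<Longrightarrow> set ts \<subseteq> {0..1} \<Longrightarrow> ennreal (path_sum (mdist X) (map \<gamma> ts)) \<le> curve_length X \<gamma>"
  unfolding curve_length_alt by (intro SUP_upper) simp

lemma mdist_le_curve_length:
  assumes "s \<in> {0..1}" "t \<in> {0..1}"
  shows "ennreal (mdist X (\<gamma> s) (\<gamma> t)) \<le> curve_length X \<gamma>"
proof (cases "s \<le> t")
  case True
  then show ?thesis
    using path_sum_le_curve_length[of "[s, t]" X \<gamma>] assms by simp
next
  case False
  then show ?thesis
    using path_sum_le_curve_length[of "[t, s]" X \<gamma>] assms by (simp add: mdist_commute)
qed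

lemma path_sum_nonneg: "path_sum (mdist X) xs \<ge> 0"
  by (induction "mdist X" xs rule: path_sum.induct) auto

lemma path_sum_append: "path_sum \<rho> (xs @ x # ys) = path_sum \<rho> (xs @ [x]) + path_sum \<rho> (x # ys)"
proof (induction xs)
  case (Cons a xs)
  then show ?case by (cases xs) auto
qed auto

text \<open>Refining a partition does not decrease the sum, by the triangle inequality.\<close>

lemma path_sum_insert:
  assumes "set xs \<subseteq> mspace X" "x \<in> mspace X" "set ys \<subseteq> mspace X"
  shows "path_sum (mdist X) (xs @ ys) \<le> path_sum (mdist X) (xs @ x # ys)"
  using assms(1)
proof (induction xs)
  case Nil
  then show ?case
    by (cases ys) auto
next
  case (Cons a xs)
  show ?case
  proof (cases xs)
    case Nil
    show ?thesis
    proof (cases ys)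
      case (Cons y zs)
      then have "mdist X a y \<le> mdist X a x + mdist X x y"
        using assms Cons.prems by (intro mdist_triangle) auto
      then show ?thesis
        using Nil Cons by simp
    qed (use Nil in simp)
  qed (use Cons in auto)
qed

lemma path_sum_rev: "path_sum (mdist X) (rev xs) = path_sum (mdist X) xs"
proof (induction "mdist X" xs rule: path_sum.induct)
  case (1 x y xs)
  have "path_sum (mdist X) (rev (x # y # xs)) = path_sum (mdist X) (rev xs @ y # [x])"
    by simp
  also have "\<dots> = path_sum (mdist X) (rev (y # xs)) + path_sum (mdist X) [y, x]"
    by (subst path_sum_append) simp
  finally show ?case
    using 1 by (simp add: mdist_commute)
qed auto

lemma curve_length_reverse: "curve_length X (\<lambda>t. \<gamma> (1 - t)) \<le> curve_length X \<gamma>"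
  unfolding curve_length_alt[of X "\<lambda>t. \<gamma> (1 - t)"]
proof (rule SUP_least)
  fix ts assume ts: "ts \<in> {ts. sorted ts \<and> set ts \<subseteq> {0..1::real}}"
  have "map (\<lambda>t. \<gamma> (1 - t)) ts = map \<gamma> (map (\<lambda>t. 1 - t) ts)"
    by simp
  then have "path_sum (mdist X) (map (\<lambda>t. \<gamma> (1 - t)) ts) = path_sum (mdist X) (map \<gamma> (rev (map (\<lambda>t. 1 - t) ts)))"
    using path_sum_rev by (metis rev_map)
  moreover have "sorted (rev (map (\<lambda>t. 1 - t) ts))"
    using ts by (auto simp: sorted_wrt_map sorted_wrt_rev)
  ultimately show "ennreal (path_sum (mdist X) (map (\<lambda>t. \<gamma> (1 - t)) ts)) \<le> curve_length X \<gamma>"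
    using ts by (auto simp: subset_iff intro!: path_sum_le_curve_length)
qed

lemma curve_length_Lipschitz:
  assumes "L \<ge> 0" "\<And>s t. 0 \<le> s \<Longrightarrow> s \<le> t \<Longrightarrow> t \<le> 1 \<Longrightarrow> mdist X (\<gamma> s) (\<gamma> t) \<le> L * (t - s)"
  shows "curve_length X \<gamma> \<le> ennreal L"
  unfolding curve_length_alt
proof (rule SUP_least)
  fix ts assume "ts \<in> {ts. sorted ts \<and> set ts \<subseteq> {0..1::real}}"
  then have ts: "sorted ts" "set ts \<subseteq> {0..1}"
    by auto
  \<comment> \<open>The bound by the span of the list telescopes in the induction; the empty list is
    separate because it has no first or last element.\<close>
  have "path_sum (mdist X) (map \<gamma> ts) \<le> (if ts = [] then 0 else L * (last ts - hd ts))"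
    using ts
  proof (induction ts rule: induct_list012)
    case (3 s t ts)
    then have "mdist X (\<gamma> s) (\<gamma> t) \<le> L * (t - s)"
      by (intro assms(2)) auto
    moreover have "path_sum (mdist X) (map \<gamma> (t # ts)) \<le> L * (last (t # ts) - t)"
      using 3 by auto
    ultimately show ?case
      by (auto simp: algebra_simps)
  qed auto
  also have "\<dots> \<le> L"
  proof (cases "ts = []")
    case False
    then have "last ts \<le> 1" "hd ts \<ge> 0"
      using ts(2) by (auto simp: subset_iff)
    then have "L * (last ts - hd ts) \<le> L * 1"
      using assms(1) by (intro mult_left_mono) auto
    then show ?thesis
      using False by simp
  qed (use assms in simp)
  finally show "ennreal (path_sum (mdist X) (map \<gamma> ts)) \<le> ennreal L"
    by (rule ennreal_leI)
qed

text \<open>Any partition may be refined by the junction 1/2; it then splits into a partition of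
  each half.\<close>

lemma curve_length_joinpaths:
  assumes "\<And>t. t \<in> {0..1} \<Longrightarrow> \<gamma> t \<in> mspace X" "\<And>t. t \<in> {0..1} \<Longrightarrow> \<delta> t \<in> mspace X"
    and "\<gamma> 1 = \<delta> 0"
  shows "curve_length X (\<gamma> +++ \<delta>) \<le> curve_length X \<gamma> + curve_length X \<delta>"
  unfolding curve_length_alt[of X "\<gamma> +++ \<delta>"]
proof (rule SUP_least)
  fix ts assume "ts \<in> {ts. sorted ts \<and> set ts \<subseteq> {0..1::real}}"
  then have ts: "sorted ts" "set ts \<subseteq> {0..1}"
    by auto
  define as where "as = takeWhile (\<lambda>t. t \<le> 1/2) ts"
  define bs where "bs = dropWhile (\<lambda>t. t \<le> 1/2) ts"
  have ab: "ts = as @ bs"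
    by (simp add: as_def bs_def)
  have as: "sorted as" "\<forall>t\<in>set as. t \<le> 1/2" "set as \<subseteq> {0..1}"
    using ts by (auto simp: as_def sorted_takeWhile dest: set_takeWhileD)
  have bs: "sorted bs" "set bs \<subseteq> {0..1}"
    using ts by (auto simp: bs_def sorted_dropWhile dest: set_dropWhileD)
  have bs_gt: "\<forall>t\<in>set bs. t > 1/2"
  proof (cases bs)
    case (Cons b cs)
    then have "b > 1/2"
      using hd_dropWhile[of "\<lambda>t. t \<le> 1/2" ts] by (auto simp: bs_def)
    then show ?thesis
      using bs(1) Cons by auto
  qed simp
  let ?j = "\<gamma> +++ \<delta>"
  have j: "?j t \<in> mspace X" if "t \<in> {0..1}" for t
    using assms(1)[of "2 * t"] assms(2)[of "2 * t - 1"] that by (auto simp: joinpaths_def)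
  have "map ?j (as @ [1/2]) = map \<gamma> (map (\<lambda>t. 2 * t) (as @ [1/2]))"
    using as(2) by (auto simp: joinpaths_def)
  moreover have "sorted (map (\<lambda>t. 2 * t) (as @ [1/2]))" "set (map (\<lambda>t. 2 * t) (as @ [1/2])) \<subseteq> {0..1}"
    using as by (auto simp: sorted_append sorted_wrt_map subset_iff)
  ultimately have 1: "ennreal (path_sum (mdist X) (map ?j (as @ [1/2]))) \<le> curve_length X \<gamma>"
    by (metis path_sum_le_curve_length)
  have "map ?j (1/2 # bs) = map \<delta> (map (\<lambda>t. 2 * t - 1) (1/2 # bs))"
    using bs_gt assms(3) by (auto simp: joinpaths_def)
  moreover have "sorted (map (\<lambda>t. 2 * t - 1) (1/2 # bs))" "set (map (\<lambda>t. 2 * t - 1) (1/2 # bs)) \<subseteq> {0..1}"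
    using bs bs_gt by (auto simp: sorted_wrt_map less_imp_le subset_iff)
  ultimately have 2: "ennreal (path_sum (mdist X) (map ?j (1/2 # bs))) \<le> curve_length X \<delta>"
    by (metis path_sum_le_curve_length)
  \<comment> \<open>If 1/2 already occurs in the partition, inserting it again does no harm.\<close>
  have "path_sum (mdist X) (map ?j ts) \<le> path_sum (mdist X) (map ?j as @ ?j (1/2) # map ?j bs)"
    unfolding ab map_append using as(3) bs(2) j by (intro path_sum_insert) auto
  also have "\<dots> = path_sum (mdist X) (map ?j (as @ [1/2])) + path_sum (mdist X) (map ?j (1/2 # bs))"
    by (subst path_sum_append) simp
  finally have "ennreal (path_sum (mdist X) (map ?j ts)) \<le>
      ennreal (path_sum (mdist X) (map ?j (as @ [1/2]))) + ennreal (path_sum (mdist X) (map ?j (1/2 # bs)))"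
    by (simp add: ennreal_leI path_sum_nonneg flip: ennreal_plus)
  also have "\<dots> \<le> curve_length X \<gamma> + curve_length X \<delta>"
    using 1 2 by (rule add_mono)
  finally show "ennreal (path_sum (mdist X) (map ?j ts)) \<le> curve_length X \<gamma> + curve_length X \<delta>" .
qed

subsection \<open>The compact model\<close>

text \<open>Solving \<open>h = (r\<^sup>2 - 1) / (r\<^sup>2 + 1)\<close> for the radius gives
  \<open>r\<^sup>2 = (1 + h) / (1 - h)\<close>.\<close>

definition iA_inv :: "complex \<times> real \<Rightarrow> complex" where
  "iA_inv x = of_real (sqrt ((1 + snd x) / (1 - snd x))) * fst x"

lemma height_iA: "snd (iA w) = ((cmod w)\<^sup>2 - 1) / ((cmod w)\<^sup>2 + 1)"
  and direction_iA: "fst (iA w) = sgn w"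
  by (simp_all add: iA_def sgn_div_norm scaleR_conv_of_real field_simps)

lemma height_iA_eq: "snd (iA w) = 1 - 2 / ((cmod w)\<^sup>2 + 1)"
proof -
  have "(cmod w)\<^sup>2 + 1 \<noteq> 0"
    by (metis add_nonneg_pos less_numeral_extra(1) less_numeral_extra(3) zero_le_power2)
  then show ?thesis
    unfolding height_iA by (simp add: field_simps)
qed

lemma height_iA_bounds:
  assumes "w \<noteq> 0"
  shows "-1 < snd (iA w)" "snd (iA w) < 1"
proof -
  have "0 < (cmod w)\<^sup>2"
    using assms by simp
  then have "2 / ((cmod w)\<^sup>2 + 1) < 2" "0 < 2 / ((cmod w)\<^sup>2 + 1)"
    by (simp_all add: pos_divide_less_eq add_pos_pos)
  then show "-1 < snd (iA w)" "snd (iA w) < 1"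
    unfolding height_iA_eq by linarith+
qed

lemma iA_in_annulus: "w \<noteq> 0 \<Longrightarrow> iA w \<in> annulus_set"
  using height_iA_bounds[of w] direction_iA[of w]
  by (auto simp: annulus_set_def mem_Times_iff norm_sgn)

lemma iA_inv_iA:
  assumes "w \<noteq> 0"
  shows "iA_inv (iA w) = w"
proof -
  define r where "r = cmod w"
  have "r > 0"
    using assms by (simp add: r_def)
  have pos: "r\<^sup>2 + 1 > 0"
    by (simp add: add_nonneg_pos)
  have "1 + (r\<^sup>2 - 1) / (r\<^sup>2 + 1) = 2 * r\<^sup>2 / (r\<^sup>2 + 1)" "1 - (r\<^sup>2 - 1) / (r\<^sup>2 + 1) = 2 / (r\<^sup>2 + 1)"
    using pos by (simp_all add: field_simps)
  then have "(1 + snd (iA w)) / (1 - snd (iA w)) = r\<^sup>2"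
    unfolding height_iA r_def[symmetric] using pos by simp
  then show ?thesis
    using \<open>r > 0\<close> by (simp add: iA_inv_def r_def iA_def)
qed

lemma iA_iA_inv:
  assumes "x \<in> annulus_set" "-1 < snd x" "snd x < 1"
  shows "iA (iA_inv x) = x" "iA_inv x \<noteq> 0"
proof -
  define r where "r = sqrt ((1 + snd x) / (1 - snd x))"
  have "r > 0" and r2: "r\<^sup>2 = (1 + snd x) / (1 - snd x)"
    using assms by (auto simp: r_def)
  have u: "cmod (fst x) = 1"
    using assms(1) by (auto simp: annulus_set_def)
  have eq: "iA_inv x = of_real r * fst x"
    by (simp add: iA_inv_def r_def)
  have "cmod (iA_inv x) = r"
    using \<open>r > 0\<close> u by (simp add: eq norm_mult)
  moreover have "(r\<^sup>2 - 1) / (r\<^sup>2 + 1) = snd x"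
  proof -
    have "r\<^sup>2 - 1 = 2 * snd x / (1 - snd x)" "r\<^sup>2 + 1 = 2 / (1 - snd x)"
      using assms by (simp_all add: r2 field_simps)
    then show ?thesis
      using assms by simp
  qed
  ultimately show "iA (iA_inv x) = x"
    using \<open>r > 0\<close> by (simp add: iA_def eq prod_eq_iff)
  show "iA_inv x \<noteq> 0"
    using \<open>r > 0\<close> u by (auto simp: eq)
qed

lemma inj_iA: "w \<noteq> 0 \<Longrightarrow> w' \<noteq> 0 \<Longrightarrow> iA w = iA w' \<Longrightarrow> w = w'"
  by (metis iA_inv_iA)

lemma continuous_on_iA: "continuous_on (- {0}) iA"
proof -
  have "(cmod z)\<^sup>2 + 1 \<noteq> 0" for z
    by (metis add_nonneg_pos less_numeral_extra(1) less_numeral_extra(3) zero_le_power2)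
  then show ?thesis
    unfolding iA_def by (intro continuous_intros) auto
qed

text \<open>The radial homeomorphism from the plane onto the open unit disc. It preserves
  directions, so going to infinity means approaching a definite point of the unit circle whenever
  the direction converges.\<close>

definition squash :: "complex \<Rightarrow> complex" where
  "squash z = z / of_real (1 + cmod z)"

definition unsquash :: "complex \<Rightarrow> complex" where
  "unsquash x = x / of_real (1 - cmod x)"

lemma one_plus_cmod_ne [simp]: "1 + cmod z \<noteq> 0" "1 + complex_of_real (cmod z) \<noteq> 0"
proof -
  show ne: "1 + cmod z \<noteq> 0"
    using norm_ge_zero[of z] by linarith
  then show "1 + complex_of_real (cmod z) \<noteq> 0"
    by (metis of_real_1 of_real_add of_real_eq_0_iff)
qed

lemma cmod_squash: "cmod (squash z) = cmod z / (1 + cmod z)"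
  by (simp add: squash_def norm_divide del: of_real_add)

lemma one_minus_cmod_squash: "1 - cmod (squash z) = 1 / (1 + cmod z)"
  by (simp add: cmod_squash field_simps)

lemma cmod_squash_less: "cmod (squash z) < 1"
proof -
  have "0 < 1 + cmod z"
    using norm_ge_zero[of z] by linarith
  then show ?thesis
    by (simp add: cmod_squash pos_divide_less_eq)
qed

lemma unsquash_squash [simp]: "unsquash (squash z) = z"
  unfolding unsquash_def one_minus_cmod_squash by (simp add: squash_def)

lemma inj_squash: "squash z = squash w \<longleftrightarrow> z = w"
  by (metis unsquash_squash)

lemma continuous_on_squash: "continuous_on UNIV squash"
  unfolding squash_def by (intro continuous_intros) simp

lemma isCont_squash: "isCont squash z"
  using continuous_on_squash by (simp add: continuous_on_eq_continuous_at)

lemma continuous_on_unsquash: "continuous_on (ball 0 1) unsquash"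
  unfolding unsquash_def by (intro continuous_intros) auto

lemma squash_sgn: "squash z = of_real (cmod (squash z)) * sgn z"
proof (cases "z = 0")
  case False
  then show ?thesis
    unfolding cmod_squash by (simp add: squash_def sgn_div_norm scaleR_conv_of_real field_simps)
qed (simp add: squash_def)

section \<open>The points added to the plane by the closure\<close>

locale separable_poly =
  fixes p :: "complex poly" and d :: nat
  assumes degree_p: "degree p = d" and d_ge_2: "d \<ge> 2" and card_rts: "card (rts p) = d"
begin

lemma p_nonzero: "p \<noteq> 0"
  using degree_p d_ge_2 by auto

lemma finite_rts: "finite (rts p)"
  using card_rts d_ge_2 by (intro card_ge_0_finite) simp

lemma sum_order:
  "(\<Sum>z | poly p z = w. order z (p - [:w:])) = d"
proof -
  have deg: "degree (p - [:w:]) = d"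
  proof -
    have "degree [:w:] < degree p"
      using degree_p d_ge_2 by simp
    then have "degree (p + - [:w:]) = degree p"
      by (intro degree_add_eq_left) (simp only: degree_minus)
    then show ?thesis
      using degree_p by (simp only: add_uminus_conv_diff)
  qed
  then have "p - [:w:] \<noteq> 0"
    using d_ge_2 by auto
  then have "size (proots (p - [:w:])) = (\<Sum>z | poly (p - [:w:]) z = 0. order z (p - [:w:]))"
    by (simp add: size_multiset_overloaded_eq)
  then show ?thesis
    using size_proots_complex[of "p - [:w:]"] deg by simp
qed

lemma order_diff_const:
  assumes "poly p z = w"
  shows "order z (p - [:w:]) = Suc (order z (pderiv p))"
proof -
  have "p \<noteq> [:w:]"
    using degree_p d_ge_2 by auto
  then have "order z (p - [:w:]) = Suc (order z (pderiv (p - [:w:])))"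
    using assms by (intro order_pderiv) auto
  then show ?thesis
    by (simp add: pderiv_diff)
qed

text \<open>The orders of the \<open>d\<close> roots are positive and add up to \<open>d\<close>,
  which leaves no room for an order above 1.\<close>

lemma simple_root:
  assumes "a \<in> rts p"
  shows "poly (pderiv p) a \<noteq> 0"
proof
  assume "poly (pderiv p) a = 0"
  have "pderiv p \<noteq> 0"
    using degree_p d_ge_2 by (simp add: pderiv_eq_0_iff)
  have rts: "rts p = {z. poly p z = 0}"
    by (simp add: rts_def)
  have ord: "order z (p - [:0:]) = Suc (order z (pderiv p))" if "z \<in> rts p" for z
    using that by (intro order_diff_const) (simp add: rts)
  have "order a (pderiv p) \<noteq> 0"
    using \<open>poly (pderiv p) a = 0\<close> \<open>pderiv p \<noteq> 0\<close> by (simp add: order_root)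
  have "card (rts p) = (\<Sum>z\<in>rts p. 1)"
    by simp
  also have "\<dots> < (\<Sum>z\<in>rts p. order z (p - [:0:]))"
  proof (rule sum_strict_mono_ex1[OF finite_rts])
    show "\<exists>z\<in>rts p. 1 < order z (p - [:0:])"
      using assms ord \<open>order a (pderiv p) \<noteq> 0\<close> by (intro bexI[of _ a]) simp_all
  qed (use ord in fastforce)
  also have "\<dots> = d"
    using sum_order[of 0] by (simp add: rts)
  finally show False
    using card_rts by simp
qed

definition J :: "complex \<Rightarrow> complex \<times> (complex \<times> real)" where
  "J z = (squash z, iA (poly p z))"

definition K :: "(complex \<times> (complex \<times> real)) set" where
  "K = closure (J ` (- rts p))"

text \<open>The quotient is the reflected polynomial at the inverse of \<open>f x\<close>, whose
  value at 0 is the leading coefficient.\<close>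

lemma poly_reflect_limit:
  assumes "filterlim f at_infinity F"
  shows "((\<lambda>x. poly p (f x) / f x ^ d) \<longlongrightarrow> lead_coeff p) F"
proof -
  have "((\<lambda>x. poly (reflect_poly p) (inverse (f x))) \<longlongrightarrow> poly (reflect_poly p) 0) F"
    by (intro tendsto_intros filterlim_compose[OF tendsto_inverse_0 assms])
  moreover have "poly (reflect_poly p) 0 = lead_coeff p"
    by (simp add: poly_0_coeff_0)
  ultimately have "((\<lambda>x. poly (reflect_poly p) (inverse (f x))) \<longlongrightarrow> lead_coeff p) F"
    by simp
  then show ?thesis
  proof (rule Lim_transform_eventually)
    have "eventually (\<lambda>x. f x \<noteq> 0) F"
      using assms by (rule filterlim_at_infinity_imp_eventually_ne)
    then show "eventually (\<lambda>x. poly (reflect_poly p) (inverse (f x)) = poly p (f x) / f x ^ d) F"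
      by eventually_elim (simp add: poly_reflect_poly_nz degree_p field_simps)
  qed
qed

lemma lead_coeff_ne: "lead_coeff p \<noteq> 0"
  using p_nonzero by simp

lemma height_tendsto_1:
  assumes "filterlim f at_infinity F"
  shows "((\<lambda>x. snd (iA (f x))) \<longlongrightarrow> 1) F"
proof -
  have "filterlim (\<lambda>x. cmod (f x)) at_top F"
    using assms by (rule filterlim_at_infinity_imp_norm_at_top)
  then have "filterlim (\<lambda>x. 1 + (cmod (f x))\<^sup>2) at_top F"
    by (intro filterlim_tendsto_add_at_top[OF tendsto_const] filterlim_pow_at_top) auto
  then have "filterlim (\<lambda>x. (cmod (f x))\<^sup>2 + 1) at_top F"
    by (simp add: add.commute)
  then have "((\<lambda>x. 2 / ((cmod (f x))\<^sup>2 + 1)) \<longlongrightarrow> 0) F"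
    by (intro tendsto_divide_0[OF tendsto_const] filterlim_at_top_imp_at_infinity)
  then have "((\<lambda>x. 1 - 2 / ((cmod (f x))\<^sup>2 + 1)) \<longlongrightarrow> 1 - 0) F"
    by (intro tendsto_diff tendsto_const)
  then show ?thesis
    unfolding height_iA_eq by simp
qed

text \<open>Along a sequence or filter with limiting direction \<open>e\<close>, the polynomial
  takes the direction of its leading term, hence the power \<open>e ^ d\<close>. This is how the
  outer circle comes to cover the top circle \<open>d\<close> times.\<close>

lemma J_tendsto_infinity:
  assumes f: "filterlim f at_infinity F" and e: "((\<lambda>x. sgn (f x)) \<longlongrightarrow> e) F"
  shows "((\<lambda>x. J (f x)) \<longlongrightarrow> (e, sgn (lead_coeff p) * e ^ d, 1)) F"
proof -
  have "filterlim (\<lambda>x. cmod (f x)) at_top F"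
    using f by (rule filterlim_at_infinity_imp_norm_at_top)
  then have "filterlim (\<lambda>x. 1 + cmod (f x)) at_top F"
    by (intro filterlim_tendsto_add_at_top[OF tendsto_const])
  then have "((\<lambda>x. 1 / (1 + cmod (f x))) \<longlongrightarrow> 0) F"
    by (intro tendsto_divide_0[OF tendsto_const] filterlim_at_top_imp_at_infinity)
  then have "((\<lambda>x. of_real (1 - 1 / (1 + cmod (f x))) * sgn (f x)) \<longlongrightarrow> of_real (1 - 0) * e) F"
    by (intro tendsto_intros e)
  moreover have "of_real (1 - 1 / (1 + cmod (f x))) * sgn (f x) = squash (f x)" for x
    unfolding one_minus_cmod_squash[symmetric] by (simp flip: squash_sgn)
  ultimately have 1: "((\<lambda>x. squash (f x)) \<longlongrightarrow> e) F"
    by simp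
  note lim = poly_reflect_limit[OF f]
  have ne: "eventually (\<lambda>x. f x \<noteq> 0) F"
    using f by (rule filterlim_at_infinity_imp_eventually_ne)
  have "((\<lambda>x. sgn (poly p (f x) / f x ^ d) * sgn (f x) ^ d) \<longlongrightarrow> sgn (lead_coeff p) * e ^ d) F"
    by (intro tendsto_intros lim e lead_coeff_ne)
  then have 2: "((\<lambda>x. sgn (poly p (f x))) \<longlongrightarrow> sgn (lead_coeff p) * e ^ d) F"
  proof (rule Lim_transform_eventually)
    show "eventually (\<lambda>x. sgn (poly p (f x) / f x ^ d) * sgn (f x) ^ d = sgn (poly p (f x))) F"
      using ne
    proof eventually_elim
      case (elim x)
      have "sgn (f x) ^ d = sgn (f x ^ d)"
        by (induction d) (simp_all add: sgn_mult)
      then have "sgn (poly p (f x) / f x ^ d) * sgn (f x) ^ d = sgn (poly p (f x) / f x ^ d * f x ^ d)"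
        by (simp only: sgn_mult)
      then show ?case
        using elim by simp
    qed
  qed
  have "filterlim (\<lambda>x. poly p (f x) / f x ^ d * f x ^ d) at_infinity F"
    using d_ge_2 by (intro tendsto_mult_filterlim_at_infinity[OF lim lead_coeff_ne] Limits.filterlim_power_at_infinity f) auto
  then have "filterlim (\<lambda>x. poly p (f x)) at_infinity F"
    by (rule filterlim_mono_eventually[OF _ order_refl order_refl]) (use ne in eventually_elim, simp)
  then have 3: "((\<lambda>x. snd (iA (poly p (f x)))) \<longlongrightarrow> 1) F"
    by (rule height_tendsto_1)
  have "J z = (squash z, sgn (poly p z), snd (iA (poly p z)))" for z
    by (simp add: J_def flip: direction_iA)
  then show ?thesis
    using 1 2 3 by (simp add: tendsto_Pair)
qed

lemma height_tendsto_minus_1: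
  assumes "(f \<longlongrightarrow> 0) F"
  shows "((\<lambda>x. snd (iA (f x))) \<longlongrightarrow> -1) F"
proof -
  have "((\<lambda>x. 1 - 2 / ((cmod (f x))\<^sup>2 + 1)) \<longlongrightarrow> 1 - 2 / ((cmod 0)\<^sup>2 + 1)) F"
    by (intro tendsto_intros assms) simp
  then show ?thesis
    unfolding height_iA_eq by simp
qed

lemma isCont_J: "z \<notin> rts p \<Longrightarrow> isCont J z"
proof -
  assume z: "z \<notin> rts p"
  have "isCont iA (poly p z)"
    using continuous_on_iA z by (simp add: continuous_on_eq_continuous_at rts_def open_Compl)
  then have "isCont (\<lambda>z. iA (poly p z)) z"
    by (intro isCont_o2[where f = "poly p" and g = iA]) simp_all
  then show ?thesis
    unfolding J_def by (intro continuous_intros isCont_squash)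
qed

lemma continuous_on_J: "continuous_on (- rts p) J"
  using isCont_J by (simp add: continuous_at_imp_continuous_on)

lemma inj_J: "J z = J w \<longleftrightarrow> z = w"
  by (auto simp: J_def inj_squash)

lemma open_complement_rts: "open (- rts p)"
  using finite_rts by (simp add: finite_imp_closed open_Compl)

text \<open>Take a sequence whose images under \<open>J\<close> converge. If the first coordinate of
  the limit has modulus below 1, the sequence converges in the plane, to a root or to another point;
  otherwise it tends to infinity in a definite direction.\<close>

lemma K_cases:
  assumes "x \<in> K"
  obtains (interior) z where "z \<notin> rts p" "x = J z"
  | (root) a u where "a \<in> rts p" "cmod u = 1" "x = (squash a, u, -1)"
  | (infinity) e where "cmod e = 1" "x = (e, sgn (lead_coeff p) * e ^ d, 1)"
proof -
  obtain y where y: "\<And>n. y n \<in> J ` (- rts p)" "y \<longlonglongrightarrow> x"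
    using assms unfolding K_def closure_sequential by blast
  then have "\<forall>n. \<exists>z. z \<notin> rts p \<and> y n = J z"
    by blast
  then obtain z where z: "\<And>n. z n \<notin> rts p" "\<And>n. y n = J (z n)"
    by metis
  have lim: "(\<lambda>n. J (z n)) \<longlonglongrightarrow> x"
    using y(2) unfolding z(2) .
  then have lim1: "(\<lambda>n. squash (z n)) \<longlonglongrightarrow> fst x" and lim2: "(\<lambda>n. iA (poly p (z n))) \<longlonglongrightarrow> snd x"
    by (auto simp: J_def dest: tendsto_fst tendsto_snd)
  have "(\<lambda>n. cmod (squash (z n))) \<longlonglongrightarrow> cmod (fst x)"
    by (intro tendsto_norm lim1)
  then have "cmod (fst x) \<le> 1"
    by (rule LIMSEQ_le_const2) (auto intro: less_imp_le[OF cmod_squash_less])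
  then consider "cmod (fst x) < 1" | "cmod (fst x) = 1"
    by linarith
  then show thesis
  proof cases
    case 1
    define c where "c = unsquash (fst x)"
    have "isCont unsquash (fst x)"
      using continuous_on_unsquash 1 by (simp add: continuous_on_eq_continuous_at)
    then have "(\<lambda>n. unsquash (squash (z n))) \<longlonglongrightarrow> c"
      unfolding c_def using lim1 by (rule isCont_tendsto_compose)
    then have c: "z \<longlonglongrightarrow> c"
      by simp
    show thesis
    proof (cases "c \<in> rts p")
      case False
      then have "(\<lambda>n. J (z n)) \<longlonglongrightarrow> J c"
        using isCont_J c by (blast intro: isCont_tendsto_compose)
      then show thesis
        using LIMSEQ_unique[OF lim] interior[OF False] by blast
    next
      case True
      have "(\<lambda>n. squash (z n)) \<longlonglongrightarrow> squash c"
        using c isCont_squash by (blast intro: isCont_tendsto_compose)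
      then have fst: "fst x = squash c"
        using LIMSEQ_unique[OF lim1] by blast
      have "(\<lambda>n. poly p (z n)) \<longlonglongrightarrow> poly p c"
        by (intro tendsto_intros c)
      then have "(\<lambda>n. snd (iA (poly p (z n)))) \<longlonglongrightarrow> -1"
        using True by (intro height_tendsto_minus_1) (simp add: rts_def)
      then have snd: "snd (snd x) = -1"
        using LIMSEQ_unique[OF tendsto_snd[OF lim2]] by blast
      \<comment> \<open>At a root the limiting direction of the values of \<open>p\<close> depends
        on the sequence, so only its modulus is determined.\<close>
      have "(\<lambda>n. cmod (fst (iA (poly p (z n))))) \<longlonglongrightarrow> cmod (fst (snd x))"
        by (intro tendsto_norm tendsto_fst lim2)
      moreover have "cmod (fst (iA (poly p (z n)))) = 1" for n
        using z(1)[of n] by (simp add: direction_iA norm_sgn rts_def)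
      ultimately have "(\<lambda>n. 1) \<longlonglongrightarrow> cmod (fst (snd x))"
        by simp
      then have "cmod (fst (snd x)) = 1"
        using LIMSEQ_unique[OF _ tendsto_const] by blast
      then show thesis
        using root[OF True, of "fst (snd x)"] fst snd by (simp add: prod_eq_iff)
    qed
  next
    case 2
    have "(\<lambda>n. 1 - cmod (squash (z n))) \<longlonglongrightarrow> 1 - cmod (fst x)"
      by (intro tendsto_intros lim1)
    then have "(\<lambda>n. 1 / (1 + cmod (z n))) \<longlonglongrightarrow> 0"
      unfolding one_minus_cmod_squash 2 by simp
    then have "filterlim (\<lambda>n. inverse (1 / (1 + cmod (z n)))) at_top sequentially"
      by (rule filterlim_inverse_at_top) (auto intro!: always_eventually simp: add_pos_nonneg)
    then have "filterlim (\<lambda>n. 1 + cmod (z n)) at_top sequentially"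
      by simp
    then have "filterlim (\<lambda>n. - 1 + (1 + cmod (z n))) at_top sequentially"
      by (rule filterlim_tendsto_add_at_top[OF tendsto_const])
    then have inf: "filterlim z at_infinity sequentially"
      by (simp add: filterlim_norm_at_top_imp_at_infinity)
    have "(\<lambda>n. squash (z n) / of_real (cmod (squash (z n)))) \<longlonglongrightarrow> fst x / of_real (cmod (fst x))"
      by (intro tendsto_intros lim1) (simp add: 2)
    then have "(\<lambda>n. squash (z n) / of_real (cmod (squash (z n)))) \<longlonglongrightarrow> fst x"
      by (simp add: 2)
    then have "(\<lambda>n. sgn (z n)) \<longlonglongrightarrow> fst x"
    proof (rule Lim_transform_eventually)
      have "eventually (\<lambda>n. z n \<noteq> 0) sequentially"
        using inf by (rule filterlim_at_infinity_imp_eventually_ne)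
      then show "eventually (\<lambda>n. squash (z n) / of_real (cmod (squash (z n))) = sgn (z n)) sequentially"
      proof eventually_elim
        case (elim n)
        then have "cmod (squash (z n)) \<noteq> 0"
          by (simp add: cmod_squash)
        then show ?case
          by (subst squash_sgn) simp
      qed
    qed
    then have "(\<lambda>n. J (z n)) \<longlonglongrightarrow> (fst x, sgn (lead_coeff p) * fst x ^ d, 1)"
      by (rule J_tendsto_infinity[OF inf])
    then have "x = (fst x, sgn (lead_coeff p) * fst x ^ d, 1)"
      using LIMSEQ_unique[OF lim] by blast
    then show thesis
      by (rule infinity[OF 2])
  qed
qed

lemma J_in_K: "z \<notin> rts p \<Longrightarrow> J z \<in> K"
  unfolding K_def by (intro subsetD[OF closure_subset] imageI) simp

lemma limit_in_K:
  assumes "eventually (\<lambda>n. z n \<notin> rts p) sequentially" "(\<lambda>n. J (z n)) \<longlonglongrightarrow> x"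
  shows "x \<in> K"
proof (rule Lim_in_closed_set[OF _ _ _ assms(2)])
  show "closed K"
    by (simp add: K_def)
  show "eventually (\<lambda>n. J (z n) \<in> K) sequentially"
    using assms(1) by eventually_elim (rule J_in_K)
qed simp

text \<open>At a simple root every direction \<open>u\<close> is attained as a limit, by approaching
  the root along the direction that the derivative turns into \<open>u\<close>.\<close>

lemma root_in_K:
  assumes a: "a \<in> rts p" and u: "cmod u = 1"
  shows "(squash a, u, -1) \<in> K"
proof -
  define c where "c = poly (pderiv p) a"
  have "c \<noteq> 0"
    using simple_root[OF a] by (simp add: c_def)
  \<comment> \<open>To first order the value of \<open>p\<close> at \<open>z n\<close> is
    \<open>u\<close> divided by \<open>Suc n\<close>.\<close>
  define z where "z n = a + of_real (inverse (real (Suc n))) * (u / c)" for n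
  have "(\<lambda>n. a + of_real (inverse (real (Suc n))) * (u / c)) \<longlonglongrightarrow> a + of_real 0 * (u / c)"
    by (intro tendsto_intros LIMSEQ_inverse_real_of_nat)
  then have z: "z \<longlonglongrightarrow> a"
    by (simp add: z_def[abs_def])
  obtain q where q: "p = [:- a, 1:] * q"
    using a by (metis dvdE mem_Collect_eq poly_eq_0_iff_dvd rts_def)
  have "pderiv p = [:- a, 1:] * pderiv q + q * pderiv [:- a, 1:]"
    unfolding q by (rule pderiv_mult)
  then have "c = poly q a"
    unfolding c_def by (simp add: pderiv_pCons)
  then have qz: "(\<lambda>n. poly q (z n)) \<longlonglongrightarrow> c"
    using z by (auto intro!: tendsto_intros)
  have pz: "sgn (poly p (z n)) = sgn (u / c) * sgn (poly q (z n))" for n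
  proof -
    have "poly p (z n) = of_real (inverse (real (Suc n))) * (u / c) * poly q (z n)"
      by (subst q) (simp add: z_def algebra_simps)
    moreover have "sgn (complex_of_real (inverse (real (Suc n)))) = 1"
      unfolding sgn_of_real by simp
    ultimately show ?thesis
      by (simp only: sgn_mult) simp
  qed
  have "(\<lambda>n. sgn (u / c) * sgn (poly q (z n))) \<longlonglongrightarrow> sgn (u / c) * sgn c"
    by (intro tendsto_intros qz \<open>c \<noteq> 0\<close>)
  moreover have "sgn (u / c) * sgn c = sgn (u / c * c)"
    by (rule sgn_mult[symmetric])
  then have "sgn (u / c) * sgn c = u"
    using \<open>c \<noteq> 0\<close> u by (simp add: sgn_div_norm)
  ultimately have 1: "(\<lambda>n. sgn (poly p (z n))) \<longlonglongrightarrow> u"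
    by (simp add: pz)
  have "(\<lambda>n. poly p (z n)) \<longlonglongrightarrow> poly p a"
    by (intro tendsto_intros z)
  then have 2: "(\<lambda>n. snd (iA (poly p (z n)))) \<longlonglongrightarrow> -1"
    using a by (intro height_tendsto_minus_1) (simp add: rts_def)
  have 3: "(\<lambda>n. squash (z n)) \<longlonglongrightarrow> squash a"
    using z isCont_squash by (blast intro: isCont_tendsto_compose)
  have "J z = (squash z, sgn (poly p z), snd (iA (poly p z)))" for z
    by (simp add: J_def flip: direction_iA)
  then have "(\<lambda>n. J (z n)) \<longlonglongrightarrow> (squash a, u, -1)"
    using 1 2 3 by (simp add: tendsto_Pair)
  moreover have "eventually (\<lambda>n. z n \<notin> rts p) sequentially"
  proof -
    have "u \<noteq> 0"
      using u by auto
    have "eventually (\<lambda>n. poly q (z n) \<noteq> 0) sequentially"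
      using qz \<open>c \<noteq> 0\<close> by (rule tendsto_imp_eventually_ne)
    then show ?thesis
    proof eventually_elim
      case (elim n)
      have "poly p (z n) = of_real (inverse (real (Suc n))) * (u / c) * poly q (z n)"
        by (subst q) (simp add: z_def algebra_simps)
      moreover have "complex_of_real (inverse (real (Suc n))) \<noteq> 0"
        by (simp del: of_nat_Suc)
      ultimately have "poly p (z n) \<noteq> 0"
        using elim \<open>u \<noteq> 0\<close> \<open>c \<noteq> 0\<close> by simp
      then show ?case
        by (simp add: rts_def)
    qed
  qed
  ultimately show ?thesis
    by (rule limit_in_K[rotated])
qed

lemma infinity_in_K:
  assumes e: "cmod e = 1"
  shows "(e, sgn (lead_coeff p) * e ^ d, 1) \<in> K"
proof -
  define z where "z n = of_real (real (Suc n)) * e" for n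
  have inf: "filterlim z at_infinity sequentially"
  proof (rule filterlim_norm_at_top_imp_at_infinity)
    have "cmod (z n) = real (Suc n)" for n
      using e by (simp add: z_def norm_mult del: of_nat_Suc)
    then show "filterlim (\<lambda>n. cmod (z n)) at_top sequentially"
      using filterlim_compose[OF filterlim_real_sequentially filterlim_Suc] by simp
  qed
  have "sgn (z n) = e" for n
  proof -
    have "sgn (z n) = sgn (complex_of_real (real (Suc n))) * sgn e"
      unfolding z_def by (rule sgn_mult)
    also have "sgn (complex_of_real (real (Suc n))) = 1"
      unfolding sgn_of_real by simp
    also have "sgn e = e"
      using e by (simp add: sgn_div_norm)
    finally show ?thesis by simp
  qed
  then have "(\<lambda>n. sgn (z n)) \<longlonglongrightarrow> e"
    by simp
  from J_tendsto_infinity[OF inf this]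
  show ?thesis
  proof (rule limit_in_K[rotated])
    obtain R where R: "\<forall>a\<in>rts p. cmod a \<le> R"
      using finite_imp_bounded[OF finite_rts] unfolding bounded_iff by blast
    have "eventually (\<lambda>n. cmod (z n) > R) sequentially"
      using filterlim_at_infinity_imp_norm_at_top[OF inf] by (simp add: filterlim_at_top_dense)
    then show "eventually (\<lambda>n. z n \<notin> rts p) sequentially"
      by eventually_elim (use R in fastforce)
  qed
qed

end

subsection \<open>Fibres and local multiplicities\<close>

text \<open>A holomorphic function that does not vanish at \<xi> has a holomorphic
  \<open>n\<close>-th root \<open>k\<close> nearby. The product with \<open>z - \<xi>\<close> has
  derivative \<open>k \<xi>\<close>, which is nonzero, hence it is injective near \<xi>.\<close>

lemma local_root_chart:
  assumes g: "g holomorphic_on S" "open S" "\<xi> \<in> S" "g \<xi> \<noteq> 0" and "n > 0"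
  shows "\<exists>r k. r > 0 \<and> k holomorphic_on ball \<xi> r \<and>
    (\<forall>z\<in>ball \<xi> r. g z = k z ^ n \<and> k z \<noteq> 0) \<and> inj_on (\<lambda>z. (z - \<xi>) * k z) (ball \<xi> r)"
proof -
  have "isCont g \<xi>"
    using g by (meson continuous_on_eq_continuous_at holomorphic_on_imp_continuous_on)
  moreover have "0 < cmod (g \<xi>)"
    using g(4) by simp
  ultimately obtain s where s: "s > 0" "\<And>z. dist z \<xi> < s \<Longrightarrow> dist (g z) (g \<xi>) < cmod (g \<xi>)"
    unfolding continuous_at_eps_delta by blast
  obtain s' where s': "s' > 0" "ball \<xi> s' \<subseteq> S"
    using g(2,3) by (meson open_contains_ball)
  define t where "t = min s s'"
  have t: "t > 0" "ball \<xi> t \<subseteq> S"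
    using s s' by (auto simp: t_def)
  \<comment> \<open>Quotients in the right half-plane avoid the branch cut of
    \<open>Ln\<close>.\<close>
  have re: "0 < Re (g z / g \<xi>)" if "z \<in> ball \<xi> t" for z
  proof -
    have "dist (g z) (g \<xi>) < cmod (g \<xi>)"
      using s(2)[of z] that by (auto simp: t_def dist_commute)
    then have "cmod (g z / g \<xi> - 1) < 1"
      using g(4) by (simp add: dist_norm norm_divide field_simps diff_divide_distrib[symmetric])
    then show ?thesis
      using abs_Re_le_cmod[of "g z / g \<xi> - 1"] by simp
  qed
  define c where "c = exp (Ln (g \<xi>) / of_nat n)"
  define k where "k z = c * exp (Ln (g z / g \<xi>) / of_nat n)" for z
  have nn: "g z / g \<xi> \<notin> \<real>\<^sub>\<le>\<^sub>0" if "z \<in> ball \<xi> t" for z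
    using re[OF that] by (simp add: complex_nonpos_Reals_iff)
  have holg: "g holomorphic_on ball \<xi> t"
    using g(1) t(2) by (rule holomorphic_on_subset)
  have holk: "k holomorphic_on ball \<xi> t"
    unfolding k_def using g(4) nn \<open>n > 0\<close>
    by (intro holomorphic_intros holg) auto
  have kn: "g z = k z ^ n" if "z \<in> ball \<xi> t" for z
  proof -
    have "g z / g \<xi> \<noteq> 0"
      using re[OF that] by fastforce
    then show ?thesis
      using g(4) \<open>n > 0\<close> by (simp add: k_def c_def power_mult_distrib exp_divide_power_eq)
  qed
  have kne: "k z \<noteq> 0" for z
    by (simp add: k_def c_def)
  let ?h = "\<lambda>z. (z - \<xi>) * k z"
  have "(k has_field_derivative deriv k \<xi>) (at \<xi>)"
    by (rule holomorphic_derivI[OF holk open_ball]) (simp add: t(1))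
  then have "(?h has_field_derivative (1 - 0) * k \<xi> + deriv k \<xi> * (\<xi> - \<xi>)) (at \<xi>)"
    by (intro DERIV_mult DERIV_diff DERIV_ident DERIV_const)
  then have "deriv ?h \<xi> = k \<xi>"
    by (simp add: DERIV_imp_deriv)
  moreover have "?h holomorphic_on ball \<xi> t"
    by (intro holomorphic_intros holk)
  ultimately obtain r where r: "r > 0" "ball \<xi> r \<subseteq> ball \<xi> t" "inj_on ?h (ball \<xi> r)"
    using has_complex_derivative_locally_injective[of ?h "ball \<xi> t" \<xi>] kne t(1) by auto
  have "k holomorphic_on ball \<xi> r"
    using holk r(2) by (rule holomorphic_on_subset)
  moreover have "\<forall>z\<in>ball \<xi> r. g z = k z ^ n \<and> k z \<noteq> 0"
    using kn kne r(2) by blast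
  ultimately show ?thesis
    using r(1,3) by blast
qed

lemma card_nth_roots_le:
  fixes c :: complex
  assumes "n > 0"
  shows "finite {z. z ^ n = c}" "card {z. z ^ n = c} \<le> n"
proof -
  have "finite {z. z ^ n = c} \<and> card {z. z ^ n = c} \<le> n"
  proof (cases "c = 0")
    case True
    then have "{z. z ^ n = c} = {0}"
      using assms by auto
    then show ?thesis
      using assms by simp
  next
    case False
    then show ?thesis
      using card_nth_roots[OF False assms] assms by (auto intro: card_ge_0_finite)
  qed
  then show "finite {z. z ^ n = c}" "card {z. z ^ n = c} \<le> n"
    by auto
qed

lemma card_le_1I:
  assumes "\<And>x y. x \<in> S \<Longrightarrow> y \<in> S \<Longrightarrow> x = y"
  shows "card S \<le> 1"
proof (cases "S = {}")
  case False
  then obtain x where "S = {x}"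
    using assms by blast
  then show ?thesis by simp
qed simp

section \<open>Local degrees of the projection\<close>

context separable_poly
begin

text \<open>The local degree of the projection: at \<open>J z\<close> it is the order of vanishing
  of \<open>p\<close> minus its value at \<open>z\<close>. Boundary points need a separate clause,
  since on the circle at infinity \<open>unsquash\<close> divides by zero.\<close>

definition mult :: "complex \<times> (complex \<times> real) \<Rightarrow> nat" where
  "mult x = (if \<bar>snd (snd x)\<bar> < 1 then Suc (order (unsquash (fst x)) (pderiv p)) else 1)"

lemma height_J: "z \<notin> rts p \<Longrightarrow> \<bar>snd (snd (J z))\<bar> < 1"
  using height_iA_bounds[of "poly p z"] by (simp add: J_def rts_def abs_less_iff)

lemma mult_J: "z \<notin> rts p \<Longrightarrow> mult (J z) = Suc (order z (pderiv p))"
  using height_J by (simp add: mult_def J_def)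

lemma snd_K: "snd ` K \<subseteq> annulus_set"
proof (rule image_subsetI)
  fix x assume "x \<in> K"
  then show "snd x \<in> annulus_set"
  proof (cases rule: K_cases)
    case (interior z)
    then show ?thesis
      using iA_in_annulus by (simp add: J_def rts_def)
  next
    case (root a u)
    then show ?thesis
      by (simp add: annulus_set_def)
  next
    case (infinity e)
    then show ?thesis
      using lead_coeff_ne by (simp add: annulus_set_def norm_mult norm_power norm_sgn)
  qed
qed

lemma compact_K: "compact K"
proof -
  have "J ` (- rts p) \<subseteq> cball 0 1 \<times> (sphere 0 1 \<times> {-1..1})"
    using J_in_K snd_K less_imp_le[OF cmod_squash_less] by (fastforce simp: J_def annulus_set_def)
  moreover have "compact (cball (0::complex) 1 \<times> (sphere (0::complex) 1 \<times> {-1..1::real}))"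
    by (intro compact_Times) auto
  ultimately show ?thesis
    unfolding K_def by (meson bounded_subset compact_closure compact_imp_bounded)
qed

lemma fibre_interior:
  assumes "a \<in> annulus_set" "\<bar>snd a\<bar> < 1"
  shows "{x \<in> K. snd x = a} = J ` {z. poly p z = iA_inv a}"
proof -
  have w: "iA (iA_inv a) = a" "iA_inv a \<noteq> 0"
    using iA_iA_inv[of a] assms by auto
  show ?thesis
  proof
    show "J ` {z. poly p z = iA_inv a} \<subseteq> {x \<in> K. snd x = a}"
    proof (rule image_subsetI)
      fix z assume "z \<in> {z. poly p z = iA_inv a}"
      then show "J z \<in> {x \<in> K. snd x = a}"
        using w J_in_K[of z] by (simp add: J_def rts_def)
    qed
    show "{x \<in> K. snd x = a} \<subseteq> J ` {z. poly p z = iA_inv a}"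
    proof
      fix x assume x: "x \<in> {x \<in> K. snd x = a}"
      then have "x \<in> K" "snd x = a"
        by auto
      from \<open>x \<in> K\<close> show "x \<in> J ` {z. poly p z = iA_inv a}"
      proof (cases rule: K_cases)
        case (interior z)
        then have "iA_inv a = poly p z"
          using \<open>snd x = a\<close> iA_inv_iA[of "poly p z"] by (auto simp: J_def rts_def)
        then show ?thesis
          using interior by (intro image_eqI[of _ _ z]) auto
      qed (use \<open>snd x = a\<close> assms in auto)
    qed
  qed
qed

lemma fibre_root:
  assumes "cmod u = 1"
  shows "{x \<in> K. snd x = (u, -1)} = (\<lambda>a. (squash a, u, -1)) ` rts p"
proof
  show "(\<lambda>a. (squash a, u, -1)) ` rts p \<subseteq> {x \<in> K. snd x = (u, -1)}"
    using root_in_K assms by auto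
  show "{x \<in> K. snd x = (u, -1)} \<subseteq> (\<lambda>a. (squash a, u, -1)) ` rts p"
  proof
    fix x assume "x \<in> {x \<in> K. snd x = (u, -1)}"
    then have "x \<in> K" "snd x = (u, -1)"
      by auto
    from \<open>x \<in> K\<close> show "x \<in> (\<lambda>a. (squash a, u, -1)) ` rts p"
    proof (cases rule: K_cases)
      case (interior z)
      then show ?thesis
        using height_J[of z] \<open>snd x = (u, -1)\<close> by simp
    qed (use \<open>snd x = (u, -1)\<close> in auto)
  qed
qed

lemma fibre_infinity:
  assumes "cmod u = 1"
  shows "{x \<in> K. snd x = (u, 1)} = (\<lambda>e. (e, u, 1)) ` {e. e ^ d = u / sgn (lead_coeff p)}"
proof
  have ne: "sgn (lead_coeff p) \<noteq> 0"
    using lead_coeff_ne by (simp add: sgn_zero_iff)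
  show "(\<lambda>e. (e, u, 1)) ` {e. e ^ d = u / sgn (lead_coeff p)} \<subseteq> {x \<in> K. snd x = (u, 1)}"
  proof (rule image_subsetI)
    fix e assume "e \<in> {e. e ^ d = u / sgn (lead_coeff p)}"
    then have e: "e ^ d = u / sgn (lead_coeff p)"
      by simp
    have "cmod e ^ d = 1"
      using assms lead_coeff_ne by (simp add: e norm_power[symmetric] norm_divide norm_sgn)
    then have "cmod e = 1"
      using d_ge_2 power_eq_1_iff[of "cmod e" d] by auto
    moreover have "sgn (lead_coeff p) * e ^ d = u"
      using ne by (simp add: e)
    ultimately show "(e, u, 1) \<in> {x \<in> K. snd x = (u, 1)}"
      using infinity_in_K[of e] by simp
  qed
  show "{x \<in> K. snd x = (u, 1)} \<subseteq> (\<lambda>e. (e, u, 1)) ` {e. e ^ d = u / sgn (lead_coeff p)}"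
  proof
    fix x assume "x \<in> {x \<in> K. snd x = (u, 1)}"
    then have "x \<in> K" "snd x = (u, 1)"
      by auto
    from \<open>x \<in> K\<close> show "x \<in> (\<lambda>e. (e, u, 1)) ` {e. e ^ d = u / sgn (lead_coeff p)}"
    proof (cases rule: K_cases)
      case (interior z)
      then show ?thesis
        using height_J[of z] \<open>snd x = (u, 1)\<close> by simp
    next
      case (infinity e)
      then have "sgn (lead_coeff p) * e ^ d = u"
        using \<open>snd x = (u, 1)\<close> by simp
      then have "e ^ d = u / sgn (lead_coeff p)"
        using ne by auto
      then show ?thesis
        using infinity \<open>snd x = (u, 1)\<close> by auto
    qed (use \<open>snd x = (u, 1)\<close> in auto)
  qed
qed

text \<open>Three counts with the same total: solutions of a polynomial equation with their orders
  in the interior, the \<open>d\<close> distinct roots at the bottom, and the \<open>d\<close>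
  solutions of a pure power equation at the top.\<close>

lemma fibre_degree:
  assumes "a \<in> annulus_set"
  shows "finite {x \<in> K. snd x = a}" "(\<Sum>x | x \<in> K \<and> snd x = a. mult x) = d"
proof -
  obtain u h where a: "a = (u, h)" "cmod u = 1" "-1 \<le> h" "h \<le> 1"
    using assms by (auto simp: annulus_set_def)
  then consider "\<bar>h\<bar> < 1" | "h = -1" | "h = 1"
    by linarith
  then have "finite {x \<in> K. snd x = a} \<and> sum mult {x \<in> K. snd x = a} = d"
  proof cases
    case 1
    let ?w = "iA_inv a"
    have "?w \<noteq> 0"
      using iA_iA_inv(2)[OF assms] 1 a by auto
    then have nr: "z \<notin> rts p" if "poly p z = ?w" for z
      using that by (simp add: rts_def)
    have "p - [:?w:] \<noteq> 0"
      using degree_p d_ge_2 by auto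
    then have "finite {z. poly (p - [:?w:]) z = 0}"
      by (rule poly_roots_finite)
    then have fin: "finite {z. poly p z = ?w}"
      by simp
    have eq: "{x \<in> K. snd x = a} = J ` {z. poly p z = ?w}"
      using fibre_interior[OF assms] 1 a by simp
    have "inj_on J {z. poly p z = ?w}"
      by (simp add: inj_on_def inj_J)
    then have "sum mult {x \<in> K. snd x = a} = (\<Sum>z | poly p z = ?w. mult (J z))"
      unfolding eq by (simp add: sum.reindex)
    also have "\<dots> = (\<Sum>z | poly p z = ?w. order z (p - [:?w:]))"
      by (intro sum.cong refl) (simp add: mult_J nr order_diff_const)
    finally show ?thesis
      using fin sum_order eq by simp
  next
    case 2
    have eq: "{x \<in> K. snd x = a} = (\<lambda>a. (squash a, u, -1)) ` rts p"
      using fibre_root[OF a(2)] 2 a(1) by simp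
    have "inj_on (\<lambda>a. (squash a, u, -1 :: real)) (rts p)"
      by (simp add: inj_on_def inj_squash)
    then show ?thesis
      unfolding eq using finite_rts card_rts by (simp add: sum.reindex mult_def)
  next
    case 3
    have eq: "{x \<in> K. snd x = a} = (\<lambda>e. (e, u, 1)) ` {e. e ^ d = u / sgn (lead_coeff p)}"
      using fibre_infinity[OF a(2)] 3 a(1) by simp
    have "u / sgn (lead_coeff p) \<noteq> 0"
      using a(2) lead_coeff_ne by (auto simp: sgn_zero_iff)
    then have "card {e. e ^ d = u / sgn (lead_coeff p)} = d"
      using card_nth_roots d_ge_2 by simp
    moreover have "finite {e. e ^ d = u / sgn (lead_coeff p)}"
      using card_nth_roots_le(1) d_ge_2 by simp
    moreover have "inj_on (\<lambda>e. (e, u, 1 :: real)) {e. e ^ d = u / sgn (lead_coeff p)}"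
      by (simp add: inj_on_def)
    ultimately show ?thesis
      unfolding eq by (simp add: sum.reindex mult_def)
  qed
  then show "finite {x \<in> K. snd x = a}" "(\<Sum>x | x \<in> K \<and> snd x = a. mult x) = d"
    by auto
qed

text \<open>The points whose first coordinate corresponds to a point of \<open>U\<close>.
  Restricting to the open disc leaves out the circle at infinity.\<close>

definition tube :: "complex set \<Rightarrow> (complex \<times> (complex \<times> real)) set" where
  "tube U = {y \<in> ball 0 1. unsquash y \<in> U} \<times> UNIV"

lemma open_tube: "open U \<Longrightarrow> open (tube U)"
proof -
  assume "open U"
  then have "open (ball 0 1 \<inter> unsquash -` U)"
    by (intro continuous_open_preimage continuous_on_unsquash) auto
  moreover have "ball 0 1 \<inter> unsquash -` U = {y \<in> ball 0 1. unsquash y \<in> U}"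
    by auto
  ultimately show ?thesis
    unfolding tube_def by (metis open_Times open_UNIV)
qed

lemma squash_in_tube: "(squash z, b) \<in> tube U \<longleftrightarrow> z \<in> U"
  using cmod_squash_less[of z] by (simp add: tube_def)

lemma tube_cases:
  assumes "x \<in> K" "x \<in> tube U"
  obtains (interior) z where "z \<notin> rts p" "x = J z" "z \<in> U"
  | (root) a u where "a \<in> rts p" "cmod u = 1" "x = (squash a, u, -1)" "a \<in> U"
  using assms(1)
proof (cases rule: K_cases)
  case (interior z)
  then show ?thesis
    using that(1) assms(2) squash_in_tube by (simp add: J_def)
next
  case (root a u)
  then show ?thesis
    using that(2) assms(2) squash_in_tube by simp
next
  case (infinity e)
  then show ?thesis
    using assms(2) by (simp add: tube_def)
qed

text \<open>Split off the exact power of the linear factor from \<open>p\<close> minus its value at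
  \<open>z\<close>, and take a root of the nonvanishing cofactor.\<close>

lemma local_chart:
  "\<exists>r \<psi>. r > 0 \<and> inj_on \<psi> (ball z r) \<and>
    (\<forall>x\<in>ball z r. poly p x - poly p z = \<psi> x ^ Suc (order z (pderiv p)))"
proof -
  let ?m = "Suc (order z (pderiv p))" and ?q = "p - [:poly p z:]"
  have "p \<noteq> [:poly p z:]"
    using degree_p d_ge_2 by (metis degree_pCons_0 not_numeral_le_zero)
  then have "?q \<noteq> 0"
    by simp
  then obtain q where q: "?q = [:- z, 1:] ^ ?m * q" "\<not> [:- z, 1:] dvd q"
    using order_decomp[of ?q z] order_diff_const[of z "poly p z"] by auto
  have "poly q z \<noteq> 0"
    using q(2) by (simp add: poly_eq_0_iff_dvd)
  then have "\<exists>r k. r > 0 \<and> k holomorphic_on ball z r \<and>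
    (\<forall>x\<in>ball z r. poly q x = k x ^ ?m \<and> k x \<noteq> 0) \<and> inj_on (\<lambda>x. (x - z) * k x) (ball z r)"
    by (intro local_root_chart[where S = UNIV] holomorphic_intros) auto
  then obtain r k where rk: "r > 0" "\<forall>x\<in>ball z r. poly q x = k x ^ ?m \<and> k x \<noteq> 0"
    "inj_on (\<lambda>x. (x - z) * k x) (ball z r)"
    by blast
  show ?thesis
  proof (intro exI[of _ r] exI[of _ "\<lambda>x. (x - z) * k x"] conjI ballI)
    fix x assume x: "x \<in> ball z r"
    have "poly p x - poly p z = poly ?q x"
      by simp
    also have "\<dots> = (x - z) ^ ?m * poly q x"
    proof -
      have "poly [:- z, 1:] x = x - z"
        by simp
      then show ?thesis
        by (simp only: q(1) poly_mult poly_power)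
    qed
    also have "\<dots> = ((x - z) * k x) ^ ?m"
      using bspec[OF rk(2) x] by (simp only: power_mult_distrib)
    finally show "poly p x - poly p z = ((x - z) * k x) ^ ?m" .
  qed (use rk in auto)
qed

text \<open>In the chart \<open>\<psi>\<close>, nearby points of one fibre inject into the solutions
  of \<open>\<omega> ^ ?m = ?c\<close>, of which there are at most \<open>?m\<close>.\<close>

lemma local_mult_interior:
  assumes z: "z \<notin> rts p"
  shows "\<exists>N. open N \<and> J z \<in> N \<and> (\<forall>a. card {y \<in> K \<inter> N. snd y = a} \<le> mult (J z))"
proof -
  let ?m = "Suc (order z (pderiv p))"
  obtain r \<psi> where r: "r > 0" "inj_on \<psi> (ball z r)"
    "\<forall>x\<in>ball z r. poly p x - poly p z = \<psi> x ^ ?m"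
    using local_chart[of z] by blast
  obtain s where s: "s > 0" "ball z s \<subseteq> - rts p"
    using open_complement_rts z by (meson ComplI open_contains_ball)
  \<comment> \<open>Shrinking away from the roots leaves only interior points over
    \<open>U\<close>.\<close>
  define U where "U = ball z (min r s)"
  have U: "open U" "z \<in> U" "U \<subseteq> ball z r" "U \<inter> rts p = {}"
    using r s by (auto simp: U_def)
  have "card {y \<in> K \<inter> tube U. snd y = a} \<le> ?m" for a
  proof -
    let ?S = "{y \<in> K \<inter> tube U. snd y = a}" and ?c = "iA_inv a - poly p z"
    have form: "\<exists>x. x \<in> U \<and> y = J x \<and> poly p x = iA_inv a" if "y \<in> ?S" for y
    proof -
      have y: "y \<in> K" "y \<in> tube U" "snd y = a"
        using that by auto
      from y(1,2) show ?thesis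
      proof (cases rule: tube_cases)
        case (interior x)
        then have "iA_inv a = poly p x"
          using y(3) iA_inv_iA[of "poly p x"] by (auto simp: J_def rts_def)
        then show ?thesis
          using interior by metis
      next
        case (root b u)
        then show ?thesis
          using U(4) by blast
      qed
    qed
    have "card ?S \<le> card {\<omega>. \<omega> ^ ?m = ?c}"
    proof (rule card_inj_on_le)
      show "inj_on (\<lambda>y. \<psi> (unsquash (fst y))) ?S"
      proof (rule inj_onI)
        fix y y' assume *: "y \<in> ?S" "y' \<in> ?S" "\<psi> (unsquash (fst y)) = \<psi> (unsquash (fst y'))"
        obtain x x' where x: "x \<in> U" "y = J x" "x' \<in> U" "y' = J x'"
          using form[OF *(1)] form[OF *(2)] by blast
        then have "\<psi> x = \<psi> x'"
          using *(3) by (simp add: J_def)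
        then have "x = x'"
          using inj_onD[OF r(2)] x U(3) by blast
        then show "y = y'"
          using x by simp
      qed
      show "(\<lambda>y. \<psi> (unsquash (fst y))) ` ?S \<subseteq> {\<omega>. \<omega> ^ ?m = ?c}"
      proof (rule image_subsetI)
        fix y assume "y \<in> ?S"
        then obtain x where x: "x \<in> U" "y = J x" "poly p x = iA_inv a"
          using form by blast
        then have "\<psi> x ^ ?m = ?c"
          using bspec[OF r(3), of x] U(3) by auto
        then show "\<psi> (unsquash (fst y)) \<in> {\<omega>. \<omega> ^ ?m = ?c}"
          using x(2) by (simp add: J_def)
      qed
    qed (rule card_nth_roots_le, simp)
    also have "\<dots> \<le> ?m"
      by (rule card_nth_roots_le) simp
    finally show ?thesis .
  qed
  then show ?thesis
    using U open_tube mult_J[OF z] squash_in_tube by (intro exI[of _ "tube U"]) (simp add: J_def)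
qed

text \<open>At a simple root the chart has exponent 1, so \<open>p\<close> itself is injective
  nearby. Interior and boundary points never share a fibre because their heights differ, and
  boundary points of one fibre over \<open>U\<close> come from the same root.\<close>

lemma local_mult_root:
  assumes a: "a \<in> rts p"
  shows "\<exists>N. open N \<and> (squash a, u, -1) \<in> N \<and> (\<forall>b. card {y \<in> K \<inter> N. snd y = b} \<le> 1)"
proof -
  have "order a (pderiv p) = 0"
    using simple_root[OF a] by (simp add: order_root)
  then obtain r \<psi> where r: "r > 0" "inj_on \<psi> (ball a r)"
    "\<forall>x\<in>ball a r. poly p x - poly p a = \<psi> x"
    using local_chart[of a] by auto
  define U where "U = ball a r"
  have inj: "x = y" if "x \<in> U" "y \<in> U" "poly p x = poly p y" for x y
    using that bspec[OF r(3), of x] bspec[OF r(3), of y] inj_onD[OF r(2), of x y] by (simp add: U_def)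
  have "card {y \<in> K \<inter> tube U. snd y = b} \<le> 1" for b
  proof (rule card_le_1I)
    fix x y assume "x \<in> {y \<in> K \<inter> tube U. snd y = b}" "y \<in> {y \<in> K \<inter> tube U. snd y = b}"
    then have xy: "x \<in> K" "x \<in> tube U" "y \<in> K" "y \<in> tube U" "snd x = snd y"
      by auto
    from xy(1,2) show "x = y"
    proof (cases rule: tube_cases)
      case 1: (interior z)
      from xy(3,4) show ?thesis
      proof (cases rule: tube_cases)
        case 2: (interior w)
        have "iA (poly p z) = iA (poly p w)"
          using xy(5) 1 2 by (simp add: J_def)
        then have "poly p z = poly p w"
          using 1 2 by (intro inj_iA) (auto simp: rts_def)
        then show ?thesis
          using inj 1 2 by auto
      next
        case 2: (root b u)
        then show ?thesis
          using xy(5) 1 height_J[of z] by simp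
      qed
    next
      case 1: (root b u)
      from xy(3,4) show ?thesis
      proof (cases rule: tube_cases)
        case 2: (interior w)
        then show ?thesis
          using xy(5) 1 height_J[of w] by (metis abs_minus_cancel abs_one less_irrefl snd_conv)
      next
        case 2: (root c v)
        then have "b = c"
          using inj 1 by (simp add: rts_def)
        then show ?thesis
          using xy(5) 1 2 by simp
      qed
    qed
  qed
  then show ?thesis
    using r(1) squash_in_tube by (intro exI[of _ "tube U"]) (simp add: U_def open_tube)
qed

text \<open>In the coordinate \<open>s = inverse z\<close>, the inverse of \<open>p z\<close> is the
  \<open>d\<close>-th power of the injective chart \<open>s * k s\<close>. Equal values of
  \<open>p\<close> therefore determine the chart up to a \<open>d\<close>-th root of unity. That
  ambiguity disappears for directions near \<open>e\<close>, where the \<open>d\<close>-th power is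
  injective; equality of moduli then gives equality of points.\<close>

lemma local_mult_infinity:
  assumes e: "cmod e = 1"
  shows "\<exists>N. open N \<and> (e, b) \<in> N \<and> (\<forall>a. card {y \<in> K \<inter> N. snd y = a} \<le> 1)"
proof -
  have "d > 0"
    using d_ge_2 by simp
  let ?q = "\<lambda>s. 1 / poly (reflect_poly p) s"
  let ?S = "{s. poly (reflect_poly p) s \<noteq> 0}"
  have q0: "poly (reflect_poly p) 0 = lead_coeff p"
    by (simp add: poly_0_coeff_0)
  have "?q holomorphic_on ?S"
    by (intro holomorphic_intros) auto
  moreover have "open ?S"
  proof -
    have "?S = - {s. poly (reflect_poly p) s = 0}"
      by auto
    moreover have "finite {s. poly (reflect_poly p) s = 0}"
      using p_nonzero by (intro poly_roots_finite) simp
    ultimately show ?thesis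
      by (simp add: finite_imp_closed open_Compl)
  qed
  moreover have "0 \<in> ?S" "?q 0 \<noteq> 0"
    using q0 lead_coeff_ne by auto
  ultimately have "\<exists>r k. r > 0 \<and> k holomorphic_on ball 0 r \<and>
    (\<forall>s\<in>ball 0 r. ?q s = k s ^ d \<and> k s \<noteq> 0) \<and> inj_on (\<lambda>s. (s - 0) * k s) (ball 0 r)"
    using \<open>d > 0\<close> by (intro local_root_chart)
  then obtain r k where r: "r > 0" "k holomorphic_on ball 0 r"
    "\<forall>s\<in>ball 0 r. ?q s = k s ^ d \<and> k s \<noteq> 0" "inj_on (\<lambda>s. (s - 0) * k s) (ball 0 r)"
    by blast
  have inj_k: "s = t" if "s \<in> ball 0 r" "t \<in> ball 0 r" "s * k s = t * k t" for s t
    by (rule inj_onD[OF r(4) _ that(1,2)]) (simp only: that(3) diff_zero)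
  have k0: "k 0 \<noteq> 0"
    using r(1,3) by simp
  have p_eq: "poly p z * (inverse z * k (inverse z)) ^ d = 1" if "z \<noteq> 0" "inverse z \<in> ball 0 r" for z
  proof -
    let ?R = "poly (reflect_poly p) (inverse z)" and ?k = "k (inverse z)"
    have R: "?R = inverse z ^ d * poly p z"
      using poly_reflect_poly_nz[of "inverse z" p] that(1) degree_p by simp
    have k: "1 / ?R = ?k ^ d" "?k \<noteq> 0"
      using bspec[OF r(3) that(2)] by blast+
    have "?k ^ d \<noteq> 0"
      using k(2) by simp
    then have "?R \<noteq> 0"
      unfolding k(1)[symmetric] by auto
    have "poly p z * (inverse z * ?k) ^ d = (inverse z ^ d * poly p z) * ?k ^ d"
      by (simp only: power_mult_distrib mult_ac)
    also have "\<dots> = ?R * (1 / ?R)"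
      by (simp only: R[symmetric] k(1))
    finally show ?thesis
      using \<open>?R \<noteq> 0\<close> by simp
  qed
  have "(\<lambda>x. x ^ d) holomorphic_on UNIV"
    by (intro holomorphic_intros)
  moreover have "deriv (\<lambda>x. x ^ d) e \<noteq> 0"
  proof -
    have "e \<noteq> 0"
      using e by auto
    moreover have "deriv (\<lambda>x. x ^ d) e = of_nat d * e ^ (d - 1)"
      by (rule DERIV_imp_deriv) (auto intro!: derivative_eq_intros)
    ultimately show ?thesis
      using \<open>d > 0\<close> by simp
  qed
  \<comment> \<open>The number \<open>e\<close> is nonzero, so the \<open>d\<close>-th power has
    nonzero derivative there.\<close>
  ultimately obtain \<rho> where \<rho>: "\<rho> > 0" "inj_on (\<lambda>x. x ^ d) (ball e \<rho>)"
    using has_complex_derivative_locally_injective[of "\<lambda>x. x ^ d" UNIV e] by auto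
  have "isCont (\<lambda>s. sgn (k 0) / sgn (k s)) 0"
  proof -
    have "isCont k 0"
      using r(1,2) by (meson centre_in_ball continuous_on_eq_continuous_at holomorphic_on_imp_continuous_on open_ball)
    then show ?thesis
      using k0 by (intro continuous_intros) (auto simp: sgn_zero_iff)
  qed
  moreover have "0 < \<rho> / 2"
    using \<rho> by simp
  ultimately obtain \<delta> where \<delta>: "\<delta> > 0"
    "\<And>s. dist s 0 < \<delta> \<Longrightarrow> dist (sgn (k 0) / sgn (k s)) (sgn (k 0) / sgn (k 0)) < \<rho> / 2"
    unfolding continuous_at_eps_delta by blast
  \<comment> \<open>By the bound 1/2, closeness of \<open>squash z\<close> to \<open>e\<close>
    forces \<open>z\<close> to be nonzero with inverse of modulus below 2 * \<epsilon>. The other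
    entries make 2 * \<epsilon> at most \<rho> / 2, \<delta> and \<open>r\<close>.\<close>
  define \<epsilon> where "\<epsilon> = Min {1/2, \<rho> / 4, \<delta> / 2, r / 2}"
  have \<epsilon>: "\<epsilon> > 0" "\<epsilon> \<le> 1/2" "\<epsilon> \<le> \<rho> / 4" "\<epsilon> \<le> \<delta> / 2" "\<epsilon> \<le> r / 2"
    using \<rho>(1) \<delta>(1) r(1) by (auto simp: \<epsilon>_def)
  have far: "z \<noteq> 0 \<and> cmod (inverse z) < 2 * \<epsilon> \<and> dist (sgn z) e < 2 * \<epsilon>" if "dist (squash z) e < \<epsilon>" for z
  proof -
    have "1 - cmod (squash z) \<le> dist (squash z) e"
      using norm_triangle_ineq2[of e "squash z"] e by (simp add: dist_norm norm_minus_commute)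
    then have less: "1 / (1 + cmod z) < \<epsilon>"
      using that one_minus_cmod_squash[of z] by simp
    have pos: "0 < 1 + cmod z"
      using norm_ge_zero[of z] by linarith
    have 1: "1 < \<epsilon> * (1 + cmod z)"
      using less pos by (simp add: pos_divide_less_eq)
    have "z \<noteq> 0"
      using 1 \<epsilon>(2) by auto
    have "\<epsilon> * (1 + cmod z) \<le> 1/2 + \<epsilon> * cmod z"
      using \<epsilon>(2) by (simp add: distrib_left)
    then have "1 < 2 * \<epsilon> * cmod z"
      using 1 by linarith
    then have "cmod (inverse z) < 2 * \<epsilon>"
    proof -
      have "0 < cmod z"
        using \<open>z \<noteq> 0\<close> by simp
      then have "1 / cmod z < 2 * \<epsilon>"
        using \<open>1 < 2 * \<epsilon> * cmod z\<close> by (simp add: pos_divide_less_eq)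
      then show ?thesis
        by (simp add: norm_inverse inverse_eq_divide norm_divide)
    qed
    moreover have "dist (sgn z) e < 2 * \<epsilon>"
    proof -
      have "sgn z - squash z = of_real (1 - cmod (squash z)) * sgn z"
        by (subst squash_sgn) (simp add: algebra_simps)
      then have "cmod (sgn z - squash z) = \<bar>1 - cmod (squash z)\<bar> * cmod (sgn z)"
        by (simp only: norm_mult norm_of_real)
      also have "\<dots> < \<epsilon>"
        using \<open>z \<noteq> 0\<close> less pos unfolding one_minus_cmod_squash by (simp add: norm_sgn)
      finally have "dist (sgn z) (squash z) < \<epsilon>"
        by (simp add: dist_norm)
      then show ?thesis
        using that dist_triangle[of "sgn z" e "squash z"] by linarith
    qed
    ultimately show ?thesis
      using \<open>z \<noteq> 0\<close> by blast
  qed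
  \<comment> \<open>Up to the constant \<open>sgn (k 0)\<close>, this is the reciprocal of the
    direction of the chart. The constant makes the correction factor tend to 1 at infinity, so
    \<open>D z\<close> stays near \<open>e\<close>.\<close>
  define D where "D z = sgn z * (sgn (k 0) / sgn (k (inverse z)))" for z
  have nearD: "D z \<in> ball e \<rho>" if "dist (squash z) e < \<epsilon>" for z
  proof -
    have z: "z \<noteq> 0" "cmod (inverse z) < 2 * \<epsilon>" "dist (sgn z) e < 2 * \<epsilon>"
      using far[OF that] by auto
    have "dist (inverse z) 0 < \<delta>"
      using z(2) \<epsilon>(4) by simp
    then have "cmod (sgn (k 0) / sgn (k (inverse z)) - 1) < \<rho> / 2"
      using \<delta>(2) k0 by (simp add: dist_norm sgn_zero_iff)
    moreover have "D z - sgn z = sgn z * (sgn (k 0) / sgn (k (inverse z)) - 1)"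
      by (simp add: D_def algebra_simps)
    then have "cmod (D z - sgn z) = cmod (sgn (k 0) / sgn (k (inverse z)) - 1)"
      using z(1) by (simp only: norm_mult norm_sgn if_False mult_1)
    ultimately have "dist (D z) (sgn z) < \<rho> / 2"
      by (simp add: dist_norm)
    then show ?thesis
      using z(3) \<epsilon>(3) dist_triangle[of "D z" e "sgn z"] by (simp add: dist_commute)
  qed
  let ?N = "ball e \<epsilon> \<times> UNIV :: (complex \<times> (complex \<times> real)) set"
  have "card {y \<in> K \<inter> ?N. snd y = a} \<le> 1" for a
  proof (rule card_le_1I)
    fix x y assume "x \<in> {y \<in> K \<inter> ?N. snd y = a}" "y \<in> {y \<in> K \<inter> ?N. snd y = a}"
    then have xy: "x \<in> K" "dist (fst x) e < \<epsilon>" "y \<in> K" "dist (fst y) e < \<epsilon>" "snd x = snd y"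
      by (auto simp: mem_Times_iff dist_commute)
    have not_root: "a \<notin> rts p" if "dist (squash a) e < \<epsilon>" for a
    proof
      assume "a \<in> rts p"
      have "a \<noteq> 0" "inverse a \<in> ball 0 r"
        using far[OF that] \<epsilon>(5) by auto
      from p_eq[OF this] show False
        using \<open>a \<in> rts p\<close> by (simp add: rts_def)
    qed
    have cases: "(\<exists>z. z \<notin> rts p \<and> w = J z) \<or> (\<exists>c. w = (c, sgn (lead_coeff p) * c ^ d, 1))"
      if "w \<in> K" "dist (fst w) e < \<epsilon>" for w
      using that(1)
    proof (cases rule: K_cases)
      case (root b u)
      then show ?thesis
        using not_root that(2) by auto
    qed blast+
    have height: "snd (snd w) = 1" if "w = (c, sgn (lead_coeff p) * c ^ d, 1)" for w c
      using that by simp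
    consider z w where "z \<notin> rts p" "x = J z" "w \<notin> rts p" "y = J w"
      | c c' where "x = (c, sgn (lead_coeff p) * c ^ d, 1)" "y = (c', sgn (lead_coeff p) * c' ^ d, 1)"
      using cases[OF xy(1,2)] cases[OF xy(3,4)] height_J height xy(5)
      by (metis abs_one less_irrefl)
    then show "x = y"
    proof cases
      case 1
      have "iA (poly p z) = iA (poly p w)"
        using xy(5) 1 by (simp add: J_def)
      then have pzw: "poly p z = poly p w"
        using 1 by (intro inj_iA) (auto simp: rts_def)
      have dz: "dist (squash z) e < \<epsilon>" "dist (squash w) e < \<epsilon>"
        using xy(2,4) 1 by (auto simp: J_def)
      have z: "z \<noteq> 0" "inverse z \<in> ball 0 r" "w \<noteq> 0" "inverse w \<in> ball 0 r"
        using far[OF dz(1)] far[OF dz(2)] \<epsilon>(5) by auto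
      let ?f = "\<lambda>z. inverse z * k (inverse z)"
      have fne: "?f z \<noteq> 0" "?f w \<noteq> 0"
        using z r(3) by auto
      have pow: "?f z ^ d = ?f w ^ d"
      proof -
        have "poly p z * ?f z ^ d = poly p z * ?f w ^ d"
          using p_eq[OF z(1,2)] p_eq[OF z(3,4)] pzw by simp
        then show ?thesis
          using 1(1) by (simp add: rts_def)
      qed
      have Df: "D v = sgn (k 0) / sgn (?f v)" if "v \<noteq> 0" for v
        by (simp add: D_def sgn_mult sgn_inverse field_simps)
      have sgn_pow: "sgn x ^ d = sgn (x ^ d)" for x :: complex
        by (induction d) (simp_all add: sgn_mult)
      have "D v ^ d = sgn (k 0 ^ d) / sgn (?f v ^ d)" if "v \<noteq> 0" for v
        by (simp only: Df[OF that] power_divide sgn_pow)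
      then have "D z ^ d = D w ^ d"
        using z pow by metis
      then have "D z = D w"
        using inj_onD[OF \<rho>(2)] nearD[OF dz(1)] nearD[OF dz(2)] by blast
      then have sg: "sgn (?f z) = sgn (?f w)"
      proof -
        have "sgn (k 0) / sgn (?f z) = sgn (k 0) / sgn (?f w)"
          using \<open>D z = D w\<close> by (simp only: Df[OF z(1)] Df[OF z(3)])
        moreover have "sgn (k 0) \<noteq> 0"
          using k0 by (simp add: sgn_zero_iff)
        ultimately show ?thesis
          by (metis divide_divide_eq_right nonzero_mult_div_cancel_left divide_eq_0_iff fne sgn_zero_iff nonzero_divide_eq_eq mult.commute)
      qed
      have "cmod (?f z) ^ d = cmod (?f w) ^ d"
        using pow by (metis norm_power)
      then have "cmod (?f z) = cmod (?f w)"
        using \<open>d > 0\<close> by (meson norm_ge_zero power_eq_imp_eq_base)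
      moreover have "x = of_real (cmod x) * sgn x" for x :: complex
        by (cases "x = 0") (simp_all add: sgn_div_norm scaleR_conv_of_real)
      ultimately have "?f z = ?f w"
        using sg by metis
      then have "inverse z = inverse w"
        using inj_k z by blast
      then show ?thesis
        using 1 by simp
    next
      case 2
      have "sgn (lead_coeff p) * c ^ d = sgn (lead_coeff p) * c' ^ d"
        using xy(5) 2 by simp
      then have "c ^ d = c' ^ d"
        using lead_coeff_ne by (simp add: sgn_zero_iff)
      moreover have "c \<in> ball e \<rho>" "c' \<in> ball e \<rho>"
        using xy(2,4) 2 \<epsilon>(1,3) by (auto simp: dist_commute)
      ultimately have "c = c'"
        using inj_onD[OF \<rho>(2)] by blast
      then show ?thesis
        using 2 by simp
    qed
  qed
  moreover have "open ?N"
    by (intro open_Times) auto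
  moreover have "(e, b) \<in> ?N"
    using \<epsilon>(1) by simp
  ultimately show ?thesis
    by blast
qed

sublocale branched_cover K snd annulus_set mult d
proof
  show "continuous_on K snd"
    by (intro continuous_intros)
  show "\<exists>N. open N \<and> x \<in> N \<and> (\<forall>a. card {y \<in> K \<inter> N. snd y = a} \<le> mult x)" if "x \<in> K" for x
    using that
  proof (cases rule: K_cases)
    case (interior z)
    then show ?thesis
      using local_mult_interior by blast
  next
    case (root a u)
    then have "mult x = 1"
      by (simp add: mult_def)
    then show ?thesis
      using local_mult_root[OF root(1), of u] root(3) by simp
  next
    case (infinity e)
    then have "mult x = 1"
      by (simp add: mult_def)
    then show ?thesis
      using local_mult_infinity[OF infinity(1)] infinity(2) by simp
  qed
qed (use compact_K snd_K fibre_degree in auto)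

end

subsection \<open>The path metric\<close>

lemma norm_sgn_diff_le:
  fixes x y :: complex
  assumes "c > 0" "c \<le> cmod x" "c \<le> cmod y"
  shows "cmod (sgn x - sgn y) \<le> 2 / c * cmod (x - y)"
proof -
  have ne: "x \<noteq> 0" "y \<noteq> 0"
    using assms by auto
  \<comment> \<open>Splits the change of direction into the displacement and a correction for the
    change of length.\<close>
  have "of_real (cmod x) * (sgn x - sgn y) = (x - y) + of_real (cmod y - cmod x) * sgn y"
    using ne by (simp add: sgn_div_norm scaleR_conv_of_real field_simps)
  then have "cmod x * cmod (sgn x - sgn y) = cmod ((x - y) + of_real (cmod y - cmod x) * sgn y)"
    by (metis norm_mult norm_of_real abs_norm_cancel)
  also have "\<dots> \<le> cmod (x - y) + \<bar>cmod y - cmod x\<bar> * cmod (sgn y)"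
    by (metis norm_mult norm_of_real norm_triangle_ineq)
  also have "\<dots> \<le> cmod (x - y) + cmod (x - y) * 1"
    using norm_triangle_ineq3[of x y] ne by (intro add_mono mult_mono) (auto simp: norm_sgn)
  finally have "c * cmod (sgn x - sgn y) \<le> 2 * cmod (x - y)"
    using assms mult_right_mono[of c "cmod x" "cmod (sgn x - sgn y)"] by simp
  then show ?thesis
    using assms(1) by (simp add: field_simps)
qed

text \<open>With \<open>a\<close> and \<open>b\<close> the squared moduli plus 1, the difference is
  \<open>2 * (a - b) / (a * b)\<close>, so it remains to bound the sum of the moduli by
  \<open>a * b\<close>.\<close>

lemma height_Lipschitz: "\<bar>snd (iA x) - snd (iA y)\<bar> \<le> 2 * cmod (x - y)"
proof -
  define a where "a = (cmod x)\<^sup>2 + 1"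
  define b where "b = (cmod y)\<^sup>2 + 1"
  have ab: "a \<ge> 1" "b \<ge> 1"
    by (auto simp: a_def b_def)
  have "snd (iA x) - snd (iA y) = 2 * (a - b) / (a * b)"
    using ab unfolding height_iA_eq a_def[symmetric] b_def[symmetric] by (simp add: field_simps)
  also have "a - b = (cmod x - cmod y) * (cmod x + cmod y)"
    by (simp add: a_def b_def algebra_simps power2_eq_square)
  finally have eq: "\<bar>snd (iA x) - snd (iA y)\<bar> = 2 * \<bar>cmod x - cmod y\<bar> * ((cmod x + cmod y) / (a * b))"
    using ab by (simp add: abs_mult abs_divide)
  \<comment> \<open>The squares of \<open>cmod x - 1\<close> and \<open>cmod y - 1\<close> are
    nonnegative.\<close>
  have "2 * cmod x \<le> a" "2 * cmod y \<le> b"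
    using zero_le_power2[of "cmod x - 1"] zero_le_power2[of "cmod y - 1"]
    by (auto simp: a_def b_def power2_diff)
  moreover have "a \<le> a * b" "b \<le> a * b"
    using ab by auto
  ultimately have "cmod x + cmod y \<le> a * b"
    by linarith
  then have "(cmod x + cmod y) / (a * b) \<le> 1"
    using ab by (simp add: divide_le_eq)
  then have "\<bar>snd (iA x) - snd (iA y)\<bar> \<le> 2 * \<bar>cmod x - cmod y\<bar> * 1"
    unfolding eq by (intro mult_left_mono) auto
  also have "\<dots> \<le> 2 * cmod (x - y)"
    using norm_triangle_ineq3[of x y] by simp
  finally show ?thesis .
qed

lemma dist_iA_le:
  assumes "c > 0" "c \<le> cmod x" "c \<le> cmod y"
  shows "dist (iA x) (iA y) \<le> (2 / c + 2) * cmod (x - y)"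
proof -
  have "dist (iA x) (iA y) \<le> dist (fst (iA x)) (fst (iA y)) + dist (snd (iA x)) (snd (iA y))"
    unfolding dist_prod_def by (rule sqrt_sum_squares_le_sum) auto
  also have "\<dots> \<le> 2 / c * cmod (x - y) + 2 * cmod (x - y)"
    using norm_sgn_diff_le[OF assms] height_Lipschitz[of x y]
    by (intro add_mono) (simp_all add: dist_norm direction_iA)
  finally show ?thesis
    by (simp add: algebra_simps)
qed

lemma annulus_dist_le_sum:
  "annulus_dist x y \<le> circle_dist (fst x) (fst y) + \<bar>snd x - snd y\<bar>"
proof -
  have "annulus_dist x y = sqrt ((circle_dist (fst x) (fst y))\<^sup>2 + \<bar>snd x - snd y\<bar>\<^sup>2)"
    by (simp add: annulus_dist_def)
  also have "\<dots> \<le> circle_dist (fst x) (fst y) + \<bar>snd x - snd y\<bar>"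
    by (rule sqrt_sum_squares_le_sum) (auto simp: circle_dist_def)
  finally show ?thesis .
qed

context separable_poly
begin

lemma poly_Lipschitz: "\<exists>C\<ge>0. \<forall>z\<in>cball 0 R. \<forall>w\<in>cball 0 R. cmod (poly p z - poly p w) \<le> C * cmod (z - w)"
proof -
  have "bounded (poly (pderiv p) ` cball 0 R)"
    by (intro compact_imp_bounded compact_continuous_image continuous_intros) auto
  then obtain C where C: "\<forall>z\<in>cball 0 R. cmod (poly (pderiv p) z) \<le> C"
    unfolding bounded_iff by blast
  have "cmod (poly p z - poly p w) \<le> max 0 C * cmod (z - w)" if "z \<in> cball 0 R" "w \<in> cball 0 R" for z w
  proof (rule field_differentiable_bound[OF convex_cball _ _ that])
    show "(poly p has_field_derivative poly (pderiv p) z) (at z within cball 0 R)" for z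
      by (rule DERIV_subset[OF poly_DERIV]) simp
    show "cmod (poly (pderiv p) z) \<le> max 0 C" if "z \<in> cball 0 R" for z
      using C that by (simp add: le_max_iff_disj)
  qed
  then show ?thesis
    by (intro exI[of _ "max 0 C"]) auto
qed

lemma poly_ne_0: "z \<notin> rts p \<longleftrightarrow> poly p z \<noteq> 0"
  by (simp add: rts_def)

lemma iA_poly_in_annulus: "z \<notin> rts p \<Longrightarrow> iA (poly p z) \<in> annulus_set"
  by (simp add: iA_in_annulus poly_ne_0)

text \<open>The direction part of \<open>iA\<close> is Lipschitz only away from 0, hence the lower
  bound \<open>c\<close> on \<open>p\<close>. One constant serves all curves in \<open>S\<close>, so
  that short curves are seen to have small length.\<close>

lemma Lipschitz_curve_length:
  assumes "S \<subseteq> cball 0 R" "c > 0" "\<And>z. z \<in> S \<Longrightarrow> c \<le> cmod (poly p z)"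
  shows "\<exists>L\<ge>0. \<forall>\<gamma> C. C \<ge> 0 \<longrightarrow> \<gamma> ` {0..1} \<subseteq> S \<longrightarrow>
    (\<forall>s\<in>{0..1}. \<forall>t\<in>{0..1}. cmod (\<gamma> s - \<gamma> t) \<le> C * \<bar>s - t\<bar>) \<longrightarrow> pullback_length p \<gamma> \<le> ennreal (L * C)"
proof -
  obtain B where B: "B \<ge> 0" "\<forall>z\<in>cball 0 R. \<forall>w\<in>cball 0 R. cmod (poly p z - poly p w) \<le> B * cmod (z - w)"
    using poly_Lipschitz by blast
  \<comment> \<open>The factors come from \<open>annulus_dist_le_dist\<close>, from
    \<open>dist_iA_le\<close> and from the Lipschitz constant of \<open>p\<close>.\<close>
  define L where "L = 2 * ((2 / c + 2) * B)"
  have "L \<ge> 0"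
    using B(1) assms(2) by (simp add: L_def)
  moreover have "pullback_length p \<gamma> \<le> ennreal (L * C)"
    if C: "C \<ge> 0" and im: "\<gamma> ` {0..1} \<subseteq> S" and lip: "\<forall>s\<in>{0..1}. \<forall>t\<in>{0..1}. cmod (\<gamma> s - \<gamma> t) \<le> C * \<bar>s - t\<bar>" for \<gamma> C
    unfolding pullback_length_def
  proof (rule curve_length_Lipschitz)
    show "0 \<le> L * C"
      using \<open>L \<ge> 0\<close> C by simp
    fix s t :: real assume st: "0 \<le> s" "s \<le> t" "t \<le> 1"
    then have S: "\<gamma> s \<in> S" "\<gamma> t \<in> S"
      using im by auto
    then have nz: "poly p (\<gamma> s) \<noteq> 0" "poly p (\<gamma> t) \<noteq> 0"
      using assms(2,3) by fastforce+
    have "annulus_dist (iA (poly p (\<gamma> s))) (iA (poly p (\<gamma> t))) \<le> 2 * dist (iA (poly p (\<gamma> s))) (iA (poly p (\<gamma> t)))"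
      using nz by (intro annulus_dist_le_dist iA_in_annulus)
    also have "\<dots> \<le> 2 * ((2 / c + 2) * cmod (poly p (\<gamma> s) - poly p (\<gamma> t)))"
      using dist_iA_le[OF assms(2)] assms(3) S by (intro mult_left_mono) auto
    also have "\<dots> \<le> 2 * ((2 / c + 2) * (B * cmod (\<gamma> s - \<gamma> t)))"
      using B(2) S assms(1,2) by (intro mult_left_mono) auto
    also have "\<dots> \<le> 2 * ((2 / c + 2) * (B * (C * \<bar>s - t\<bar>)))"
      using bspec[OF bspec[OF lip, of s], of t] st B(1) assms(2) by (intro mult_left_mono) auto
    also have "\<dots> = L * C * (t - s)"
      using st by (simp add: L_def)
    finally show "mdist annulus ((iA \<circ> poly p \<circ> \<gamma>) s) ((iA \<circ> poly p \<circ> \<gamma>) t) \<le> L * C * (t - s)"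
      by simp
  qed
  ultimately show ?thesis
    by blast
qed

text \<open>Gives the infimum in the metric its meaning: the plane without the roots is connected by
  polynomial curves, which are Lipschitz and stay away from the roots.\<close>

lemma rectifiable_curve_exists:
  assumes "z \<notin> rts p" "w \<notin> rts p"
  shows "rectifiable_curves p z w \<noteq> {}"
proof -
  have "path_connected (- rts p)"
    by (intro path_connected_complement_countable uncountable_infinite countable_finite finite_rts) simp
  then have "connected (- rts p)"
    by (rule path_connected_imp_connected)
  then obtain g where g: "polynomial_function g" "path_image g \<subseteq> - rts p" "pathstart g = z" "pathfinish g = w"
    using connected_open_polynomial_connected[OF open_complement_rts, of z w] assms by auto
  have "path g"
    using g(1) by (simp add: path_def continuous_on_polymonial_function)
  then have comp: "compact (path_image g)"
    by (rule compact_path_image)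
  obtain g' where g': "polynomial_function g'" "\<And>x. (g has_vector_derivative g' x) (at x)"
    using has_vector_derivative_polynomial_function[OF g(1)] by blast
  have "bounded (g' ` {0..1})"
    using g'(1) by (intro compact_imp_bounded compact_continuous_image continuous_on_polymonial_function) auto
  then obtain C0 where C0: "\<forall>x\<in>{0..1}. cmod (g' x) \<le> C0"
    unfolding bounded_iff by blast
  define C where "C = max 0 C0"
  have lip: "cmod (g s - g t) \<le> C * \<bar>s - t\<bar>" if "s \<in> {0..1}" "t \<in> {0..1}" for s t
  proof -
    have "cmod (g s - g t) \<le> C * norm (s - t)"
    proof (rule differentiable_bound[where f' = "\<lambda>x h. h *\<^sub>R g' x"])
      show "(g has_derivative (\<lambda>h. h *\<^sub>R g' x)) (at x within {0..1})" for x
        using g'(2)[of x] unfolding has_vector_derivative_def by (rule has_derivative_at_withinI)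
      show "onorm (\<lambda>h. h *\<^sub>R g' x) \<le> C" if "x \<in> {0..1}" for x
        using C0 that by (intro onorm_bound) (auto simp: C_def mult.commute intro!: mult_left_mono le_max_iff_disj[THEN iffD2])
    qed (use that in auto)
    then show ?thesis by simp
  qed
  have "compact (poly p ` path_image g)"
    by (intro compact_continuous_image comp continuous_intros)
  moreover have "0 \<notin> poly p ` path_image g"
    using g(2) by (auto simp: rts_def)
  ultimately obtain c where c: "c > 0" "\<forall>y\<in>poly p ` path_image g. c \<le> dist 0 y"
    using separate_point_closed[of "poly p ` path_image g" 0] compact_imp_closed by blast
  obtain R where "\<forall>x\<in>path_image g. cmod x \<le> R"
    using compact_imp_bounded[OF comp] unfolding bounded_iff by blast
  then have "path_image g \<subseteq> cball 0 R"
    by auto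
  then obtain L where "L \<ge> 0" "\<forall>\<gamma> C. C \<ge> 0 \<longrightarrow> \<gamma> ` {0..1} \<subseteq> path_image g \<longrightarrow>
    (\<forall>s\<in>{0..1}. \<forall>t\<in>{0..1}. cmod (\<gamma> s - \<gamma> t) \<le> C * \<bar>s - t\<bar>) \<longrightarrow> pullback_length p \<gamma> \<le> ennreal (L * C)"
    using Lipschitz_curve_length[of "path_image g" R c] c by auto
  then have "pullback_length p g \<le> ennreal (L * C)"
    using lip by (auto simp: path_image_def C_def)
  then have "pullback_length p g < \<infinity>"
    using order_le_less_trans[OF _ ennreal_less_top] by simp
  then show ?thesis
    using g \<open>path g\<close> by (auto simp: rectifiable_curves_def)
qed

definition bdist :: "complex \<Rightarrow> complex \<Rightarrow> real" where
  "bdist z w = (if z \<in> - rts p \<and> w \<in> - rts p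
     then (INF \<gamma>\<in>rectifiable_curves p z w. enn2real (pullback_length p \<gamma>)) else 0)"

lemma bdist_le:
  assumes "z \<notin> rts p" "w \<notin> rts p" "\<gamma> \<in> rectifiable_curves p z w"
  shows "bdist z w \<le> enn2real (pullback_length p \<gamma>)"
proof -
  have "(INF \<gamma>\<in>rectifiable_curves p z w. enn2real (pullback_length p \<gamma>)) \<le> enn2real (pullback_length p \<gamma>)"
    by (rule cINF_lower[OF bdd_belowI[of _ 0] assms(3)]) auto
  then show ?thesis
    using assms by (simp add: bdist_def)
qed

lemma bdist_less:
  assumes "z \<notin> rts p" "w \<notin> rts p" "bdist z w < r"
  obtains \<gamma> where "\<gamma> \<in> rectifiable_curves p z w" "enn2real (pullback_length p \<gamma>) < r"
proof -
  have "(INF \<gamma>\<in>rectifiable_curves p z w. enn2real (pullback_length p \<gamma>)) < r"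
    using assms by (simp add: bdist_def)
  then show thesis
    using that rectifiable_curve_exists[OF assms(1,2)]
    by (subst (asm) cINF_less_iff) (auto intro: bdd_belowI[of _ 0])
qed

lemma bdist_nonneg: "0 \<le> bdist z w"
proof (cases "z \<in> - rts p \<and> w \<in> - rts p")
  case True
  then have "rectifiable_curves p z w \<noteq> {}"
    using rectifiable_curve_exists by simp
  then show ?thesis
    using True unfolding bdist_def by (auto intro!: cINF_greatest)
qed (simp only: bdist_def if_False)

lemma bdist_le_length:
  assumes "path \<gamma>" "path_image \<gamma> \<subseteq> - rts p" "pathstart \<gamma> = z" "pathfinish \<gamma> = w"
    and "pullback_length p \<gamma> \<le> ennreal L" "L \<ge> 0"
  shows "bdist z w \<le> L"
proof -
  have "pullback_length p \<gamma> < \<infinity>"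
    using order_le_less_trans[OF assms(5) ennreal_less_top] by simp
  then have "\<gamma> \<in> rectifiable_curves p z w"
    using assms by (simp add: rectifiable_curves_def)
  moreover have "z \<notin> rts p" "w \<notin> rts p"
    using assms(2,3,4) pathstart_in_path_image[of \<gamma>] pathfinish_in_path_image[of \<gamma>] by auto
  ultimately have "bdist z w \<le> enn2real (pullback_length p \<gamma>)"
    by (intro bdist_le)
  also have "\<dots> \<le> L"
    using assms(5,6) by (rule enn2real_leI[rotated])
  finally show ?thesis .
qed

lemma curve_avoids_rts:
  assumes "path_image \<gamma> \<subseteq> - rts p" "t \<in> {0..1}"
  shows "\<gamma> t \<notin> rts p"
  using assms unfolding path_image_def by blast

text \<open>The two-point partition already bounds the length from below. Intermediate parameters
  are allowed, so a short curve is confined as a whole and not only at its ends.\<close>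

lemma dist_le_length:
  assumes \<gamma>: "\<gamma> \<in> rectifiable_curves p z w" and st: "s \<in> {0..1}" "t \<in> {0..1}"
  shows "dist (iA (poly p (\<gamma> s))) (iA (poly p (\<gamma> t))) \<le> enn2real (pullback_length p \<gamma>)"
proof -
  have "\<gamma> s \<notin> rts p" "\<gamma> t \<notin> rts p"
    using \<gamma> st curve_avoids_rts by (auto simp: rectifiable_curves_def)
  then have "dist (iA (poly p (\<gamma> s))) (iA (poly p (\<gamma> t))) \<le> annulus_dist (iA (poly p (\<gamma> s))) (iA (poly p (\<gamma> t)))"
    by (intro dist_le_annulus_dist iA_poly_in_annulus)
  also have "ennreal \<dots> \<le> pullback_length p \<gamma>"
    unfolding pullback_length_def using mdist_le_curve_length[OF st, of annulus "iA \<circ> poly p \<circ> \<gamma>"] by simp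
  then have "annulus_dist (iA (poly p (\<gamma> s))) (iA (poly p (\<gamma> t))) \<le> enn2real (pullback_length p \<gamma>)"
  proof -
    have "pullback_length p \<gamma> = ennreal (enn2real (pullback_length p \<gamma>))"
      using \<gamma> by (simp add: rectifiable_curves_def)
    with \<open>ennreal (annulus_dist (iA (poly p (\<gamma> s))) (iA (poly p (\<gamma> t)))) \<le> pullback_length p \<gamma>\<close>
    show ?thesis
      by (metis enn2real_nonneg ennreal_le_iff)
  qed
  finally show ?thesis .
qed

text \<open>A short curve cannot cross a small sphere that avoids the fibre through its centre.\<close>

lemma bdist_controls_J_local:
  assumes \<kappa>: "\<kappa> \<in> K" and "\<epsilon> > 0"
  shows "\<exists>\<delta>>0. \<forall>z w. z \<notin> rts p \<longrightarrow> w \<notin> rts p \<longrightarrow> dist (J z) \<kappa> < \<delta> \<longrightarrow> bdist z w < \<delta> \<longrightarrow> dist (J w) \<kappa> < \<epsilon>"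
proof -
  define a where "a = snd \<kappa>"
  have "a \<in> annulus_set"
    using snd_K \<kappa> by (auto simp: a_def)
  then have "finite ((\<lambda>x. dist x \<kappa>) ` fibre a)"
    by (intro finite_imageI finite_fibre)
  moreover have "infinite {0<..<\<epsilon>}"
    using \<open>\<epsilon> > 0\<close> by simp
  \<comment> \<open>Finitely many distances to \<kappa> occur in the fibre, so some sphere of radius
    below \<epsilon> misses it.\<close>
  ultimately obtain \<eta> where \<eta>: "\<eta> \<in> {0<..<\<epsilon>}" "\<eta> \<notin> (\<lambda>x. dist x \<kappa>) ` fibre a"
    by (meson finite_subset subsetI)
  define N where "N = {y. dist y \<kappa> \<noteq> \<eta>}"
  have "open {y. dist y \<kappa> \<noteq> \<eta>}"
    by (intro open_Collect_neq continuous_intros)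
  then have "\<exists>\<delta>>0. \<forall>b. dist b a < \<delta> \<longrightarrow> fibre b \<subseteq> (\<Union>x\<in>fibre a. N)"
    using \<eta>(2) by (intro fibre_near) (auto simp: N_def)
  then obtain \<delta> where \<delta>: "\<delta> > 0" "\<forall>b. dist b a < \<delta> \<longrightarrow> fibre b \<subseteq> N"
    by (metis (no_types, lifting) UN_iff subset_eq)
  \<comment> \<open>Half of \<delta> is spent on the distance from the start of the curve to the
    centre, the other half on the curve itself.\<close>
  define \<delta>' where "\<delta>' = min \<eta> (\<delta> / 2)"
  have "\<delta>' > 0"
    using \<eta>(1) \<delta>(1) by (simp add: \<delta>'_def)
  moreover have "dist (J w) \<kappa> < \<epsilon>" if z: "z \<notin> rts p" and w: "w \<notin> rts p" and near: "dist (J z) \<kappa> < \<delta>'" "bdist z w < \<delta>'" for z w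
  proof (rule ccontr)
    assume "\<not> dist (J w) \<kappa> < \<epsilon>"
    then have far: "\<eta> < dist (J w) \<kappa>"
      using \<eta>(1) by simp
    obtain \<gamma> where \<gamma>: "\<gamma> \<in> rectifiable_curves p z w" "enn2real (pullback_length p \<gamma>) < \<delta>'"
      using bdist_less[OF z w near(2)] by blast
    then have p\<gamma>: "path \<gamma>" "path_image \<gamma> \<subseteq> - rts p" "\<gamma> 0 = z" "\<gamma> 1 = w"
      by (auto simp: rectifiable_curves_def pathstart_def pathfinish_def)
    have "continuous_on {0..1} (\<lambda>t. J (\<gamma> t))"
      using p\<gamma>(1,2) unfolding path_def path_image_def
      by (intro continuous_on_compose2[OF continuous_on_J])
    then have "continuous_on {0..1} (\<lambda>t. dist (J (\<gamma> t)) \<kappa>)"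
      by (intro continuous_intros)
    then obtain t where t: "0 \<le> t" "t \<le> 1" "dist (J (\<gamma> t)) \<kappa> = \<eta>"
      using IVT'[of "\<lambda>t. dist (J (\<gamma> t)) \<kappa>" 0 \<eta> 1] near(1) far p\<gamma>(3,4) by (auto simp: \<delta>'_def)
    have t_nr: "\<gamma> t \<notin> rts p"
      using curve_avoids_rts[OF p\<gamma>(2)] t by simp
    have "dist (snd (J (\<gamma> t))) (snd (J z)) < \<delta>'"
      using dist_le_length[OF \<gamma>(1), of t 0] \<gamma>(2) t p\<gamma>(3) by (simp add: J_def)
    moreover have "dist (snd (J z)) a < \<delta>'"
      using near(1) dist_snd_le[of "J z" \<kappa>] by (simp add: a_def)
    ultimately have "dist (snd (J (\<gamma> t))) a < \<delta>"
      using dist_triangle[of "snd (J (\<gamma> t))" a "snd (J z)"] by (simp add: \<delta>'_def)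
    moreover have "J (\<gamma> t) \<in> fibre (snd (J (\<gamma> t)))"
      using J_in_K[OF t_nr] by (simp add: in_fibre)
    ultimately have "J (\<gamma> t) \<in> N"
      using \<delta>(2) by blast
    then show False
      using t(3) by (simp add: N_def)
  qed
  ultimately show ?thesis
    by blast
qed

text \<open>Counterexamples with ever smaller path distance would have a subsequence whose images
  accumulate at a point of the compact \<open>K\<close>, against the local statement there.\<close>

lemma bdist_controls_J:
  assumes "\<epsilon> > 0"
  shows "\<exists>\<delta>>0. \<forall>z w. z \<notin> rts p \<longrightarrow> w \<notin> rts p \<longrightarrow> bdist z w < \<delta> \<longrightarrow> dist (J z) (J w) < \<epsilon>"
proof (rule ccontr)
  assume "\<not> ?thesis"
  then have "\<forall>n. \<exists>z w. z \<notin> rts p \<and> w \<notin> rts p \<and> bdist z w < inverse (real (Suc n)) \<and> \<epsilon> \<le> dist (J z) (J w)"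
    by (metis inverse_positive_iff_positive not_le of_nat_0_less_iff zero_less_Suc)
  then obtain z w where zw: "\<And>n. z n \<notin> rts p" "\<And>n. w n \<notin> rts p" "\<And>n. bdist (z n) (w n) < inverse (real (Suc n))"
    "\<And>n. \<epsilon> \<le> dist (J (z n)) (J (w n))"
    by metis
  have "\<forall>n. (J \<circ> z) n \<in> K"
    using J_in_K zw(1) by simp
  then obtain \<kappa> r where r: "\<kappa> \<in> K" "strict_mono r" "((J \<circ> z) \<circ> r) \<longlonglongrightarrow> \<kappa>"
    using compact_K[unfolded compact_def] by blast
  obtain \<delta> where \<delta>: "\<delta> > 0"
    "\<forall>z w. z \<notin> rts p \<longrightarrow> w \<notin> rts p \<longrightarrow> dist (J z) \<kappa> < \<delta> \<longrightarrow> bdist z w < \<delta> \<longrightarrow> dist (J w) \<kappa> < \<epsilon> / 2"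
    using bdist_controls_J_local[OF r(1), of "\<epsilon> / 2"] assms by auto
  have "eventually (\<lambda>n. dist (J (z (r n))) \<kappa> < min \<delta> (\<epsilon> / 2)) sequentially"
    using tendstoD[OF r(3), of "min \<delta> (\<epsilon> / 2)"] \<delta>(1) assms by (simp add: o_def)
  moreover have "eventually (\<lambda>n. inverse (real (Suc n)) < \<delta>) sequentially"
    using LIMSEQ_inverse_real_of_nat \<delta>(1) by (rule order_tendstoD)
  ultimately have "eventually (\<lambda>n. False) sequentially"
  proof eventually_elim
    case (elim n)
    have "inverse (real (Suc (r n))) \<le> inverse (real (Suc n))"
      using seq_suble[OF r(2), of n] by simp
    then have "bdist (z (r n)) (w (r n)) < \<delta>"
      using zw(3)[of "r n"] elim(2) by linarith
    then have "dist (J (w (r n))) \<kappa> < \<epsilon> / 2"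
      using \<delta>(2)[rule_format, OF zw(1) zw(2), of "r n" "r n"] elim(1) by simp
    then have "dist (J (z (r n))) (J (w (r n))) < \<epsilon>"
      using elim(1) dist_triangle_half_l[of "J (z (r n))" \<kappa> \<epsilon> "J (w (r n))"] by (simp add: dist_commute)
    then show False
      using zw(4)[of "r n"] by simp
  qed
  then show False
    by simp
qed

lemma bdist_refl:
  assumes "z \<notin> rts p"
  shows "bdist z z = 0"
proof -
  have "pullback_length p (\<lambda>_. z) \<le> ennreal 0"
    unfolding pullback_length_def
    by (rule curve_length_Lipschitz) (use iA_poly_in_annulus[OF assms] in \<open>auto simp: annulus.zero\<close>)
  then have "bdist z z \<le> 0"
    using assms by (intro bdist_le_length[where \<gamma> = "\<lambda>_. z"])
      (auto simp: path_def path_image_def pathstart_def pathfinish_def)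
  then show ?thesis
    using bdist_nonneg[of z z] by simp
qed

lemma bdist_triangle:
  assumes "x \<notin> rts p" "y \<notin> rts p" "z \<notin> rts p"
  shows "bdist x z \<le> bdist x y + bdist y z"
proof (rule field_le_epsilon)
  fix \<epsilon> :: real assume "\<epsilon> > 0"
  obtain \<gamma> where \<gamma>: "\<gamma> \<in> rectifiable_curves p x y" "enn2real (pullback_length p \<gamma>) < bdist x y + \<epsilon> / 2"
    using bdist_less[OF assms(1,2), of "bdist x y + \<epsilon> / 2"] \<open>\<epsilon> > 0\<close> by auto
  obtain \<delta> where \<delta>: "\<delta> \<in> rectifiable_curves p y z" "enn2real (pullback_length p \<delta>) < bdist y z + \<epsilon> / 2"
    using bdist_less[OF assms(2,3), of "bdist y z + \<epsilon> / 2"] \<open>\<epsilon> > 0\<close> by auto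
  let ?f = "iA \<circ> poly p"
  have p\<gamma>: "path \<gamma>" "path_image \<gamma> \<subseteq> - rts p" "pathstart \<gamma> = x" "pathfinish \<gamma> = y" "pullback_length p \<gamma> < \<infinity>"
    and p\<delta>: "path \<delta>" "path_image \<delta> \<subseteq> - rts p" "pathstart \<delta> = y" "pathfinish \<delta> = z" "pullback_length p \<delta> < \<infinity>"
    using \<gamma>(1) \<delta>(1) by (auto simp: rectifiable_curves_def)
  have "?f \<circ> (\<gamma> +++ \<delta>) = (?f \<circ> \<gamma>) +++ (?f \<circ> \<delta>)"
    by (auto simp: joinpaths_def)
  then have "pullback_length p (\<gamma> +++ \<delta>) = curve_length annulus ((?f \<circ> \<gamma>) +++ (?f \<circ> \<delta>))"
    by (simp add: pullback_length_def)
  also have "\<dots> \<le> pullback_length p \<gamma> + pullback_length p \<delta>"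
    unfolding pullback_length_def
  proof (rule curve_length_joinpaths)
    show "(?f \<circ> \<gamma>) t \<in> mspace annulus" if "t \<in> {0..1}" for t
      using curve_avoids_rts[OF p\<gamma>(2) that] iA_poly_in_annulus by simp
    show "(?f \<circ> \<delta>) t \<in> mspace annulus" if "t \<in> {0..1}" for t
      using curve_avoids_rts[OF p\<delta>(2) that] iA_poly_in_annulus by simp
    show "(?f \<circ> \<gamma>) 1 = (?f \<circ> \<delta>) 0"
      using p\<gamma>(4) p\<delta>(3) by (simp add: pathstart_def pathfinish_def)
  qed
  also have "\<dots> = ennreal (enn2real (pullback_length p \<gamma>) + enn2real (pullback_length p \<delta>))"
    using p\<gamma>(5) p\<delta>(5) by (simp add: ennreal_plus)
  finally have "bdist x z \<le> enn2real (pullback_length p \<gamma>) + enn2real (pullback_length p \<delta>)"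
    using p\<gamma> p\<delta> by (intro bdist_le_length[where \<gamma> = "\<gamma> +++ \<delta>"]) (auto simp: path_image_join)
  then show "bdist x z \<le> bdist x y + bdist y z + \<epsilon>"
    using \<gamma>(2) \<delta>(2) by linarith
qed

lemma bdist_commute_le:
  assumes "x \<notin> rts p" "y \<notin> rts p"
  shows "bdist y x \<le> bdist x y"
proof (rule field_le_epsilon)
  fix \<epsilon> :: real assume "\<epsilon> > 0"
  obtain \<gamma> where \<gamma>: "\<gamma> \<in> rectifiable_curves p x y" "enn2real (pullback_length p \<gamma>) < bdist x y + \<epsilon>"
    using bdist_less[OF assms, of "bdist x y + \<epsilon>"] \<open>\<epsilon> > 0\<close> by auto
  have p\<gamma>: "path \<gamma>" "path_image \<gamma> \<subseteq> - rts p" "pathstart \<gamma> = x" "pathfinish \<gamma> = y" "pullback_length p \<gamma> < \<infinity>"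
    using \<gamma>(1) by (auto simp: rectifiable_curves_def)
  have "pullback_length p (reversepath \<gamma>) = curve_length annulus (\<lambda>t. (iA \<circ> poly p \<circ> \<gamma>) (1 - t))"
    by (simp add: pullback_length_def reversepath_def o_def)
  also have "\<dots> \<le> pullback_length p \<gamma>"
    unfolding pullback_length_def by (rule curve_length_reverse)
  also have "\<dots> = ennreal (enn2real (pullback_length p \<gamma>))"
    using p\<gamma>(5) by simp
  finally have "bdist y x \<le> enn2real (pullback_length p \<gamma>)"
    using p\<gamma> by (intro bdist_le_length[where \<gamma> = "reversepath \<gamma>"]) auto
  then show "bdist y x \<le> bdist x y + \<epsilon>"
    using \<gamma>(2) by linarith
qed

sublocale bdist: Metric_space "- rts p" bdist
proof
  show "0 \<le> bdist x y" for x y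
    by (rule bdist_nonneg)
  show "bdist x y = bdist y x" for x y
  proof (cases "x \<in> - rts p \<and> y \<in> - rts p")
    case True
    then show ?thesis
      using bdist_commute_le[of x y] bdist_commute_le[of y x] by simp
  next
    case False
    then show ?thesis
      unfolding bdist_def by meson
  qed
  show "bdist x y = 0 \<longleftrightarrow> x = y" if "x \<in> - rts p" "y \<in> - rts p" for x y
  proof
    assume "bdist x y = 0"
    \<comment> \<open>Positivity of the path metric: distance 0 satisfies every bound in
      \<open>bdist_controls_J\<close>.\<close>
    then have "dist (J x) (J y) < \<epsilon>" if "\<epsilon> > 0" for \<epsilon>
      using bdist_controls_J[OF that] \<open>x \<in> - rts p\<close> \<open>y \<in> - rts p\<close> by auto
    then have "J x = J y"
      by (metis less_irrefl zero_less_dist_iff)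
    then show "x = y"
      by (simp add: inj_J)
  qed (use bdist_refl that in auto)
  show "bdist x z \<le> bdist x y + bdist y z" if "x \<in> - rts p" "y \<in> - rts p" "z \<in> - rts p" for x y z
    using bdist_triangle that by simp
qed

lemma open_branched_annulus_eq: "open_branched_annulus p = metric (- rts p, bdist)"
  unfolding open_branched_annulus_def bdist_def ..

lemma mspace_oba: "mspace (open_branched_annulus p) = - rts p"
  and mdist_oba: "mdist (open_branched_annulus p) = bdist"
  by (simp_all add: open_branched_annulus_eq bdist.mspace_metric bdist.mdist_metric)

end

subsection \<open>The model is the completion\<close>

context separable_poly
begin

lemma finite_cvl: "finite (cvl p)"
proof -
  have "pderiv p \<noteq> 0"
    using degree_p d_ge_2 by (simp add: pderiv_eq_0_iff)
  then have "finite (cpt p)"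
    unfolding cpt_def by (rule poly_roots_finite)
  then show ?thesis
    by (simp add: cvl_def)
qed

lemma mult_eq_1:
  assumes "x \<in> K" "snd x \<notin> iA ` cvl p"
  shows "mult x = 1"
  using assms(1)
proof (cases rule: K_cases)
  case (interior z)
  then have "z \<notin> cpt p"
    using assms(2) by (auto simp: J_def cvl_def)
  then have "order z (pderiv p) = 0"
    by (simp add: cpt_def order_root)
  then show ?thesis
    using mult_J interior by simp
qed (simp_all add: mult_def)

text \<open>Straight segments in a ball free of roots have length at most a constant times their
  Euclidean length.\<close>

lemma bdist_small_near:
  assumes z0: "z0 \<notin> rts p" and "\<epsilon> > 0"
  shows "\<exists>\<delta>>0. \<forall>z. dist z z0 < \<delta> \<longrightarrow> z \<notin> rts p \<and> bdist z0 z < \<epsilon>"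
proof -
  obtain s where s: "s > 0" "cball z0 s \<subseteq> - rts p"
    using open_complement_rts z0 by (meson ComplI open_contains_cball)
  have "compact (poly p ` cball z0 s)"
    by (intro compact_continuous_image continuous_intros) auto
  moreover have "0 \<notin> poly p ` cball z0 s"
    using s(2) by (auto simp: rts_def)
  ultimately obtain c where c: "c > 0" "\<forall>y\<in>poly p ` cball z0 s. c \<le> dist 0 y"
    using separate_point_closed[of "poly p ` cball z0 s" 0] compact_imp_closed by blast
  have "bounded (cball z0 s)"
    by simp
  then obtain R where "\<forall>x\<in>cball z0 s. cmod x \<le> R"
    unfolding bounded_iff by blast
  then have "cball z0 s \<subseteq> cball 0 R"
    by auto
  then obtain L where L: "L \<ge> 0" "\<forall>\<gamma> C. C \<ge> 0 \<longrightarrow> \<gamma> ` {0..1} \<subseteq> cball z0 s \<longrightarrow>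
    (\<forall>s\<in>{0..1}. \<forall>t\<in>{0..1}. cmod (\<gamma> s - \<gamma> t) \<le> C * \<bar>s - t\<bar>) \<longrightarrow> pullback_length p \<gamma> \<le> ennreal (L * C)"
    using Lipschitz_curve_length[of "cball z0 s" R c] c by auto
  \<comment> \<open>The denominator \<open>L + 1\<close> is positive even when \<open>L\<close> is
    0.\<close>
  define \<delta> where "\<delta> = min s (\<epsilon> / (L + 1))"
  have "\<delta> > 0"
    using s(1) \<open>\<epsilon> > 0\<close> L(1) by (simp add: \<delta>_def)
  moreover have "z \<notin> rts p \<and> bdist z0 z < \<epsilon>" if z: "dist z z0 < \<delta>" for z
  proof
    have zs: "z \<in> cball z0 s"
      using z by (simp add: \<delta>_def dist_commute)
    then show "z \<notin> rts p"
      using s(2) by blast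
    have seg: "path_image (linepath z0 z) \<subseteq> cball z0 s"
      using zs s(1) by (simp add: closed_segment_subset)
    have lip: "cmod (linepath z0 z a - linepath z0 z b) \<le> cmod (z - z0) * \<bar>a - b\<bar>" for a b
    proof -
      have "linepath z0 z a - linepath z0 z b = (a - b) *\<^sub>R (z - z0)"
        by (simp add: linepath_def algebra_simps)
      then show ?thesis
        by simp
    qed
    have "pullback_length p (linepath z0 z) \<le> ennreal (L * cmod (z - z0))"
      using L(2)[rule_format, of "cmod (z - z0)" "linepath z0 z"] lip seg by (simp add: path_image_def)
    then have "bdist z0 z \<le> L * cmod (z - z0)"
      using seg s(2) L(1) by (intro bdist_le_length[where \<gamma> = "linepath z0 z"]) auto
    also have "\<dots> \<le> L * (\<epsilon> / (L + 1))"
      using z L(1) by (intro mult_left_mono) (auto simp: \<delta>_def dist_norm)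
    also have "\<dots> < \<epsilon>"
      using L(1) \<open>\<epsilon> > 0\<close> by (simp add: field_simps)
    finally show "bdist z0 z < \<epsilon>" .
  qed
  ultimately show ?thesis
    by blast
qed

text \<open>
  Near a boundary point the projection is a local homeomorphism, so straight segments in the
  annulus lift to curves of the same length.
\<close>

lemma J_controls_bdist_boundary:
  assumes \<kappa>: "\<kappa> \<in> K" "\<bar>snd (snd \<kappa>)\<bar> = 1" and "\<epsilon> > 0"
  shows "\<exists>\<delta>>0. \<forall>z w. z \<notin> rts p \<longrightarrow> w \<notin> rts p \<longrightarrow> dist (J z) \<kappa> < \<delta> \<longrightarrow> dist (J w) \<kappa> < \<delta> \<longrightarrow> bdist z w < \<epsilon>"
proof -
  \<comment> \<open>Away from the critical values all multiplicities are 1, so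
    \<open>covering_unbranched\<close> applies, including at the boundary.\<close>
  define S where "S = annulus_set - iA ` cvl p"
  have cov: "covering_space (K \<inter> snd -` S) snd S"
    using mult_eq_1 d_ge_2 by (intro covering_unbranched) (auto simp: S_def)
  \<comment> \<open>Critical points are not roots, so critical values have height strictly between
    -1 and 1.\<close>
  have "snd \<kappa> \<notin> iA ` cvl p"
  proof
    assume "snd \<kappa> \<in> iA ` cvl p"
    then obtain b where b: "b \<in> cpt p" "snd \<kappa> = iA (poly p b)"
      by (auto simp: cvl_def)
    have "b \<notin> rts p"
      using b(1) simple_root by (auto simp: cpt_def)
    then show False
      using height_J[of b] b(2) \<kappa>(2) by (simp add: J_def)
  qed
  then have S: "snd \<kappa> \<in> S"
    using \<kappa>(1) snd_K by (auto simp: S_def)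
  have "\<exists>u T q. \<kappa> \<in> u \<and> openin (top_of_set (K \<inter> snd -` S)) u \<and> openin (top_of_set S) T \<and> homeomorphism u T snd q"
  proof -
    from bspec[OF conjunct2[OF conjunct2[OF cov[unfolded covering_space_def]]] S]
    obtain T v where T: "snd \<kappa> \<in> T" "openin (top_of_set S) T" "\<Union> v = K \<inter> snd -` S \<inter> snd -` T"
      "\<forall>u\<in>v. openin (top_of_set (K \<inter> snd -` S)) u" "\<forall>u\<in>v. \<exists>q. homeomorphism u T snd q"
      by (elim exE conjE)
    have "\<kappa> \<in> \<Union> v"
      unfolding T(3) using \<kappa>(1) S T(1) by simp
    then obtain u where "u \<in> v" "\<kappa> \<in> u"
      by blast
    moreover obtain q where "homeomorphism u T snd q"
      using bspec[OF T(5) \<open>u \<in> v\<close>] by (elim exE)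
    ultimately show ?thesis
      using T(2) bspec[OF T(4) \<open>u \<in> v\<close>] by (intro exI conjI)
  qed
  then obtain u T q where u: "\<kappa> \<in> u" "openin (top_of_set (K \<inter> snd -` S)) u"
    and T: "openin (top_of_set S) T" and q: "homeomorphism u T snd q"
    by blast
  have uK: "u \<subseteq> K"
    using u(2) openin_imp_subset by blast
  have "closed (iA ` cvl p)"
    using finite_cvl by (intro finite_imp_closed finite_imageI)
  then have S_open: "openin (top_of_set annulus_set) S"
    unfolding S_def Diff_eq by (intro openin_open_Int) (simp add: open_Compl)
  have "openin (top_of_set annulus_set) T"
    using T S_open by (rule openin_trans)
  moreover have "snd \<kappa> \<in> T"
    using u(1) q by (auto simp: homeomorphism_def)
  ultimately obtain \<rho> where \<rho>: "\<rho> > 0" "\<forall>x\<in>annulus_set. dist x (snd \<kappa>) < \<rho> \<longrightarrow> x \<in> T"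
    unfolding openin_euclidean_subtopology_iff by blast
  obtain r where r: "r > 0" "\<forall>x\<in>K \<inter> snd -` S. dist x \<kappa> < r \<longrightarrow> x \<in> u"
    using u unfolding openin_euclidean_subtopology_iff by blast
  \<comment> \<open>The segment below moves through an angle below 4 * \<delta> and a height below 2
    * \<delta>, and starts within \<delta> of the centre. It therefore stays within 7 * \<delta>,
    and 8 leaves a margin.\<close>
  define \<delta> where "\<delta> = min r (min (\<rho> / 8) (\<epsilon> / 8))"
  have \<delta>: "\<delta> > 0" "\<delta> \<le> r" "8 * \<delta> \<le> \<rho>" "8 * \<delta> \<le> \<epsilon>"
    using r(1) \<rho>(1) \<open>\<epsilon> > 0\<close> by (auto simp: \<delta>_def)
  have "bdist z w < \<epsilon>" if zw: "z \<notin> rts p" "w \<notin> rts p" "dist (J z) \<kappa> < \<delta>" "dist (J w) \<kappa> < \<delta>" for z w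
  proof -
    have near: "J x \<in> u \<and> iA (poly p x) \<in> annulus_set \<and> dist (iA (poly p x)) (snd \<kappa>) < \<delta>"
      if "x \<notin> rts p" "dist (J x) \<kappa> < \<delta>" for x
    proof -
      have A: "iA (poly p x) \<in> annulus_set"
        using iA_poly_in_annulus[OF that(1)] .
      moreover have d: "dist (iA (poly p x)) (snd \<kappa>) < \<delta>"
        using that(2) dist_snd_le[of "J x" \<kappa>] by (simp add: J_def)
      moreover have "iA (poly p x) \<in> T"
        using \<rho>(2) A d \<delta>(1,3) by auto
      then have "iA (poly p x) \<in> S"
        using openin_imp_subset[OF T] by blast
      then have "J x \<in> u"
        using r(2) J_in_K[OF that(1)] that(2) \<delta>(2) by (simp add: J_def)
      ultimately show ?thesis
        by blast
    qed
    obtain U h where Uh: "iA (poly p z) = (U, h)"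
      by (cases "iA (poly p z)")
    obtain U' h' where Uh': "iA (poly p w) = (U', h')"
      by (cases "iA (poly p w)")
    have unit: "cmod U = 1" "cmod U' = 1"
      using near[OF zw(1,3)] near[OF zw(2,4)] Uh Uh' by (auto simp: annulus_set_def)
    have h: "\<bar>h\<bar> < 1" "\<bar>h'\<bar> < 1"
      using height_J[OF zw(1)] height_J[OF zw(2)] Uh Uh' by (simp_all add: J_def)
    obtain \<theta> where \<theta>: "U' = U * cis \<theta>" "\<bar>\<theta>\<bar> = circle_dist U' U"
      using cis_circle_dist[OF unit(2,1)] by metis
    have d2: "dist (U, h) (U', h') < 2 * \<delta>"
    proof -
      have "dist (U, h) (snd \<kappa>) < \<delta>" "dist (U', h') (snd \<kappa>) < \<delta>"
        using near[OF zw(1,3)] near[OF zw(2,4)] Uh Uh' by simp_all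
      then show ?thesis
        using dist_triangle2[of "(U, h)" "(U', h')" "snd \<kappa>"] by linarith
    qed
    have "dist U' U < 2 * \<delta>" "dist h' h < 2 * \<delta>"
      using d2 dist_fst_le[of "(U, h)" "(U', h')"] dist_snd_le[of "(U, h)" "(U', h')"] by (auto simp: dist_commute)
    then have \<theta>h: "\<bar>\<theta>\<bar> + \<bar>h' - h\<bar> < 6 * \<delta>"
      using circle_dist_le_norm[OF unit(2,1)] \<theta>(2) by (simp add: dist_norm)
    \<comment> \<open>A straight segment in angle and height, so its length is at most
      \<open>\<bar>\<theta>\<bar> + \<bar>h' - h\<bar>\<close>.\<close>
    define \<Gamma> where "\<Gamma> t = (U * cis (t * \<theta>), h + t * (h' - h))" for t :: real
    have \<Gamma>_dist: "annulus_dist (\<Gamma> s) (\<Gamma> t) \<le> (\<bar>\<theta>\<bar> + \<bar>h' - h\<bar>) * \<bar>s - t\<bar>" for s t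
    proof -
      have "s * \<theta> - t * \<theta> = (s - t) * \<theta>" "snd (\<Gamma> s) - snd (\<Gamma> t) = (s - t) * (h' - h)"
        by (simp_all add: \<Gamma>_def algebra_simps)
      then have "annulus_dist (\<Gamma> s) (\<Gamma> t) \<le> \<bar>(s - t) * \<theta>\<bar> + \<bar>(s - t) * (h' - h)\<bar>"
        using annulus_dist_le_sum[of "\<Gamma> s" "\<Gamma> t"] circle_dist_cis[of U "s * \<theta>" "t * \<theta>"]
        by (simp add: \<Gamma>_def)
      also have "\<dots> = (\<bar>\<theta>\<bar> + \<bar>h' - h\<bar>) * \<bar>s - t\<bar>"
        by (simp only: abs_mult distrib_right) (simp only: mult.commute)
      finally show ?thesis .
    qed
    \<comment> \<open>Heights strictly inside the range force the lift to consist of interior points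
      of \<open>K\<close>, so that it is a curve in the plane off the roots.\<close>
    have \<Gamma>_height: "\<bar>snd (\<Gamma> t)\<bar> < 1" if "t \<in> {0..1}" for t
    proof -
      have "snd (\<Gamma> t) = (1 - t) *\<^sub>R h + t *\<^sub>R h'"
        by (simp add: \<Gamma>_def algebra_simps)
      then have "snd (\<Gamma> t) \<in> {-1<..<1}"
        using convexD[OF convex_real_interval(8)[of "-1" 1], of h h' "1 - t" t] h that by (auto simp: abs_less_iff)
      then show ?thesis
        by (simp add: abs_less_iff)
    qed
    have \<Gamma>_A: "\<Gamma> t \<in> annulus_set" if "t \<in> {0..1}" for t
      using \<Gamma>_height[OF that] unit(1) by (auto simp: \<Gamma>_def annulus_set_def norm_mult abs_less_iff)
    have \<Gamma>_T: "\<Gamma> t \<in> T" if t: "t \<in> {0..1}" for t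
    proof -
      have "dist (\<Gamma> t) (\<Gamma> 0) \<le> (\<bar>\<theta>\<bar> + \<bar>h' - h\<bar>) * \<bar>t - 0\<bar>"
        using dist_le_annulus_dist[OF \<Gamma>_A[OF t] \<Gamma>_A[of 0]] \<Gamma>_dist[of t 0] by simp
      also have "\<dots> \<le> (\<bar>\<theta>\<bar> + \<bar>h' - h\<bar>) * 1"
        using t by (intro mult_left_mono) auto
      finally have "dist (\<Gamma> t) (\<Gamma> 0) < 6 * \<delta>"
        using \<theta>h by simp
      moreover have "dist (\<Gamma> 0) (snd \<kappa>) < \<delta>"
        using near[OF zw(1,3)] Uh by (simp add: \<Gamma>_def)
      ultimately have "dist (\<Gamma> t) (snd \<kappa>) < \<rho>"
        using dist_triangle[of "\<Gamma> t" "snd \<kappa>" "\<Gamma> 0"] \<delta>(1,3) by linarith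
      then show ?thesis
        using \<rho>(2) \<Gamma>_A[OF t] by blast
    qed
    have q\<Gamma>: "q (\<Gamma> t) \<in> K" "snd (q (\<Gamma> t)) = \<Gamma> t" if "t \<in> {0..1}" for t
      using \<Gamma>_T[OF that] homeomorphism_image2[OF q] homeomorphism_apply2[OF q] uK by blast+
    define \<gamma> where "\<gamma> t = unsquash (fst (q (\<Gamma> t)))" for t
    have J\<gamma>: "\<gamma> t \<notin> rts p \<and> q (\<Gamma> t) = J (\<gamma> t)" if t: "t \<in> {0..1}" for t
    proof -
      have height: "\<bar>snd (snd (q (\<Gamma> t)))\<bar> < 1"
        using q\<Gamma>(2)[OF t] \<Gamma>_height[OF t] by simp
      from q\<Gamma>(1)[OF t] show ?thesis
      proof (cases rule: K_cases)
        case (interior x)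
        then show ?thesis
          by (simp add: \<gamma>_def J_def)
      qed (use height in auto)
    qed
    have "continuous_on {0..1} \<Gamma>"
      unfolding \<Gamma>_def by (intro continuous_intros)
    then have "continuous_on {0..1} (\<lambda>t. q (\<Gamma> t))"
      using continuous_on_compose2[OF homeomorphism_cont2[OF q]] \<Gamma>_T by blast
    then have "continuous_on {0..1} \<gamma>"
      unfolding \<gamma>_def
    proof (intro continuous_on_compose2[OF continuous_on_unsquash] continuous_intros)
      show "(\<lambda>t. fst (q (\<Gamma> t))) ` {0..1} \<subseteq> ball 0 1"
      proof (rule image_subsetI)
        fix t :: real assume "t \<in> {0..1}"
        then have "fst (q (\<Gamma> t)) = squash (\<gamma> t)"
          using J\<gamma> by (simp add: J_def)
        then show "fst (q (\<Gamma> t)) \<in> ball 0 1"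
          using cmod_squash_less by simp
      qed
    qed
    then have "path \<gamma>"
      by (simp add: path_def)
    \<comment> \<open>Both \<open>J z\<close> and \<open>J w\<close> lie in the sheet
      \<open>u\<close>, on which \<open>q\<close> inverts the projection; hence the lifted segment
      joins \<open>z\<close> to \<open>w\<close>.\<close>
    have qJ: "q (iA (poly p x)) = J x" if "J x \<in> u" for x
      using homeomorphism_apply1[OF q that] by (simp add: J_def)
    have "\<gamma> 0 = z"
      using qJ[of z] near[OF zw(1,3)] Uh by (simp add: \<gamma>_def \<Gamma>_def J_def)
    moreover have "\<gamma> 1 = w"
      using qJ[of w] near[OF zw(2,4)] Uh' \<theta>(1) by (simp add: \<gamma>_def \<Gamma>_def J_def)
    moreover have "path_image \<gamma> \<subseteq> - rts p"
      using J\<gamma> unfolding path_image_def by blast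
    moreover have "pullback_length p \<gamma> \<le> ennreal (\<bar>\<theta>\<bar> + \<bar>h' - h\<bar>)"
      unfolding pullback_length_def
    proof (rule curve_length_Lipschitz)
      fix s t :: real assume st: "0 \<le> s" "s \<le> t" "t \<le> 1"
      have "iA (poly p (\<gamma> x)) = \<Gamma> x" if "x \<in> {0..1}" for x
        using J\<gamma>[OF that] q\<Gamma>(2)[OF that] by (simp add: J_def)
      then show "mdist annulus ((iA \<circ> poly p \<circ> \<gamma>) s) ((iA \<circ> poly p \<circ> \<gamma>) t) \<le> (\<bar>\<theta>\<bar> + \<bar>h' - h\<bar>) * (t - s)"
        using \<Gamma>_dist[of s t] st by simp
    qed simp
    ultimately have "bdist z w \<le> \<bar>\<theta>\<bar> + \<bar>h' - h\<bar>"
      using \<open>path \<gamma>\<close> by (intro bdist_le_length[where \<gamma> = \<gamma>]) (auto simp: pathstart_def pathfinish_def)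
    then show ?thesis
      using \<theta>h \<delta>(1,4) by linarith
  qed
  then show ?thesis
    using \<delta>(1) by blast
qed

text \<open>Interior points are compared through the centre \<open>z0\<close> by straight segments;
  boundary points by lifted segments.\<close>

lemma J_controls_bdist_local:
  assumes \<kappa>: "\<kappa> \<in> K" and "\<epsilon> > 0"
  shows "\<exists>\<delta>>0. \<forall>z w. z \<notin> rts p \<longrightarrow> w \<notin> rts p \<longrightarrow> dist (J z) \<kappa> < \<delta> \<longrightarrow> dist (J w) \<kappa> < \<delta> \<longrightarrow> bdist z w < \<epsilon>"
  using \<kappa>
proof (cases rule: K_cases)
  case (interior z0)
  obtain \<delta> where \<delta>: "\<delta> > 0" "\<forall>z. dist z z0 < \<delta> \<longrightarrow> z \<notin> rts p \<and> bdist z0 z < \<epsilon> / 2"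
    using bdist_small_near[OF interior(1), of "\<epsilon> / 2"] \<open>\<epsilon> > 0\<close> by auto
  have "isCont unsquash (squash z0)"
    using continuous_on_unsquash cmod_squash_less[of z0] by (simp add: continuous_on_eq_continuous_at)
  then obtain \<eta> where \<eta>: "\<eta> > 0" "\<And>y. dist y (squash z0) < \<eta> \<Longrightarrow> dist (unsquash y) z0 < \<delta>"
    using \<delta>(1) unfolding continuous_at_eps_delta by fastforce
  have near: "bdist z0 z < \<epsilon> / 2" if "dist (J z) \<kappa> < \<eta>" for z
  proof -
    have "dist (squash z) (squash z0) < \<eta>"
      using that dist_fst_le[of "J z" \<kappa>] interior(2) by (simp add: J_def)
    then have "dist z z0 < \<delta>"
      using \<eta>(2) by fastforce
    then show ?thesis
      using \<delta>(2) by blast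
  qed
  have "bdist z w < \<epsilon>" if "z \<notin> rts p" "w \<notin> rts p" "dist (J z) \<kappa> < \<eta>" "dist (J w) \<kappa> < \<eta>" for z w
    using near[OF that(3)] near[OF that(4)] bdist_triangle[OF that(1) interior(1) that(2)] bdist.commute[of z z0]
    by linarith
  then show ?thesis
    using \<eta>(1) by blast
qed (use J_controls_bdist_boundary[OF \<kappa> _ \<open>\<epsilon> > 0\<close>] in auto)

text \<open>The same compactness argument as for \<open>bdist_controls_J\<close>: along a
  subsequence both images tend to one point of \<open>K\<close>.\<close>

lemma J_controls_bdist:
  assumes "\<epsilon> > 0"
  shows "\<exists>\<delta>>0. \<forall>z w. z \<notin> rts p \<longrightarrow> w \<notin> rts p \<longrightarrow> dist (J z) (J w) < \<delta> \<longrightarrow> bdist z w < \<epsilon>"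
proof (rule ccontr)
  assume "\<not> ?thesis"
  then have "\<forall>n. \<exists>z w. z \<notin> rts p \<and> w \<notin> rts p \<and> dist (J z) (J w) < inverse (real (Suc n)) \<and> \<epsilon> \<le> bdist z w"
    by (metis inverse_positive_iff_positive not_le of_nat_0_less_iff zero_less_Suc)
  then obtain z w where zw: "\<And>n. z n \<notin> rts p" "\<And>n. w n \<notin> rts p"
    "\<And>n. dist (J (z n)) (J (w n)) < inverse (real (Suc n))" "\<And>n. \<epsilon> \<le> bdist (z n) (w n)"
    by metis
  have "\<forall>n. (J \<circ> z) n \<in> K"
    using J_in_K zw(1) by simp
  then obtain \<kappa> r where r: "\<kappa> \<in> K" "strict_mono r" "((J \<circ> z) \<circ> r) \<longlonglongrightarrow> \<kappa>"
    using compact_K[unfolded compact_def] by blast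
  obtain \<delta> where \<delta>: "\<delta> > 0"
    "\<forall>z w. z \<notin> rts p \<longrightarrow> w \<notin> rts p \<longrightarrow> dist (J z) \<kappa> < \<delta> \<longrightarrow> dist (J w) \<kappa> < \<delta> \<longrightarrow> bdist z w < \<epsilon>"
    using J_controls_bdist_local[OF r(1) assms] by auto
  have "eventually (\<lambda>n. dist (J (z (r n))) \<kappa> < \<delta> / 2) sequentially"
    using tendstoD[OF r(3), of "\<delta> / 2"] \<delta>(1) by (simp add: o_def)
  moreover have "eventually (\<lambda>n. inverse (real (Suc n)) < \<delta> / 2) sequentially"
    using LIMSEQ_inverse_real_of_nat \<delta>(1) by (intro order_tendstoD) auto
  ultimately have "eventually (\<lambda>n. False) sequentially"
  proof eventually_elim
    case (elim n)
    have "inverse (real (Suc (r n))) \<le> inverse (real (Suc n))"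
      using seq_suble[OF r(2), of n] by simp
    then have "dist (J (z (r n))) (J (w (r n))) < \<delta> / 2"
      using zw(3)[of "r n"] elim(2) by linarith
    then have "dist (J (w (r n))) \<kappa> < \<delta>"
      using elim(1) dist_triangle3[of "J (w (r n))" \<kappa> "J (z (r n))"] by linarith
    moreover have "dist (J (z (r n))) \<kappa> < \<delta>"
      using elim(1) \<delta>(1) by linarith
    ultimately have "bdist (z (r n)) (w (r n)) < \<epsilon>"
      using \<delta>(2)[rule_format, OF zw(1) zw(2)] by blast
    then show False
      using zw(4)[of "r n"] by simp
  qed
  then show False
    by simp
qed

text \<open>The maps between the images of \<open>J\<close> and \<open>i\<close> are uniformly
  continuous both ways and extend to the closures, since both target spaces are complete. The
  composites of the extensions are identities on dense sets, hence everywhere.\<close>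

lemma completion_model:
  assumes "is_metric_completion (open_branched_annulus p) B i"
  shows "\<exists>G. homeomorphic_map (top_of_set K) (mtopology_of B) G \<and> (\<forall>z. z \<notin> rts p \<longrightarrow> G (J z) = i z)"
proof -
  let ?M = "- rts p"
  have B: "mcomplete_of B" "i \<in> ?M \<rightarrow> mspace B" "\<And>z w. z \<notin> rts p \<Longrightarrow> w \<notin> rts p \<Longrightarrow> mdist B (i z) (i w) = bdist z w"
    "mtopology_of B closure_of (i ` ?M) = mspace B"
    using assms unfolding is_metric_completion_def mspace_oba mdist_oba by auto
  have Hausdorff_B: "Hausdorff_space (mtopology_of B)"
    by (metis Metric_space.Hausdorff_space_mtopology Metric_space_mspace_mdist mtopology_of_def)
  define f where "f x = i (unsquash (fst x))" for x :: "complex \<times> complex \<times> real"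
  have f: "f (J z) = i z" for z
    by (simp add: f_def J_def)
  have "uniformly_continuous_map (submetric euclidean_metric (J ` ?M)) B f"
    unfolding uniformly_continuous_map_def
  proof (intro conjI allI impI)
    show "f \<in> mspace (submetric euclidean_metric (J ` ?M)) \<rightarrow> mspace B"
      using B(2) f by auto
    fix \<epsilon> :: real assume "\<epsilon> > 0"
    then obtain \<delta> where "\<delta> > 0" "\<forall>z w. z \<notin> rts p \<longrightarrow> w \<notin> rts p \<longrightarrow> dist (J z) (J w) < \<delta> \<longrightarrow> bdist z w < \<epsilon>"
      using J_controls_bdist by blast
    then show "\<exists>\<delta>>0. \<forall>x\<in>mspace (submetric euclidean_metric (J ` ?M)).
        \<forall>y\<in>mspace (submetric euclidean_metric (J ` ?M)).
          mdist (submetric euclidean_metric (J ` ?M)) y x < \<delta> \<longrightarrow> mdist B (f y) (f x) < \<epsilon>"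
      using f B(3) by (intro exI[of _ \<delta>]) auto
  qed
  then obtain G where G: "continuous_map (top_of_set K) (mtopology_of B) G" "\<And>x. x \<in> J ` ?M \<Longrightarrow> G x = f x"
    using Cauchy_continuous_map_extends_to_continuous_closure_of[OF B(1) uniformly_imp_Cauchy_continuous_map]
    unfolding K_def by (metis mtopology_of_euclidean euclidean_closure_of)
  have GJ: "G (J z) = i z" if "z \<notin> rts p" for z
    using G(2)[of "J z"] f[of z] that by simp
  have inj: "inj_on i ?M"
  proof (rule inj_onI)
    fix z w assume zw: "z \<in> ?M" "w \<in> ?M" "i z = i w"
    have "i w \<in> mspace B"
      using B(2) zw(2) by auto
    then have "mdist B (i z) (i w) = 0"
      using zw(3) by simp
    then have "bdist z w = 0"
      using B(3)[of z w] zw(1,2) by simp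
    then show "z = w"
      using zw by simp
  qed
  define g where "g y = J (inv_into ?M i y)" for y
  have g: "g (i z) = J z" if "z \<notin> rts p" for z
    using inj that by (simp add: g_def)
  have "uniformly_continuous_map (submetric B (i ` ?M)) euclidean_metric g"
    unfolding uniformly_continuous_map_def
  proof (intro conjI allI impI)
    fix \<epsilon> :: real assume "\<epsilon> > 0"
    then obtain \<delta> where "\<delta> > 0" "\<forall>z w. z \<notin> rts p \<longrightarrow> w \<notin> rts p \<longrightarrow> bdist z w < \<delta> \<longrightarrow> dist (J z) (J w) < \<epsilon>"
      using bdist_controls_J by blast
    then show "\<exists>\<delta>>0. \<forall>x\<in>mspace (submetric B (i ` ?M)). \<forall>y\<in>mspace (submetric B (i ` ?M)).
        mdist (submetric B (i ` ?M)) y x < \<delta> \<longrightarrow> mdist euclidean_metric (g y) (g x) < \<epsilon>"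
      using g B(3) by (intro exI[of _ \<delta>]) auto
  qed simp
  moreover have "mcomplete_of (euclidean_metric :: (complex \<times> complex \<times> real) metric)"
    by (simp add: mcomplete_of_def complete_UNIV)
  ultimately obtain H where "continuous_map (subtopology (mtopology_of B) (mtopology_of B closure_of i ` ?M)) (mtopology_of euclidean_metric) H"
    and Hg: "\<And>y. y \<in> i ` ?M \<Longrightarrow> H y = g y"
    using Cauchy_continuous_map_extends_to_continuous_closure_of[OF _ uniformly_imp_Cauchy_continuous_map] by metis
  then have H: "continuous_map (mtopology_of B) euclidean H"
    unfolding B(4) by (metis mtopology_of_euclidean subtopology_topspace topspace_mtopology_of)
  \<comment> \<open>Holds on the dense image of \<open>i\<close>, and passes to limits because
    \<open>K\<close> is closed.\<close>
  have HK: "H y \<in> K" if "y \<in> mspace B" for y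
  proof -
    have "closedin (mtopology_of B) {y \<in> topspace (mtopology_of B). H y \<in> K}"
      using H by (intro closedin_continuous_map_preimage) (auto simp: K_def)
    then show ?thesis
      using that Hg g J_in_K by (intro forall_in_closure_of[of y "mtopology_of B" "i ` ?M" "\<lambda>y. H y \<in> K"]) (auto simp: B(4))
  qed
  then have H': "continuous_map (mtopology_of B) (top_of_set K) H"
    using H by (auto simp: continuous_map_in_subtopology)
  have GH: "G (H y) = y" if "y \<in> mspace B" for y
  proof (rule forall_in_closure_of_eq[of y "mtopology_of B" "i ` ?M" "mtopology_of B" "\<lambda>y. G (H y)" "\<lambda>y. y"])
    show "continuous_map (mtopology_of B) (mtopology_of B) (\<lambda>y. G (H y))"
      using continuous_map_compose[OF H' G(1)] by (simp add: o_def)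
    show "G (H y) = y" if "y \<in> i ` ?M" for y
      using that Hg g GJ by auto
  qed (use that B(4) Hausdorff_B in auto)
  have HG: "H (G x) = x" if "x \<in> K" for x
  proof (rule forall_in_closure_of_eq[of x "top_of_set K" "J ` ?M" "euclidean" "\<lambda>x. H (G x)" "\<lambda>x. x"])
    have "J ` ?M \<subseteq> K"
      using J_in_K by auto
    then show "x \<in> top_of_set K closure_of J ` ?M"
      using that by (simp add: closure_of_subtopology inf.absorb2) (simp add: K_def)
    show "continuous_map (top_of_set K) euclidean (\<lambda>x. H (G x))"
      using continuous_map_compose[OF G(1) H] by (simp add: o_def)
    show "H (G x) = x" if "x \<in> J ` ?M" for x
      using that Hg g GJ by auto
  qed auto
  have "homeomorphic_maps (top_of_set K) (mtopology_of B) G H"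
    unfolding homeomorphic_maps_def using G(1) H' GH HG by simp
  then have "homeomorphic_map (top_of_set K) (mtopology_of B) G"
    by (rule homeomorphic_maps_imp_map)
  moreover have "\<forall>z. z \<notin> rts p \<longrightarrow> G (J z) = i z"
    using GJ by simp
  ultimately show ?thesis
    by blast
qed

end

subsection \<open>Valences\<close>

lemma connected_components_of_top_of_set: "connected_components_of (top_of_set S) = components S"
proof -
  have "connected_component_of (top_of_set S) = connected_component S"
    by (intro ext) (auto simp: connected_component_of_def connected_component_def connectedin_subtopology)
  then show ?thesis
    by (simp add: connected_components_of_def components_def)
qed

lemma (in annulus_grid) cylinder_eq: "cylinder = annulus_set"
  by (simp add: annulus_set_def)

context separable_poly
begin

lemma critical_not_root: "b \<in> cpt p \<Longrightarrow> b \<notin> rts p"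
  using simple_root by (auto simp: cpt_def)

lemma cvl_nonzero: "c \<in> cvl p \<Longrightarrow> c \<noteq> 0"
  using critical_not_root by (auto simp: cvl_def rts_def)

definition U where "U = {c / of_real (cmod c) |c. c \<in> cvl p}"
definition H where "H = {-1, 1} \<union> {((cmod c)\<^sup>2 - 1) / ((cmod c)\<^sup>2 + 1) |c. c \<in> cvl p}"

sublocale grid: annulus_grid U H
proof
  have U: "U = (\<lambda>c. fst (iA c)) ` cvl p"
    by (auto simp: U_def iA_def)
  have H: "H = {-1, 1} \<union> (\<lambda>c. snd (iA c)) ` cvl p"
    by (auto simp: H_def iA_def)
  show "finite U" "finite H"
    unfolding U H using finite_cvl by auto
  show "U \<subseteq> sphere 0 1"
    unfolding U using cvl_nonzero by (auto simp: direction_iA norm_sgn)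
  show "H \<subseteq> {-1..1}"
    unfolding H using cvl_nonzero height_iA_bounds by (force simp: less_imp_le)
  show "-1 \<in> H" "1 \<in> H"
    by (simp_all add: H_def)
qed

lemma iA_cvl: "iA ` cvl p \<subseteq> U \<times> H"
  by (auto simp: iA_def U_def H_def)

lemma annulus_cells_0: "annulus_cells p 0 = {{u} \<times> {h} |u h. u \<in> U \<and> h \<in> H}"
  unfolding annulus_cells_def circle_cells_def interval_cells_def graph_cells_def
    U_def[symmetric] H_def[symmetric] by auto

lemma annulus_cells_1: "annulus_cells p 1 = grid.vertical \<union> grid.horizontal"
proof
  note defs = annulus_cells_def circle_cells_def interval_cells_def U_def[symmetric] H_def[symmetric]
  show "annulus_cells p 1 \<subseteq> grid.vertical \<union> grid.horizontal"
  proof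
    fix c assume "c \<in> annulus_cells p 1"
    then obtain e f i j where c: "c = e \<times> f" "e \<in> graph_cells (sphere 0 1) U i" "f \<in> graph_cells {-1..1} H j" "i + j = 1"
      unfolding defs by blast
    then consider "i = 0" "j = 1" | "i = 1" "j = 0"
      by linarith
    then show "c \<in> grid.vertical \<union> grid.horizontal"
    proof cases
      case 1
      then obtain v where "e = {v}" "v \<in> U" "f \<in> components ({-1..1} - H)"
        using c(2,3) by (auto simp: graph_cells_def)
      then show ?thesis
        unfolding grid.vertical_def c(1) by blast
    next
      case 2
      then obtain h where "f = {h}" "h \<in> H" "e \<in> components (sphere 0 1 - U)"
        using c(2,3) by (auto simp: graph_cells_def)
      then show ?thesis
        unfolding grid.horizontal_def c(1) by blast
    qed
  qed
  show "grid.vertical \<union> grid.horizontal \<subseteq> annulus_cells p 1"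
  proof
    fix c assume "c \<in> grid.vertical \<union> grid.horizontal"
    then consider u f where "c = {u} \<times> f" "u \<in> U" "f \<in> components ({-1..1} - H)"
      | e h where "c = e \<times> {h}" "e \<in> components (sphere 0 1 - U)" "h \<in> H"
      unfolding grid.vertical_def grid.horizontal_def by blast
    then show "c \<in> annulus_cells p 1"
    proof cases
      case 1
      then have "{u} \<in> graph_cells (sphere 0 1) U 0" "f \<in> graph_cells {-1..1} H 1"
        by (auto simp: graph_cells_def)
      then show ?thesis
        unfolding defs using 1(1) add_0[of "1::nat"] by blast
    next
      case 2
      then have "e \<in> graph_cells (sphere 0 1) U 1" "{h} \<in> graph_cells {-1..1} H 0"
        by (auto simp: graph_cells_def)
      then show ?thesis
        unfolding defs using 2(1) add_0_right[of "1::nat"] by blast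
    qed
  qed
qed

text \<open>By \<open>iA_cvl\<close> all branch values are vertices of the grid, and open edges
  avoid vertices. This is the hypothesis under which edges lift.\<close>

lemma mult_over_edge:
  assumes "c \<in> annulus_cells p 1" "x \<in> K" "snd x \<in> c"
  shows "mult x = 1"
proof -
  have "c \<inter> U \<times> H = {}"
    using assms(1) grid.edge_avoids_vertices unfolding annulus_cells_1 by blast
  then show ?thesis
    using assms(2,3) iA_cvl by (intro mult_eq_1) blast+
qed

end

section \<open>Transport of cells, valences and boundary to the completion\<close>

locale branched_annulus = separable_poly +
  fixes B :: "'b metric" and iB :: "complex \<Rightarrow> 'b" and G :: "complex \<times> complex \<times> real \<Rightarrow> 'b"
  assumes completion: "is_metric_completion (open_branched_annulus p) B iB"
    and homeo_G: "homeomorphic_map (top_of_set K) (mtopology_of B) G"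
    and G_J: "z \<notin> rts p \<Longrightarrow> G (J z) = iB z"
begin

abbreviation "X \<equiv> mtopology_of B"

lemma Hausdorff_X: "Hausdorff_space X"
  by (metis Metric_space.Hausdorff_space_mtopology Metric_space_mspace_mdist mtopology_of_def)

lemma inj_G: "inj_on G K"
  using homeomorphic_imp_injective_map[OF homeo_G] by simp

lemma image_G: "G ` K = mspace B"
  using homeomorphic_imp_surjective_map[OF homeo_G] by simp

lemma G_inverse:
  obtains H' where "continuous_map X (top_of_set K) H'" "\<And>x. x \<in> K \<Longrightarrow> H' (G x) = x" "\<And>y. y \<in> mspace B \<Longrightarrow> G (H' y) = y"
proof -
  obtain H' where "homeomorphic_maps (top_of_set K) X G H'"
    using homeo_G unfolding homeomorphic_map_maps by blast
  then have "continuous_map X (top_of_set K) H'" "\<forall>x\<in>K. H' (G x) = x" "\<forall>y\<in>mspace B. G (H' y) = y"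
    by (simp_all add: homeomorphic_maps_def)
  then show thesis
    using that by blast
qed

text \<open>The projection transported by \<open>G\<close> is one continuous extension of
  \<open>iA\<close> after \<open>p\<close>. The chosen one agrees with it on the dense image of
  \<open>iB\<close>, hence everywhere, because the annulus is Hausdorff.\<close>

lemma pA_G:
  assumes "x \<in> K"
  shows "pA p B iB (G x) = snd x"
proof -
  obtain H' where H': "continuous_map X (top_of_set K) H'" "\<And>x. x \<in> K \<Longrightarrow> H' (G x) = x" "\<And>y. y \<in> mspace B \<Longrightarrow> G (H' y) = y"
    by (rule G_inverse) blast
  let ?Q = "\<lambda>f. continuous_map X (mtopology_of annulus) f \<and> (\<forall>z\<in>- rts p. f (iB z) = iA (poly p z))"
  have "continuous_map (top_of_set K) (top_of_set annulus_set) snd"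
    using snd_K by (simp add: continuous_map_in_subtopology image_subset_iff_funcset continuous_on_snd)
  then have "continuous_map X (top_of_set annulus_set) (snd \<circ> H')"
    using H'(1) continuous_map_compose by blast
  moreover have "(snd \<circ> H') (iB z) = iA (poly p z)" if "z \<in> - rts p" for z
  proof -
    have "H' (iB z) = J z"
      using H'(2)[OF J_in_K] G_J that by fastforce
    then show ?thesis
      by (simp add: J_def)
  qed
  ultimately have Q1: "?Q (snd \<circ> H')"
    unfolding mtopology_annulus by blast
  then have Q2: "?Q (pA p B iB)"
    unfolding pA_def by (rule someI[of ?Q])
  have "G x \<in> X closure_of (iB ` (- rts p))"
    using completion assms image_G unfolding is_metric_completion_def mspace_oba by blast
  then have "pA p B iB (G x) = (snd \<circ> H') (G x)"
  proof (rule forall_in_closure_of_eq)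
    show "Hausdorff_space (mtopology_of annulus)"
      unfolding mtopology_annulus by (intro Hausdorff_space_subtopology) simp
    show "continuous_map X (mtopology_of annulus) (pA p B iB)"
      by (rule conjunct1[OF Q2])
    show "continuous_map X (mtopology_of annulus) (snd \<circ> H')"
      by (rule conjunct1[OF Q1])
    show "pA p B iB y = (snd \<circ> H') y" if "y \<in> iB ` (- rts p)" for y
      using that conjunct2[OF Q1] conjunct2[OF Q2] by auto
  qed
  then show ?thesis
    using H'(2)[OF assms] by simp
qed

lemma cells_eq: "branched_cells p B iB k = (\<Union>c\<in>annulus_cells p k. (image G) ` components (K \<inter> snd -` c))"
proof -
  have "connected_components_of (subtopology X {x \<in> mspace B. pA p B iB x \<in> c}) = (image G) ` components (K \<inter> snd -` c)" for c
  proof -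
    have eq: "{x \<in> mspace B. pA p B iB x \<in> c} = G ` (K \<inter> snd -` c)"
      using pA_G unfolding image_G[symmetric] by auto
    have "G ` (topspace (top_of_set K) \<inter> (K \<inter> snd -` c)) = topspace X \<inter> G ` (K \<inter> snd -` c)"
      using image_G by auto
    from homeomorphic_map_subtopologies[OF homeo_G this]
    have "homeomorphic_map (top_of_set (K \<inter> snd -` c)) (subtopology X (G ` (K \<inter> snd -` c))) G"
      by (simp add: subtopology_subtopology Int_absorb1)
    then show ?thesis
      unfolding eq by (simp add: homeomorphic_map_connected_components_of connected_components_of_top_of_set)
  qed
  then show ?thesis
    by (simp add: branched_cells_def)
qed

lemma vertices_eq: "branched_vertices p B iB = G ` (K \<inter> snd -` (U \<times> H))"
proof -
  have "\<Union>(\<Union>c\<in>annulus_cells p 0. (image G) ` components (K \<inter> snd -` c)) =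
      (\<Union>c\<in>annulus_cells p 0. G ` \<Union>(components (K \<inter> snd -` c)))"
    by blast
  also have "\<dots> = (\<Union>c\<in>annulus_cells p 0. G ` (K \<inter> snd -` c))"
    by (simp only: Union_components)
  also have "\<dots> = G ` (K \<inter> snd -` \<Union>(annulus_cells p 0))"
    by blast
  also have "\<Union>(annulus_cells p 0) = U \<times> H"
    unfolding annulus_cells_0 by auto
  finally show ?thesis
    unfolding branched_vertices_def cells_eq .
qed

text \<open>Sums \<open>ends_over_edge\<close> over all edges of the annulus; the factor
  \<open>mult \<kappa>\<close> is common to all of them and leaves the valence of the vertex
  below.\<close>

lemma valence_eq:
  assumes \<kappa>: "\<kappa> \<in> K" and uh: "snd \<kappa> = (u, h)" "u \<in> U" "h \<in> H"
  shows "valence p B iB (G \<kappa>) = mult \<kappa> * (2 + (if h < 1 then 1 else 0) + (if -1 < h then 1 else 0))"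
proof -
  have "U \<noteq> {}"
    using uh by auto
  let ?E = "annulus_cells p 1" and ?C = "\<lambda>c. components (K \<inter> snd -` c)"
  have finE: "finite ?E"
    unfolding annulus_cells_1 using grid.finite_edges[OF \<open>U \<noteq> {}\<close>] by blast
  have edge: "finite (?C c) \<and> (\<Sum>e\<in>?C c. ends X (G ` e) (G \<kappa>)) = mult \<kappa> * ends (top_of_set annulus_set) c (u, h)"
    if c: "c \<in> ?E" for c
  proof -
    have "c \<in> grid.vertical \<union> grid.horizontal"
      using c unfolding annulus_cells_1 .
    from grid.edge_map_exists[OF \<open>U \<noteq> {}\<close> this]
    obtain \<phi> where "is_edge_map (top_of_set annulus_set) c \<phi>" "c \<subseteq> annulus_set"
      unfolding annulus_set_def by blast
    then show ?thesis
      using ends_over_edge[OF _ _ _ _ Hausdorff_X homeo_G \<kappa>, of c \<phi>] mult_over_edge[OF c] d_ge_2 uh(1) by simp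
  qed
  have sub: "e \<subseteq> K" "e \<noteq> {}" "snd ` e \<subseteq> c" if "e \<in> ?C c" for e c
    using in_components_subset[OF that] in_components_nonempty[OF that] by auto
  have inj: "inj_on (image G) (?C c)" for c
    using inj_G sub by (intro inj_on_image) (meson Sup_le_iff inj_on_subset)
  \<comment> \<open>A lift projects into a single edge, so no 1-cell is counted for two edges of the
    annulus.\<close>
  have disj: "(image G) ` ?C c \<inter> (image G) ` ?C c' = {}" if "c \<in> ?E" "c' \<in> ?E" "c \<noteq> c'" for c c'
  proof (rule ccontr)
    assume "(image G) ` ?C c \<inter> (image G) ` ?C c' \<noteq> {}"
    then obtain e e' where e: "e \<in> ?C c" "e' \<in> ?C c'" "G ` e = G ` e'"
      by auto
    then have "e = e'"
      using inj_on_image_eq_iff[OF inj_G sub(1)[OF e(1)] sub(1)[OF e(2)]] by simp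
    then have "c \<inter> c' \<noteq> {}"
      using sub[OF e(1)] sub[OF e(2)] by blast
    then show False
      using grid.edges_disjoint that unfolding annulus_cells_1 by blast
  qed
  have "finite (branched_cells p B iB 1)"
    unfolding cells_eq using finE edge by auto
  moreover have "{(e, t). e \<in> branched_cells p B iB 1 \<and> t \<in> {0, 1} \<and> edge_map X e t = G \<kappa>} =
      Sigma (branched_cells p B iB 1) (\<lambda>e. {t \<in> {0, 1}. edge_map X e t = G \<kappa>})"
    by auto
  ultimately have "valence p B iB (G \<kappa>) = (\<Sum>e\<in>branched_cells p B iB 1. ends X e (G \<kappa>))"
    unfolding valence_def ends_def by (simp add: card_SigmaI)
  also have "\<dots> = (\<Sum>c\<in>?E. \<Sum>e\<in>(image G) ` ?C c. ends X e (G \<kappa>))"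
    unfolding cells_eq using finE edge disj by (intro sum.UNION_disjoint) auto
  also have "\<dots> = (\<Sum>c\<in>?E. \<Sum>e\<in>?C c. ends X (G ` e) (G \<kappa>))"
    using inj by (simp add: sum.reindex)
  also have "\<dots> = (\<Sum>c\<in>?E. mult \<kappa> * ends (top_of_set annulus_set) c (u, h))"
    using edge by simp
  also have "\<dots> = mult \<kappa> * (\<Sum>c\<in>grid.vertical \<union> grid.horizontal. ends (top_of_set annulus_set) c (u, h))"
    unfolding annulus_cells_1 by (simp add: sum_distrib_left)
  also have "(\<Sum>c\<in>grid.vertical \<union> grid.horizontal. ends (top_of_set annulus_set) c (u, h)) =
      2 + (if h < 1 then 1 else 0) + (if -1 < h then 1 else 0)"
    using grid.valence_in_cylinder[OF uh(2,3)] unfolding grid.cylinder_eq .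
  finally show ?thesis .
qed

text \<open>The part of \<open>K\<close> over a disc free of roots is open and is a homeomorphic
  copy of the disc, hence of the plane.\<close>

lemma interior_not_boundary:
  assumes z: "z \<notin> rts p"
  shows "iB z \<notin> surface_boundary X"
proof -
  obtain r where r: "r > 0" "ball z r \<subseteq> - rts p"
    using open_complement_rts z by (meson ComplI open_contains_ball)
  let ?N = "K \<inter> tube (ball z r)"
  have N: "?N = J ` ball z r"
  proof
    show "?N \<subseteq> J ` ball z r"
    proof
      fix x assume "x \<in> ?N"
      then have "x \<in> K" "x \<in> tube (ball z r)"
        by auto
      then show "x \<in> J ` ball z r"
        by (cases rule: tube_cases) (use r(2) in blast)+
    qed
    show "J ` ball z r \<subseteq> ?N"
    proof (rule image_subsetI)
      fix x assume x: "x \<in> ball z r"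
      then have "x \<notin> rts p"
        using r(2) by blast
      then show "J x \<in> ?N"
        using x J_in_K squash_in_tube[of x _ "ball z r"] by (simp add: J_def)
    qed
  qed
  have "openin (top_of_set K) ?N"
    by (intro openin_open_Int open_tube) simp
  then have op: "openin X (G ` ?N)"
    using homeomorphic_map_openness_eq[OF homeo_G] by (metis openin_imp_subset image_mono homeomorphic_map_openness homeo_G topspace_euclidean_subtopology)
  have "homeomorphism (ball z r) ?N J (\<lambda>x. unsquash (fst x))"
  proof (rule homeomorphismI)
    show "continuous_on (ball z r) J"
      using continuous_on_J r(2) continuous_on_subset by blast
    show "continuous_on ?N (\<lambda>x. unsquash (fst x))"
    proof (rule continuous_on_compose2[OF continuous_on_unsquash])
      show "fst ` ?N \<subseteq> ball 0 1"
        by (auto simp: tube_def)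
    qed (intro continuous_intros)
    show "J ` ball z r \<subseteq> ?N"
      using N by simp
    show "(\<lambda>x. unsquash (fst x)) ` ?N \<subseteq> ball z r"
      by (auto simp: tube_def)
    show "unsquash (fst (J x)) = x" for x
      by (simp add: J_def)
    show "J (unsquash (fst y)) = y" if "y \<in> ?N" for y
      using that unfolding N by (auto simp: J_def)
  qed
  then have "homeomorphic_maps (top_of_set (ball z r)) (top_of_set ?N) J (\<lambda>x. unsquash (fst x))"
    by (simp add: homeomorphic_maps_top_of_set)
  then have "top_of_set ?N homeomorphic_space top_of_set (ball z r)"
    using homeomorphic_space_def homeomorphic_space_sym by blast
  moreover have "ball z r homeomorphic (UNIV :: complex set)"
    using homeomorphic_ball01_UNIV homeomorphic_balls(1)[OF r(1), of 1 z 0] by (metis homeomorphic_trans zero_less_one)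
  then obtain f g where "homeomorphism (ball z r) (UNIV :: complex set) f g"
    unfolding homeomorphic_def by blast
  then have "homeomorphic_maps (top_of_set (ball z r)) (top_of_set (UNIV :: complex set)) f g"
    by (simp only: homeomorphic_maps_top_of_set)
  then have "top_of_set (ball z r) homeomorphic_space (euclidean :: complex topology)"
    unfolding homeomorphic_space_def by (auto simp: subtopology_UNIV)
  moreover have "subtopology X (G ` ?N) homeomorphic_space top_of_set ?N"
  proof -
    have "G ` (topspace (top_of_set K) \<inter> ?N) = topspace X \<inter> G ` ?N"
      using image_G by auto
    from homeomorphic_map_subtopologies[OF homeo_G this]
    have "homeomorphic_map (top_of_set ?N) (subtopology X (G ` ?N)) G"
      by (simp add: subtopology_subtopology Int_absorb1)
    then show ?thesis
      using homeomorphic_map_imp_homeomorphic_space homeomorphic_space_sym by blast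
  qed
  ultimately have "subtopology X (G ` ?N) homeomorphic_space (euclidean :: complex topology)"
    by (meson homeomorphic_space_trans)
  moreover have "iB z \<in> G ` ?N"
    unfolding N G_J[OF z, symmetric] using r(1) by simp
  ultimately show ?thesis
    using op unfolding surface_boundary_def by blast
qed

text \<open>Multiplicity 1 makes the projection injective near \<kappa>. A planar neighbourhood of
  \<open>G \<kappa>\<close> would thus embed into a closed ring in the plane with \<kappa> on the
  rim, while invariance of domain makes the image open.\<close>

lemma boundary_point:
  assumes \<kappa>: "\<kappa> \<in> K" "\<bar>snd (snd \<kappa>)\<bar> = 1"
  shows "G \<kappa> \<in> surface_boundary X"
proof (rule ccontr)
  assume "G \<kappa> \<notin> surface_boundary X"
  moreover have "G \<kappa> \<in> topspace X"
    using \<kappa>(1) image_G by auto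
  ultimately obtain V where V: "openin X V" "G \<kappa> \<in> V"
    "subtopology X V homeomorphic_space (euclidean :: complex topology)"
    unfolding surface_boundary_def by blast
  obtain f and g :: "complex \<Rightarrow> 'b" where fg: "homeomorphic_maps (subtopology X V) euclidean f g"
    using V(3) unfolding homeomorphic_space_def by blast
  obtain H' where H': "continuous_map X (top_of_set K) H'" "\<And>x. x \<in> K \<Longrightarrow> H' (G x) = x" "\<And>y. y \<in> mspace B \<Longrightarrow> G (H' y) = y"
    by (rule G_inverse) blast
  have g: "continuous_map euclidean X g" "\<And>x. f (g x) = x" "g (f (G \<kappa>)) = G \<kappa>"
    using fg V(2) \<open>G \<kappa> \<in> topspace X\<close> by (auto simp: homeomorphic_maps_def continuous_map_in_subtopology)
  define s where "s = H' \<circ> g"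
  have "continuous_map euclidean (top_of_set K) s"
    unfolding s_def using g(1) H'(1) continuous_map_compose by blast
  then have cont_s: "continuous_on UNIV s" and sK: "\<And>x. s x \<in> K"
    by (auto simp: continuous_map_in_subtopology)
  have inj_s: "x = y" if "s x = s y" for x y
  proof -
    have "g x \<in> mspace B" "g y \<in> mspace B"
      using g(1) by (auto simp: continuous_map_def Pi_iff)
    then have "g x = g y"
      using H'(3) that by (metis comp_apply s_def)
    then show ?thesis
      using g(2) by metis
  qed
  define x0 where "x0 = f (G \<kappa>)"
  have x0: "s x0 = \<kappa>"
    using g(3) H'(2)[OF \<kappa>(1)] by (simp add: s_def x0_def)
  have "mult \<kappa> = 1"
    using \<kappa>(2) by (simp add: mult_def)
  then obtain N where N: "open N" "\<kappa> \<in> N" "\<And>a. card {y \<in> K \<inter> N. snd y = a} \<le> 1"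
    using local_mult[OF \<kappa>(1)] by auto
  have inj_N: "x = y" if xy: "x \<in> K \<inter> N" "y \<in> K \<inter> N" "snd x = snd y" for x y
  proof -
    \<comment> \<open>An infinite set has \<open>card\<close> 0, so the bound by 1 says something
      only together with finiteness.\<close>
    have "finite {w \<in> K \<inter> N. snd w = snd y}"
      using fibre_degree(1)[of "snd y"] snd_K xy(2) by (auto intro: finite_subset[rotated])
    moreover have "{x, y} \<subseteq> {w \<in> K \<inter> N. snd w = snd y}"
      using xy by auto
    ultimately have "card {x, y} \<le> card {w \<in> K \<inter> N. snd w = snd y}"
      by (rule card_mono)
    also have "\<dots> \<le> 1"
      by (rule N(3))
    finally have "card {x, y} \<le> 1" .
    then show ?thesis
      by (cases "x = y") simp_all
  qed
  define S where "S = s -` N"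
  have "open S"
    unfolding S_def using N(1) cont_s by (rule open_vimage)
  \<comment> \<open>Radius \<open>2 + h\<close> draws the annulus as the ring between the circles of
    radius 1 and 3, with the boundary heights on these circles.\<close>
  define E where "E w = of_real (2 + snd w) * fst w" for w :: "complex \<times> real"
  have norm_E: "cmod (E w) = 2 + snd w" if "w \<in> annulus_set" for w
    using that by (auto simp: E_def annulus_set_def norm_mult simp del: of_real_add)
  have inj_E: "w = w'" if "w \<in> annulus_set" "w' \<in> annulus_set" "E w = E w'" for w w'
  proof -
    have "snd w = snd w'"
      using norm_E[OF that(1)] norm_E[OF that(2)] that(3) by simp
    moreover have "complex_of_real (2 + snd w) \<noteq> 0"
      using that(1) unfolding of_real_eq_0_iff by (auto simp: annulus_set_def)
    ultimately show ?thesis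
      using that(3) by (simp add: E_def prod_eq_iff)
  qed
  have A: "snd (s x) \<in> annulus_set" for x
    using sK snd_K by blast
  let ?F = "\<lambda>x. E (snd (s x))"
  have F_open: "open (?F ` S)"
  proof (rule invariance_of_domain)
    show "continuous_on S ?F"
      unfolding E_def by (intro continuous_intros continuous_on_subset[OF cont_s]) auto
    show "inj_on ?F S"
    proof (rule inj_onI)
      fix x y assume xy: "x \<in> S" "y \<in> S" "?F x = ?F y"
      then have "snd (s x) = snd (s y)"
        using inj_E A by blast
      then have "s x = s y"
        using inj_N[of "s x" "s y"] xy sK by (simp add: S_def)
      then show "x = y"
        by (rule inj_s)
    qed
  qed (rule \<open>open S\<close>)
  have F: "1 \<le> cmod (?F x)" "cmod (?F x) \<le> 3" for x
    using norm_E[OF A[of x]] A[of x] by (auto simp: annulus_set_def)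
  have F_sub: "?F ` S \<subseteq> cball 0 3" "?F ` S \<subseteq> - ball 0 1"
    by (rule image_subsetI, simp add: F not_less)+
  have "x0 \<in> S"
    using x0 N(2) by (simp add: S_def)
  \<comment> \<open>The open image lies in the interior of both closed sets, so the radius at
    \<kappa> is strictly between 1 and 3.\<close>
  then have "?F x0 \<in> interior (cball 0 3)" "?F x0 \<in> interior (- ball 0 1)"
    using interior_maximal[OF F_sub(1) F_open] interior_maximal[OF F_sub(2) F_open] by blast+
  then have "?F x0 \<in> ball 0 3" "?F x0 \<in> - cball 0 1"
    by (simp_all add: interior_complement)
  then have "1 < cmod (?F x0)" "cmod (?F x0) < 3"
    by auto
  then have "1 < 2 + snd (snd \<kappa>)" "2 + snd (snd \<kappa>) < 3"
    using norm_E[OF A[of x0]] x0 by auto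
  then show False
    using \<kappa>(2) by linarith
qed

end

theorem theorem2:
  fixes p :: "complex poly" and d :: nat
    and B :: "'b metric" and iB :: "complex \<Rightarrow> 'b" and v :: 'b
  assumes "degree p = d" and "d \<ge> 2" and "card (rts p) = d"
    and "is_metric_completion (open_branched_annulus p) B iB"
    and "v \<in> branched_vertices p B iB"
  shows "(v \<in> surface_boundary (mtopology_of B) \<longrightarrow> valence p B iB v = 3) \<and>
         (v \<notin> surface_boundary (mtopology_of B) \<longrightarrow>
            (\<exists>z\<in>- rts p. v = iB z) \<and>
            (\<forall>z\<in>- rts p. v = iB z \<longrightarrow>
               (\<forall>k. z \<in> cpt p \<and> order z (pderiv p) = k \<longrightarrow> valence p B iB v = 4 * (k + 1)) \<and>
               (z \<notin> cpt p \<longrightarrow> valence p B iB v = 4)))"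
proof -
  interpret separable_poly p d
    by (rule separable_poly.intro[OF assms(1-3)])
  obtain G where G: "homeomorphic_map (top_of_set K) (mtopology_of B) G" "\<forall>z. z \<notin> rts p \<longrightarrow> G (J z) = iB z"
    using completion_model[OF assms(4)] by blast
  interpret branched_annulus p d B iB G
    by (intro branched_annulus.intro branched_annulus_axioms.intro separable_poly_axioms assms(4) G(1))
      (use G(2) in blast)
  obtain \<kappa> u h where \<kappa>: "\<kappa> \<in> K" "v = G \<kappa>" "snd \<kappa> = (u, h)" "u \<in> U" "h \<in> H"
    using assms(5) unfolding vertices_eq by (auto simp: vimage_def)
  \<comment> \<open>The bracket is 4 for heights strictly between -1 and 1, and 3 at the two
    boundary heights, where moreover \<open>mult \<kappa>\<close> is 1.\<close>
  have val: "valence p B iB v = mult \<kappa> * (2 + (if h < 1 then 1 else 0) + (if -1 < h then 1 else 0))"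
    unfolding \<kappa>(2) by (rule valence_eq) (use \<kappa> in auto)
  from \<kappa>(1) show ?thesis
  proof (cases rule: K_cases)
    case (interior z0)
    have h: "\<bar>h\<bar> < 1"
      using height_J[OF interior(1)] interior(2) \<kappa>(3) by simp
    have v: "v = iB z0"
      using \<kappa>(2) interior G_J by simp
    have nb: "v \<notin> surface_boundary X"
      unfolding v by (rule interior_not_boundary[OF interior(1)])
    have val4: "valence p B iB v = 4 * (order z0 (pderiv p) + 1)"
      using val h mult_J[OF interior(1)] interior(2) by (simp add: abs_less_iff)
    \<comment> \<open>A vertex carries at most one label, so a statement about all labels reduces to
      \<open>z0\<close>.\<close>
    have uniq: "z = z0" if "z \<in> - rts p" "v = iB z" for z
    proof -
      have "G (J z) = G (J z0)"
        using that v G_J interior(1) by simp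
      then have "J z = J z0"
        using inj_onD[OF inj_G] J_in_K that(1) interior(1) by simp
      then show ?thesis
        by (simp add: inj_J)
    qed
    \<comment> \<open>Noncritical labels have order 0, so \<open>4 * (0 + 1)\<close> gives their
      valence.\<close>
    have ord0: "order z0 (pderiv p) = 0" if "z0 \<notin> cpt p"
      using that by (simp add: cpt_def order_root)
    have "(\<forall>k. z \<in> cpt p \<and> order z (pderiv p) = k \<longrightarrow> valence p B iB v = 4 * (k + 1)) \<and>
        (z \<notin> cpt p \<longrightarrow> valence p B iB v = 4)" if "z \<in> - rts p" "v = iB z" for z
      unfolding uniq[OF that] val4 using ord0 by simp
    moreover have "\<exists>z\<in>- rts p. v = iB z"
      using v interior(1) by blast
    ultimately show ?thesis
      using nb by blast
  next
    case (root a w)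
    then have "h = -1" "mult \<kappa> = 1"
      using \<kappa>(3) by (simp_all add: mult_def)
    then show ?thesis
      using val boundary_point[OF \<kappa>(1)] \<kappa>(2,3) by simp
  next
    case (infinity e)
    then have "h = 1" "mult \<kappa> = 1"
      using \<kappa>(3) by (simp_all add: mult_def)
    then show ?thesis
      using val boundary_point[OF \<kappa>(1)] \<kappa>(2,3) by simp
  qed
qed

end
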